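(* Let $n\ge 2$ and let $A$ be a maximal abelian subalgebra of the Cuntz algebra $\mathcal{O}_n$ such that $A\cap\mathcal{O}_n^0$ is maximal abelian in $\mathcal{O}_n^0$, $\sigma(A)\subset A$ and $\tilde{\sigma}(A)\subset A$. Then there is a unitary $u\in M_n(\mathbb{C})$ such that the automorphism $\alpha_U$ of $\mathcal{O}_n$ satisfies $\alpha_U(A)=\mathcal{D}$. Furthermore, $\alpha_U$ commutes with $\sigma$ and with $\tilde{\sigma}$.
   Context: $\mathcal{O}_n=C^*(s_1,\dots,s_n)$ is the Cuntz algebra, generated by isometries $s_1,\dots,s_n$ with $\sum_{i=1}^n s_is_i^*=1$. For a finite word $\mu=i_1\cdots i_k$ in $\{1,\dots,n\}$ write $s_\mu=s_{i_1}\cdots s_{i_k}$ (with $s_\emptyset=1$). The standard circle action is $\omega_t(s_i)=ts_i$, $t\in\mathbb{T}$, and $\mathcal{O}_n^0=\{x\in\mathcal{O}_n:\omega_t(x)=x\ \forall t\in\mathbb{T}\}$ is its fixed-point algebra. The canonical endomorphism is $\sigma(x)=\sum_{i=1}^n s_ixs_i^*$. The "second shift" is the endomorphism $\tilde{\sigma}(x)=\sum_{i,j,k=1}^n s_is_ks_i^*\,x\,s_js_k^*s_j^*$. $\mathcal{D}=C^*\{s_\mu s_\mu^*:\mu \text{ a finite word}\}$. For a unitary $u=[u_{ij}]\in M_n(\mathbb{C})$, put $U=\sum_{i,j}u_{ij}s_is_j^*$; $\alpha_U$ denotes the automorphism of $\mathcal{O}_n$ determined by $\alpha_U(s_i)=Us_i$,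 $i=1,\dots,n$. *)

theory Defs
  imports "HOL-Analysis.Analysis"
begin

text \<open>Abstract unital C*-algebras. The carrier is a type of class
  real_normed_algebra_1 and banach (so it is a real unital Banach algebra with
  norm 1 = 1); the complex scalar multiplication sc and the involution st are
  extra structure, subject to the C*-algebra axioms.\<close>

definition cstar_alg :: "('a::{real_normed_algebra_1,banach} \<Rightarrow> 'a) \<Rightarrow> (complex \<Rightarrow> 'a \<Rightarrow> 'a) \<Rightarrow> bool" where
  "cstar_alg st sc \<longleftrightarrow>
     (\<forall>r x. sc (complex_of_real r) x = r *\<^sub>R x) \<and>
     (\<forall>a b x. sc (a + b) x = sc a x + sc b x) \<and>
     (\<forall>a b x. sc (a * b) x = sc a (sc b x)) \<and>
     (\<forall>a x y. sc a (x + y) = sc a x + sc a y) \<and>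
     (\<forall>a x y. sc a (x * y) = sc a x * y \<and> sc a (x * y) = x * sc a y) \<and>
     (\<forall>a x. norm (sc a x) = cmod a * norm x) \<and>
     (\<forall>x y. st (x + y) = st x + st y) \<and>
     (\<forall>a x. st (sc a x) = sc (cnj a) (st x)) \<and>
     (\<forall>x y. st (x * y) = st y * st x) \<and>
     (\<forall>x. st (st x) = x) \<and>
     (\<forall>x. norm (st x * x) = (norm x)\<^sup>2)"

definition cstar_sub :: "('a::{real_normed_algebra_1,banach} \<Rightarrow> 'a) \<Rightarrow> (complex \<Rightarrow> 'a \<Rightarrow> 'a) \<Rightarrow> 'a set \<Rightarrow> bool" where
  "cstar_sub st sc S \<longleftrightarrow> 0 \<in> S \<and> closed S \<and>
     (\<forall>x\<in>S. \<forall>y\<in>S. x + y \<in> S \<and> x * y \<in> S) \<and>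
     (\<forall>a. \<forall>x\<in>S. sc a x \<in> S) \<and> (\<forall>x\<in>S. st x \<in> S)"

definition cstar_gen :: "('a::{real_normed_algebra_1,banach} \<Rightarrow> 'a) \<Rightarrow> (complex \<Rightarrow> 'a \<Rightarrow> 'a) \<Rightarrow> 'a set \<Rightarrow> 'a set" where
  "cstar_gen st sc G = \<Inter>{S. cstar_sub st sc S \<and> G \<subseteq> S}"

definition masa :: "('a::{real_normed_algebra_1,banach} \<Rightarrow> 'a) \<Rightarrow> (complex \<Rightarrow> 'a \<Rightarrow> 'a) \<Rightarrow> 'a set \<Rightarrow> 'a set \<Rightarrow> bool" where
  "masa st sc B A \<longleftrightarrow> cstar_sub st sc A \<and> A \<subseteq> B \<and> (\<forall>x\<in>A. \<forall>y\<in>A. x * y = y * x) \<and>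
     (\<forall>A'. cstar_sub st sc A' \<and> A \<subseteq> A' \<and> A' \<subseteq> B \<and> (\<forall>x\<in>A'. \<forall>y\<in>A'. x * y = y * x) \<longrightarrow> A' = A)"

definition star_endo :: "('a::{real_normed_algebra_1,banach} \<Rightarrow> 'a) \<Rightarrow> (complex \<Rightarrow> 'a \<Rightarrow> 'a) \<Rightarrow> 'a set \<Rightarrow> ('a \<Rightarrow> 'a) \<Rightarrow> bool" where
  "star_endo st sc B \<phi> \<longleftrightarrow> \<phi> ` B \<subseteq> B \<and>
     (\<forall>x\<in>B. \<forall>y\<in>B. \<phi> (x + y) = \<phi> x + \<phi> y \<and> \<phi> (x * y) = \<phi> x * \<phi> y) \<and>
     (\<forall>a. \<forall>x\<in>B. \<phi> (sc a x) = sc a (\<phi> x)) \<and> (\<forall>x\<in>B. \<phi> (st x) = st (\<phi> x))"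

definition star_auto :: "('a::{real_normed_algebra_1,banach} \<Rightarrow> 'a) \<Rightarrow> (complex \<Rightarrow> 'a \<Rightarrow> 'a) \<Rightarrow> 'a set \<Rightarrow> ('a \<Rightarrow> 'a) \<Rightarrow> bool" where
  "star_auto st sc B \<phi> \<longleftrightarrow> star_endo st sc B \<phi> \<and> bij_betw \<phi> B B"

definition cuntz_family :: "('a::{real_normed_algebra_1,banach} \<Rightarrow> 'a) \<Rightarrow> nat \<Rightarrow> (nat \<Rightarrow> 'a) \<Rightarrow> bool" where
  "cuntz_family st n s \<longleftrightarrow> (\<forall>i\<in>{1..n}. st (s i) * s i = 1) \<and> (\<Sum>i=1..n. s i * st (s i)) = 1"

text \<open>The Cuntz algebra O_n = C*(s_1,...,s_n) (unique up to isomorphism by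
  Cuntz's theorem, so it may be realised by any Cuntz family).\<close>
definition cuntz :: "('a::{real_normed_algebra_1,banach} \<Rightarrow> 'a) \<Rightarrow> (complex \<Rightarrow> 'a \<Rightarrow> 'a) \<Rightarrow> nat \<Rightarrow> (nat \<Rightarrow> 'a) \<Rightarrow> 'a set" where
  "cuntz st sc n s = cstar_gen st sc (s ` {1..n})"

definition smon :: "(nat \<Rightarrow> 'a::{real_normed_algebra_1,banach}) \<Rightarrow> nat list \<Rightarrow> 'a" where
  "smon s \<mu> = prod_list (map s \<mu>)"

definition gauge_fixed :: "('a::{real_normed_algebra_1,banach} \<Rightarrow> 'a) \<Rightarrow> (complex \<Rightarrow> 'a \<Rightarrow> 'a) \<Rightarrow> nat \<Rightarrow> (nat \<Rightarrow> 'a) \<Rightarrow> 'a set" where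
  "gauge_fixed st sc n s = {x \<in> cuntz st sc n s. \<forall>t. cmod t = 1 \<longrightarrow>
      (\<forall>\<omega>. star_auto st sc (cuntz st sc n s) \<omega> \<and> (\<forall>i\<in>{1..n}. \<omega> (s i) = sc t (s i)) \<longrightarrow> \<omega> x = x)}"

definition diag :: "('a::{real_normed_algebra_1,banach} \<Rightarrow> 'a) \<Rightarrow> (complex \<Rightarrow> 'a \<Rightarrow> 'a) \<Rightarrow> nat \<Rightarrow> (nat \<Rightarrow> 'a) \<Rightarrow> 'a set" where
  "diag st sc n s = cstar_gen st sc {smon s \<mu> * st (smon s \<mu>) | \<mu>. set \<mu> \<subseteq> {1..n}}"

definition cshift :: "('a::{real_normed_algebra_1,banach} \<Rightarrow> 'a) \<Rightarrow> nat \<Rightarrow> (nat \<Rightarrow> 'a) \<Rightarrow> 'a \<Rightarrow> 'a" where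
  "cshift st n s x = (\<Sum>i=1..n. s i * x * st (s i))"

definition cshift2 :: "('a::{real_normed_algebra_1,banach} \<Rightarrow> 'a) \<Rightarrow> nat \<Rightarrow> (nat \<Rightarrow> 'a) \<Rightarrow> 'a \<Rightarrow> 'a" where
  "cshift2 st n s x = (\<Sum>i=1..n. \<Sum>j=1..n. \<Sum>k=1..n.
      s i * s k * st (s i) * x * s j * st (s k) * st (s j))"

definition unitary_mat :: "nat \<Rightarrow> (nat \<Rightarrow> nat \<Rightarrow> complex) \<Rightarrow> bool" where
  "unitary_mat n u \<longleftrightarrow>
     (\<forall>i\<in>{1..n}. \<forall>j\<in>{1..n}. (\<Sum>k=1..n. cnj (u k i) * u k j) = (if i = j then 1 else 0)) \<and>
     (\<forall>i\<in>{1..n}. \<forall>j\<in>{1..n}. (\<Sum>k=1..n. u i k * cnj (u j k)) = (if i = j then 1 else 0))"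

definition unit_of_mat :: "('a::{real_normed_algebra_1,banach} \<Rightarrow> 'a) \<Rightarrow> (complex \<Rightarrow> 'a \<Rightarrow> 'a) \<Rightarrow> nat \<Rightarrow> (nat \<Rightarrow> 'a) \<Rightarrow> (nat \<Rightarrow> nat \<Rightarrow> complex) \<Rightarrow> 'a" where
  "unit_of_mat st sc n s u = (\<Sum>i=1..n. \<Sum>j=1..n. sc (u i j) (s i * st (s j)))"

end

theory Submission
  imports Defs "HOL-Real_Asymp.Real_Asymp" "HOL-Computational_Algebra.Fundamental_Theorem_Algebra"
begin

text \<open>Think of the fixed-point algebra \<open>F\<close> of the gauge action as the infinite tensor power of
  the algebra of \<open>n \<times> n\<close> matrices. The shift sends \<open>x\<close> to \<open>1 \<otimes> x\<close>, and iterating the second shift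
  pushes all tensor legs of \<open>a \<in> A \<inter> F\<close> except the first one to infinity. Since these elements
  commute with \<open>A \<inter> F\<close>, so does every matrix obtained from \<open>a\<close> by slicing with a functional on the
  other legs. Hence the matrices in \<open>A\<close> form a maximal abelian subalgebra of the first leg. An
  orthonormal eigenbasis of it is a Cuntz family \<open>t\<close> in the span of the \<open>s i\<close>, and \<open>\<alpha>\<close> maps \<open>t i\<close> to
  \<open>s i\<close>. By shift invariance \<open>A\<close> contains the diagonal of \<open>t\<close>, which is maximal abelian.

  The uniqueness theorem for Cuntz families, needed for \<open>\<alpha>\<close> and for the gauge action, rests on the
  following: a polynomial \<open>x\<close> in the generators with \<open>N\<close> homogeneous components satisfies
  \<open>norm x \<le> N * max\<close>, where \<open>max\<close> is the largest norm of a component, and no component has norm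
  larger than \<open>norm x\<close>. The norms of the components do not depend on the family, and applying this
  to \<open>(x\<^sup>* x)\<^sup>k\<close> with \<open>k\<close> tending to infinity removes the factor \<open>N\<close>.\<close>

section \<open>C*-algebras\<close>

text \<open>The algebra is given only by the C*-axioms and the Cuntz relations, so orthogonality of
  the ranges, the gauge automorphisms and the independence of norms from the family all have to be
  derived. This is done by norm estimates, with three substitutes for the usual tools. Positivity
  becomes a norm condition. The projection onto degree 0 becomes compression by isometries
  \<open>Z L m\<close> built from the word with \<open>m\<close> letters 1 followed by a 2; it kills
  every component whose degree is nonzero and at most \<open>m\<close> in modulus once
  \<open>L\<close> is large. Faithfulness of that projection, and of the vector functionals on the
  fixed-point algebra, becomes a power argument: let \<open>z\<close> be self-adjoint and
  annihilated in the limit, and let \<open>b\<close> be a polynomial close to \<open>z\<close>.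
  Powers of \<open>st b * b\<close> and of \<open>st (b - z) * (b - z)\<close> then differ by
  annihilated elements, so the norm of the first is at most that of the second times a factor that
  roots remove. This gives \<open>norm b \<le> norm (z - b)\<close>, and \<open>z = 0\<close>
  follows by letting \<open>b\<close> tend to \<open>z\<close>.\<close>

locale cstar =
  fixes st :: "'a::{real_normed_algebra_1,banach} \<Rightarrow> 'a"
    and sc :: "complex \<Rightarrow> 'a \<Rightarrow> 'a"
  assumes cstar_axioms: "cstar_alg st sc"
begin

section \<open>Scalars, involution and norms of isometries\<close>

lemma sc_of_real: "sc (complex_of_real r) x = r *\<^sub>R x"
  and sc_add_left: "sc (a + b) x = sc a x + sc b x"
  and sc_sc [simp]: "sc a (sc b x) = sc (a * b) x"
  and sc_add_right: "sc a (x + y) = sc a x + sc a y"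
  and mult_sc_left [simp]: "sc a x * y = sc a (x * y)"
  and mult_sc_right [simp]: "x * sc a y = sc a (x * y)"
  and norm_sc [simp]: "norm (sc a x) = cmod a * norm x"
  and st_add: "st (x + y) = st x + st y"
  and st_sc [simp]: "st (sc a x) = sc (cnj a) (st x)"
  and st_mult [simp]: "st (x * y) = st y * st x"
  and st_st [simp]: "st (st x) = x"
  and norm_st_mult: "norm (st x * x) = (norm x)\<^sup>2"
  using cstar_axioms unfolding cstar_alg_def by metis+

lemma sc_one [simp]: "sc 1 x = x"
  using sc_of_real[of 1] by simp

lemma sc_zero_left [simp]: "sc 0 x = 0"
  using sc_of_real[of 0] by simp

lemma sc_zero_right [simp]: "sc a 0 = 0"
  using sc_add_right[of a 0 0] by simp

lemma sc_minus_one: "sc (- 1) x = - x"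
  using sc_of_real[of "-1"] by simp

lemma sc_minus_left [simp]: "sc (- a) x = - sc a x"
  by (metis sc_sc sc_minus_one mult_minus1)

lemma sc_minus_right [simp]: "sc a (- x) = - sc a x"
  by (metis sc_sc sc_minus_one mult_minus1_right sc_minus_left)

lemma sc_diff_left: "sc (a - b) x = sc a x - sc b x"
  using sc_add_left[of a "-b" x] by simp

lemma sc_diff_right: "sc a (x - y) = sc a x - sc a y"
  using sc_add_right[of a x "-y"] by simp

lemma sc_sum_right: "sc a (sum f I) = (\<Sum>i\<in>I. sc a (f i))"
  by (induction I rule: infinite_finite_induct) (auto simp: sc_add_right)

lemma sc_sum_left: "sc (sum f I) x = (\<Sum>i\<in>I. sc (f i) x)"
  by (induction I rule: infinite_finite_induct) (auto simp: sc_add_left)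

lemma sc_eq_0_iff [simp]: "sc a x = 0 \<longleftrightarrow> a = 0 \<or> x = 0"
  using norm_sc[of a x] by (metis mult_eq_0_iff norm_eq_zero)

lemma sc_one_inject [simp]: "sc a 1 = sc b 1 \<longleftrightarrow> a = b"
  using sc_eq_0_iff[of "a - b" 1] by (simp add: sc_diff_left)

lemma st_zero [simp]: "st 0 = 0"
  using st_add[of 0 0] by simp

lemma st_minus [simp]: "st (- x) = - st x"
  using st_add[of x "-x"] by (simp add: eq_neg_iff_add_eq_0 add.commute)

lemma st_diff: "st (x - y) = st x - st y"
  using st_add[of x "-y"] by simp

lemma st_sum: "st (sum f I) = (\<Sum>i\<in>I. st (f i))"
  by (induction I rule: infinite_finite_induct) (auto simp: st_add)

lemma st_one [simp]: "st 1 = 1"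
  by (metis mult.left_neutral mult.right_neutral st_mult st_st)

lemma st_power [simp]: "st (x ^ k) = st x ^ k"
  by (induction k) (auto simp: power_commutes)

lemma st_scaleR [simp]: "st (r *\<^sub>R x) = r *\<^sub>R st x"
  by (metis sc_of_real st_sc complex_cnj_complex_of_real)

lemma norm_st [simp]: "norm (st x) = norm x"
proof -
  have *: "norm x \<le> norm (st x)" for x
  proof (cases "x = 0")
    case False
    have "(norm x)\<^sup>2 \<le> norm (st x) * norm x"
      by (metis norm_st_mult norm_mult_ineq)
    then show ?thesis using False by (simp add: power2_eq_square)
  qed auto
  from *[of x] *[of "st x"] show ?thesis by simp
qed

lemma st_mult_self_eq_0_iff [simp]: "st x * x = 0 \<longleftrightarrow> x = 0"
  using norm_st_mult[of x] by (metis mult_zero_right norm_eq_zero power_eq_0_iff)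

lemma bounded_linear_st: "bounded_linear st"
  by (rule bounded_linear_intro[where K = 1]) (auto simp: st_add)

lemma bounded_linear_sc: "bounded_linear (sc a)"
proof (rule bounded_linear_intro[where K = "cmod a"])
  show "sc a (r *\<^sub>R x) = r *\<^sub>R sc a x" for r x
    by (metis sc_of_real sc_sc mult.commute)
qed (auto simp: sc_add_right mult.commute)

lemma sc_bounded_linear_left: "bounded_linear (\<lambda>c. sc c x)"
proof (rule bounded_linear_intro[where K = "norm x"])
  show "sc (r *\<^sub>R c) x = r *\<^sub>R sc c x" for r c
    by (metis sc_of_real sc_sc scaleR_conv_of_real)
qed (auto simp: sc_add_left)

lemmas tendsto_st [tendsto_intros] = bounded_linear.tendsto[OF bounded_linear_st]
lemmas tendsto_sc [tendsto_intros] = bounded_linear.tendsto[OF bounded_linear_sc]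

text \<open>The C*-identity doubles exponents, so powers of two are enough to play the part of the
  spectral radius formula.\<close>

lemma norm_power_sa: "st x = x \<Longrightarrow> norm (x ^ (2 ^ m)) = norm x ^ (2 ^ m)"
proof (induction m)
  case (Suc m)
  have "x ^ (2 ^ Suc m) = st (x ^ (2 ^ m)) * x ^ (2 ^ m)"
    by (simp add: Suc.prems flip: power_add mult_2)
  then have "norm (x ^ (2 ^ Suc m)) = (norm (x ^ (2 ^ m)))\<^sup>2"
    by (simp only: norm_st_mult)
  then show ?case
    by (simp add: Suc mult.commute flip: power_mult)
qed auto

lemma norm_sq_power: "norm ((st x * x) ^ (2 ^ m)) = (norm x)\<^sup>2 ^ (2 ^ m)"
  by (subst norm_power_sa) (auto simp: norm_st_mult)

lemma norm_isom_mult: assumes "st v * v = 1" shows "norm (v * x) = norm x"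
proof -
  have "(norm (v * x))\<^sup>2 = norm (st x * (st v * v) * x)"
    by (simp add: mult.assoc flip: norm_st_mult)
  then show ?thesis using assms by (simp add: norm_st_mult)
qed

lemma isom_mult: assumes "st v * v = 1" "st w * w = 1" shows "st (v * w) * (v * w) = 1"
proof -
  have "st (v * w) * (v * w) = st w * (st v * v) * w" by (simp add: mult.assoc)
  then show ?thesis by (simp add: assms)
qed

lemma isom_power: "st v * v = 1 \<Longrightarrow> st (v ^ k) * v ^ k = 1"
  by (induction k) (simp_all only: power_Suc isom_mult power_0 st_one mult_1_left)

lemma norm_isom: "st v * v = 1 \<Longrightarrow> norm v = 1"
  using norm_isom_mult[of v 1] by simp

lemma norm_isom_le: assumes "st v * v = 1"
  shows "norm (x * v) \<le> norm x" "norm (st v * x) \<le> norm x" "norm (v * x) \<le> norm x"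
    "norm (x * st v) \<le> norm x"
  using norm_mult_ineq[of x v] norm_mult_ineq[of "st v" x] norm_mult_ineq[of x "st v"]
    norm_isom[OF assms] norm_isom_mult[OF assms] by auto

lemma norm_mult_coisom: assumes "st v * v = 1" shows "norm (x * st v) = norm x"
  using norm_isom_mult[OF assms, of "st x"] norm_st[of "x * st v"] by simp

section \<open>C*-subalgebras and generated C*-algebras\<close>

lemma subalgD:
  assumes "cstar_sub st sc B"
  shows "0 \<in> B" "closed B" "x \<in> B \<Longrightarrow> y \<in> B \<Longrightarrow> x + y \<in> B" "x \<in> B \<Longrightarrow> y \<in> B \<Longrightarrow> x * y \<in> B"
    "x \<in> B \<Longrightarrow> sc a x \<in> B" "x \<in> B \<Longrightarrow> st x \<in> B"
  using assms unfolding cstar_sub_def by auto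

lemma subalg_minus: "cstar_sub st sc B \<Longrightarrow> x \<in> B \<Longrightarrow> - x \<in> B"
  using subalgD(5)[of B x "-1"] by (simp)

lemma subalg_diff: "cstar_sub st sc B \<Longrightarrow> x \<in> B \<Longrightarrow> y \<in> B \<Longrightarrow> x - y \<in> B"
  using subalgD(3)[of B x "-y"] subalg_minus by simp

lemma subalg_sum: "cstar_sub st sc B \<Longrightarrow> (\<And>i. i \<in> I \<Longrightarrow> f i \<in> B) \<Longrightarrow> sum f I \<in> B"
  by (induction I rule: infinite_finite_induct) (auto simp: subalgD)

lemma subalg_power: "cstar_sub st sc B \<Longrightarrow> 1 \<in> B \<Longrightarrow> x \<in> B \<Longrightarrow> x ^ k \<in> B"
  by (induction k) (auto simp: subalgD)

lemma subalg_scaleR: "cstar_sub st sc B \<Longrightarrow> x \<in> B \<Longrightarrow> r *\<^sub>R x \<in> B"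
  by (metis sc_of_real subalgD(5))

lemma cstar_sub_gen: "cstar_sub st sc (cstar_gen st sc X)"
  unfolding cstar_gen_def cstar_sub_def by (auto intro!: closed_Inter)

lemma gen_subset: "X \<subseteq> cstar_gen st sc X"
  unfolding cstar_gen_def by auto

lemma gen_least: "cstar_sub st sc B \<Longrightarrow> X \<subseteq> B \<Longrightarrow> cstar_gen st sc X \<subseteq> B"
  unfolding cstar_gen_def by auto

lemma cstar_sub_closureI:
  assumes "0 \<in> P" "\<And>x y. x \<in> P \<Longrightarrow> y \<in> P \<Longrightarrow> x + y \<in> P" "\<And>x y. x \<in> P \<Longrightarrow> y \<in> P \<Longrightarrow> x * y \<in> P"
    "\<And>a x. x \<in> P \<Longrightarrow> sc a x \<in> P" "\<And>x. x \<in> P \<Longrightarrow> st x \<in> P"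
  shows "cstar_sub st sc (closure P)"
  unfolding cstar_sub_def
proof (intro conjI ballI allI)
  show "0 \<in> closure P" using assms(1) closure_subset by blast
  fix x y assume x: "x \<in> closure P"
  then obtain f where f: "\<And>i. f i \<in> P" "f \<longlonglongrightarrow> x" unfolding closure_sequential by blast
  show "st x \<in> closure P"
    unfolding closure_sequential by (rule exI[of _ "\<lambda>i. st (f i)"]) (auto intro!: assms f tendsto_st)
  show "sc a x \<in> closure P" for a
    unfolding closure_sequential by (rule exI[of _ "\<lambda>i. sc a (f i)"]) (auto intro!: assms f tendsto_sc)
  assume "y \<in> closure P"
  then obtain g where g: "\<And>i. g i \<in> P" "g \<longlonglongrightarrow> y" unfolding closure_sequential by blast
  show "x + y \<in> closure P"
    unfolding closure_sequential by (rule exI[of _ "\<lambda>i. f i + g i"]) (auto intro!: assms f g tendsto_add)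
  show "x * y \<in> closure P"
    unfolding closure_sequential by (rule exI[of _ "\<lambda>i. f i * g i"]) (auto intro!: assms f g tendsto_mult)
qed auto

section \<open>Commutants and maximal abelian subalgebras\<close>

lemma closed_commutant: "closed {y::'a. \<forall>x\<in>X. x * y = y * x}"
proof -
  have "{y. \<forall>x\<in>X. x * y = y * x} = (\<Inter>x\<in>X. {y. x * y = y * x})" by auto
  also have "closed \<dots>" by (intro closed_INT ballI closed_Collect_eq continuous_intros)
  finally show ?thesis .
qed

lemma cstar_sub_commutant:
  assumes B: "cstar_sub st sc B" and X: "\<And>x. x \<in> X \<Longrightarrow> st x \<in> X"
  shows "cstar_sub st sc {y \<in> B. \<forall>x\<in>X. x * y = y * x}"
proof -
  have cl: "closed {y \<in> B. \<forall>x\<in>X. x * y = y * x}"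
    using closed_Int[OF subalgD(2)[OF B] closed_commutant[of X]] by (simp add: Int_def)
  have st: "x * st y = st y * x" if "y \<in> B" "\<forall>x\<in>X. x * y = y * x" "x \<in> X" for x y
    using that X by (metis st_mult st_st)
  show ?thesis
    unfolding cstar_sub_def using cl st subalgD[OF B]
    by (auto simp: distrib_left distrib_right) (metis mult.assoc)
qed

text \<open>The bicommutant of \<open>A \<union> {x}\<close> inside \<open>B\<close> is an abelian C*-algebra containing both.\<close>
lemma masa_commutantD_sa:
  assumes m: "masa st sc B A" and B: "cstar_sub st sc B" and x: "x \<in> B" "st x = x"
    and c: "\<And>a. a \<in> A \<Longrightarrow> a * x = x * a"
  shows "x \<in> A"
proof -
  have A: "cstar_sub st sc A" "A \<subseteq> B" "\<And>x y. x \<in> A \<Longrightarrow> y \<in> A \<Longrightarrow> x * y = y * x"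
    and max: "\<And>A'. cstar_sub st sc A' \<Longrightarrow> A \<subseteq> A' \<Longrightarrow> A' \<subseteq> B \<Longrightarrow> (\<forall>x\<in>A'. \<forall>y\<in>A'. x * y = y * x) \<Longrightarrow> A' = A"
    using m unfolding masa_def by blast+
  define X where "X = insert x A"
  define C1 where "C1 = {y \<in> B. \<forall>z\<in>X. z * y = y * z}"
  define C2 where "C2 = {y \<in> B. \<forall>z\<in>C1. z * y = y * z}"
  have "st z \<in> X" if "z \<in> X" for z using that x subalgD(6)[OF A(1)] by (auto simp: X_def)
  then have C1: "cstar_sub st sc C1" unfolding C1_def by (intro cstar_sub_commutant B)
  then have C2: "cstar_sub st sc C2"
    unfolding C2_def by (intro cstar_sub_commutant B) (auto dest: subalgD)
  have XC1: "X \<subseteq> C1" unfolding C1_def X_def using c x A by auto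
  have XC2: "X \<subseteq> C2" unfolding C2_def using XC1 by (auto simp: C1_def)
  have "C2 \<subseteq> C1" unfolding C2_def using XC1 by (auto simp: C1_def)
  then have "\<forall>x\<in>C2. \<forall>y\<in>C2. x * y = y * x" by (auto simp: C2_def)
  moreover have "C2 \<subseteq> B" by (auto simp: C2_def)
  moreover have "A \<subseteq> C2" using XC2 by (auto simp: X_def)
  ultimately have "C2 = A" using C2 max by blast
  then show ?thesis using XC2 by (auto simp: X_def)
qed

text \<open>A C*-algebra containing \<open>x\<close> contains its adjoint, and an \<open>x\<close>
  that is not normal lies in no abelian one. Hence the reduction to the self-adjoint elements
  \<open>x + st x\<close> and \<open>sc \<i> (x - st x)\<close>.\<close>

lemma masa_commutantD:
  assumes m: "masa st sc B A" and B: "cstar_sub st sc B" and x: "x \<in> B"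
    and c: "\<And>a. a \<in> A \<Longrightarrow> a * x = x * a"
  shows "x \<in> A"
proof -
  have A: "cstar_sub st sc A" using m unfolding masa_def by blast
  have c': "a * st x = st x * a" if "a \<in> A" for a
    using c[OF subalgD(6)[OF A that]] by (metis st_mult st_st)
  have "x + st x \<in> A"
    by (rule masa_commutantD_sa[OF m B]) (use B x c c' in \<open>auto simp: subalgD st_add distrib_left distrib_right add.commute\<close>)
  moreover have "sc \<i> (x - st x) \<in> A"
    by (rule masa_commutantD_sa[OF m B])
       (use B x c c' in \<open>auto simp: subalgD subalg_diff st_add st_diff left_diff_distrib right_diff_distrib sc_diff_right\<close>)
  ultimately have "sc (1/2) (x + st x) + sc (-\<i>/2) (sc \<i> (x - st x)) \<in> A"
    using subalgD(3,5)[OF A] by blast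
  also have "sc (1/2) (x + st x) + sc (-\<i>/2) (sc \<i> (x - st x)) = sc (1/2 + 1/2) x"
    by (simp only: sc_add_left) (simp add: sc_add_right sc_diff_right)
  finally show ?thesis by simp
qed

text \<open>\<open>N\<close> stands for a left ideal of elements annihilated in the limit. In the
  telescoping, powers of \<open>?Y\<close> occur only on the left, so right multiplication by
  \<open>b\<close> and \<open>st b\<close> is all that \<open>N\<close> must tolerate.\<close>

lemma square_power_diff:
  assumes add: "\<And>x y. x \<in> N \<Longrightarrow> y \<in> N \<Longrightarrow> x + y \<in> N" and left: "\<And>a x. x \<in> N \<Longrightarrow> a * x \<in> N"
    and right: "\<And>x. x \<in> N \<Longrightarrow> x * b \<in> N" "\<And>x. x \<in> N \<Longrightarrow> x * st b \<in> N"
    and z: "z \<in> N" "st z = z"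
  shows "(st b * b) ^ k - (st (b - z) * (b - z)) ^ k \<in> N"
proof (induction k)
  case 0
  show ?case using left[OF z(1), of 0] by simp
next
  case (Suc k)
  let ?X = "st b * b" and ?Y = "st (b - z) * (b - z)"
  have "?X - ?Y = z * b + st (b - z) * z" by (simp add: z(2) st_diff algebra_simps)
  then have XY: "?X - ?Y \<in> N" using add[OF right(1)[OF z(1)] left[OF z(1)]] by simp
  have "?X ^ Suc k - ?Y ^ Suc k = (?X ^ k - ?Y ^ k) * st b * b + ?Y ^ k * (?X - ?Y)"
    by (simp only: power_Suc2) (simp add: left_diff_distrib right_diff_distrib mult.assoc)
  then show ?case using add[OF right(1)[OF right(2)[OF Suc]] left[OF XY]] by simp
qed

lemma zero_if_approx:
  assumes "\<And>e. e > 0 \<Longrightarrow> \<exists>b. norm (z - b) < e \<and> norm b \<le> norm (z - b)" shows "z = 0"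
proof (rule ccontr)
  assume "z \<noteq> 0"
  then obtain b where b: "norm (z - b) < norm z / 2" "norm b \<le> norm (z - b)"
    using assms[of "norm z / 2"] by auto
  have "norm z \<le> norm b + norm (z - b)" using norm_triangle_ineq[of b "z - b"] by simp
  then show False using b by simp
qed

lemma closed_scalars: "closed (range (\<lambda>c. sc c 1))"
proof -
  have "closed ((\<lambda>c. sc c 1) ` UNIV)"
    by (rule complete_imp_closed, rule complete_isometric_image[of 1])
       (auto intro: sc_bounded_linear_left complete_UNIV)
  then show ?thesis by simp
qed

end

text \<open>A factor growing only linearly in the exponent disappears under roots, since
  \<open>q ^ k / k\<close> is unbounded for \<open>q > 1\<close>.\<close>

lemma le_of_power_le:
  fixes a b C :: real
  assumes "0 \<le> a" "0 \<le> b" and le: "\<And>m. a ^ (2 ^ m) \<le> C * 2 ^ m * b ^ (2 ^ m)"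
  shows "a \<le> b"
proof (rule ccontr)
  assume "\<not> a \<le> b"
  then have ab: "b < a" by simp
  show False
  proof (cases "b = 0")
    case True
    then show ?thesis using le[of 0] ab by simp
  next
    case False
    then have b: "b > 0" using assms by simp
    define q where "q = a / b"
    have q: "q > 1" using ab b by (simp add: q_def)
    have "q ^ (2 ^ m) \<le> C * 2 ^ m" for m
      using le[of m] b by (simp add: q_def power_divide field_simps)
    moreover have "filterlim (\<lambda>k::nat. q ^ k / real k) at_top sequentially"
      using q by real_asymp
    then have "eventually (\<lambda>k::nat. q ^ k / real k > C) sequentially"
      by (simp add: filterlim_at_top_dense)
    then obtain K where K: "\<And>k. k \<ge> K \<Longrightarrow> q ^ k / real k > C" by (auto simp: eventually_at_top_linorder)
    have "K \<le> 2 ^ K" by (simp add: less_imp_le)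
    from K[OF this] have "q ^ (2 ^ K) > C * 2 ^ K" by (simp add: field_simps)
    ultimately show False using not_le by blast
  qed
qed

section \<open>Fourier coefficients, positivity and contractivity\<close>

context cstar
begin

text \<open>The average over the \<open>M\<close>-th roots of unity, weighted by the conjugate of
  \<open>z ^ j\<close>, isolates coefficient \<open>j\<close> exactly because all exponents lie
  below \<open>M\<close>. A finite sum thus replaces the integral over the circle.\<close>

lemma fourier_coeff_le:
  assumes le: "\<And>z. cmod z = 1 \<Longrightarrow> norm (\<Sum>i<M. sc (z ^ i) (x i)) \<le> C" and j: "j < M"
  shows "norm (x j) \<le> C"
proof -
  define w where "w = (\<lambda>i::nat. cis (2 * pi * (real i - real j) / real M))"
  have M: "M > 0" using j by simp
  have w: "(\<Sum>r<M. w i ^ r) = (if i = j then of_nat M else 0)" if "i < M" for i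
  proof (cases "i = j")
    case False
    have "w i \<noteq> 1"
    proof
      assume "w i = 1"
      then have "cos (2 * pi * (real i - real j) / real M) = 1"
        unfolding w_def by (metis cis.simps(1) one_complex.simps(1))
      then obtain k :: int where "2 * pi * (real i - real j) / real M = k * 2 * pi"
        using cos_one_2pi_int by auto
      then have "2 * pi * (real i - real j - k * real M) = 0" using M by (simp add: field_simps)
      then have "real i - real j = k * real M" by simp
      then have "real_of_int (int i - int j) = real_of_int (k * int M)" by simp
      then have "int i - int j = k * int M" by (simp only: of_int_eq_iff)
      moreover have "\<bar>int i - int j\<bar> < int M" using that j by linarith
      ultimately have "\<bar>k\<bar> * int M < int M" by (simp add: abs_mult)
      then have "k = 0" using M by simp
      then show False using \<open>int i - int j = k * int M\<close> False by simp
    qed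
    moreover have "w i ^ M = 1"
    proof -
      have "w i ^ M = cis (2 * pi * of_int (int i - int j))"
        unfolding w_def Complex.DeMoivre using M by (intro arg_cong[where f = cis]) (simp add: field_simps)
      then show ?thesis by (simp only: cis_multiple_2pi[OF Ints_of_int])
    qed
    ultimately show ?thesis using False by (simp add: sum_gp_strict)
  qed (simp add: w_def)
  define \<zeta> where "\<zeta> = cis (2 * pi / real M)"
  have wz: "cnj (\<zeta> ^ r) ^ j * (\<zeta> ^ r) ^ i = w i ^ r" for i r
    unfolding w_def \<zeta>_def
    by (simp add: Complex.DeMoivre cis_cnj cis_mult, intro arg_cong[where f = cis])
       (simp add: field_simps diff_divide_distrib)
  have "real M *\<^sub>R x j = (\<Sum>i<M. sc (\<Sum>r<M. w i ^ r) (x i))"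
    using j by (subst sum.cong[OF refl, of _ _ "\<lambda>i. if i = j then sc (of_nat M) (x i) else 0"])
      (auto simp: w simp flip: sc_of_real)
  also have "\<dots> = (\<Sum>r<M. sc (cnj (\<zeta> ^ r) ^ j) (\<Sum>i<M. sc ((\<zeta> ^ r) ^ i) (x i)))"
    unfolding sc_sum_right sc_sum_left sc_sc wz by (rule sum.swap)
  also have "norm \<dots> \<le> (\<Sum>r<M. C)"
    by (rule sum_norm_le) (auto simp: norm_power \<zeta>_def intro!: le)
  finally show ?thesis using M by simp
qed

text \<open>The coefficient of interest is the linear one. The upper limit \<open>k + 2\<close>
  keeps index 1 in range also for \<open>k = 0\<close>.\<close>

lemma power_one_plus_coeffs:
  "\<exists>x. x 0 = 1 \<and> x 1 = of_nat k * h \<and> (\<forall>j\<ge>k+2. x j = 0) \<and>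
     (\<forall>z. (1 + sc z h) ^ k = (\<Sum>j<k+2. sc (z ^ j) (x j)))"
proof (induction k)
  case 0
  show ?case by (intro exI[of _ "\<lambda>j. if j = 0 then 1 else 0"]) (auto simp: numeral_2_eq_2)
next
  case (Suc k)
  then obtain x where x: "x 0 = 1" "x 1 = of_nat k * h" "\<And>j. j \<ge> k+2 \<Longrightarrow> x j = 0"
    "\<And>z. (1 + sc z h) ^ k = (\<Sum>j<k+2. sc (z ^ j) (x j))" by blast
  define y where "y = (\<lambda>j. x j + (case j of 0 \<Rightarrow> 0 | Suc i \<Rightarrow> h * x i))"
  have "(1 + sc z h) ^ Suc k = (\<Sum>j<Suc k + 2. sc (z ^ j) (y j))" for z
  proof -
    have "(\<Sum>j<Suc k + 2. sc (z ^ j) (y j)) = (\<Sum>j<Suc (k+2). sc (z ^ j) (x j)) +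
        (\<Sum>j<Suc (k+2). sc (z ^ j) (case j of 0 \<Rightarrow> 0 | Suc i \<Rightarrow> h * x i))"
      by (simp only: y_def sc_add_right sum.distrib add_Suc)
    also have "(\<Sum>j<Suc (k+2). sc (z ^ j) (x j)) = (1 + sc z h) ^ k"
      by (simp add: x(4) x(3))
    also have "(\<Sum>j<Suc (k+2). sc (z ^ j) (case j of 0 \<Rightarrow> 0 | Suc i \<Rightarrow> h * x i)) = sc z h * (1 + sc z h) ^ k"
      unfolding sum.lessThan_Suc_shift x(4) sum_distrib_left by (simp add: mult.commute mult.left_commute)
    finally show ?thesis by (simp add: distrib_right)
  qed
  moreover have "y 0 = 1" "y 1 = of_nat (Suc k) * h" "\<forall>j\<ge>Suc k + 2. y j = 0"
    using x(1-3) by (auto simp: y_def distrib_right add.commute split: nat.split)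
  ultimately show ?case by blast
qed

text \<open>No complex disc around 1 fits into the unit ball: all powers
  \<open>(1 + sc z h) ^ k\<close> would stay in the ball, while their linear coefficient grows like
  \<open>k\<close>.\<close>

lemma zero_if_contractive_disc:
  assumes r: "r > 0" and le: "\<And>z. cmod z \<le> r \<Longrightarrow> norm (1 + sc z h) \<le> 1"
  shows "h = 0"
proof -
  have *: "real k * r * norm h \<le> 1" for k
  proof -
    obtain x where x: "x 1 = of_nat k * sc r h"
      "\<And>z. (1 + sc z (sc r h)) ^ k = (\<Sum>j<k+2. sc (z ^ j) (x j))"
      using power_one_plus_coeffs[of k "sc r h"] by blast
    have "norm (x 1) \<le> 1"
    proof (rule fourier_coeff_le)
      fix z :: complex assume z: "cmod z = 1"
      have "norm (1 + sc z (sc r h)) \<le> 1" using r z by (auto intro!: le simp: norm_mult)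
      then show "norm (\<Sum>j<k+2. sc (z ^ j) (x j)) \<le> 1"
        unfolding x(2)[symmetric] by (meson norm_power_ineq order_trans power_le_one norm_ge_zero)
    qed simp
    moreover have "of_nat k * sc r h = real k *\<^sub>R sc r h" by (metis scaleR_conv_of_real of_real_of_nat_eq)
    ultimately show ?thesis using x r by (simp)
  qed
  show ?thesis
  proof (rule ccontr)
    assume "h \<noteq> 0"
    then have "r * norm h > 0" using r by simp
    then obtain k :: nat where "real k * (r * norm h) > 1" using reals_Archimedean3 by blast
    with *[of k] show False by (simp add: mult.assoc)
  qed
qed

text \<open>The condition \<open>norm (1 - b) \<le> 1\<close> is a substitute for positivity of \<open>b\<close>.\<close>
lemma sum_pos_eq_0:
  assumes I: "finite I" and j: "j \<in> I" and s0: "(\<Sum>i\<in>I. b i) = 0"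
    and sa: "\<And>i. i \<in> I \<Longrightarrow> st (b i) = b i" and le: "\<And>i. i \<in> I \<Longrightarrow> norm (1 - b i) \<le> 1"
  shows "b j = 0"
proof -
  define N where "N = real (card I)"
  have N: "N \<ge> 1" using I j unfolding N_def by (metis card_gt_0_iff empty_iff Suc_leI One_nat_def of_nat_1 of_nat_le_iff)
  define g where "g = (1 / N) *\<^sub>R b j"
  have card: "real (card (I - {j})) = N - 1" using I j N unfolding N_def by (simp add: card_Diff_singleton of_nat_diff)
  \<comment> \<open>As the \<open>b i\<close> sum to 0, \<open>1 + g\<close> is the average of 1 and
    the \<open>N - 1\<close> contractions \<open>1 - b i\<close> with \<open>i \<noteq> j\<close>.
    Likewise \<open>1 - g\<close> averages \<open>N - 1\<close> copies of 1 and
    \<open>1 - b j\<close>.\<close>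
  have "N *\<^sub>R (1 + g) = 1 + (\<Sum>i\<in>I - {j}. 1 - b i)"
  proof -
    have "(\<Sum>i\<in>I - {j}. b i) = - b j" using sum.remove[OF I j, of b] s0 by (simp add: eq_neg_iff_add_eq_0 add.commute)
    then have "(\<Sum>i\<in>I - {j}. 1 - b i) = of_nat (card (I - {j})) + b j"
      by (simp only: sum_subtractf) simp
    also have "of_nat (card (I - {j})) = real (card (I - {j})) *\<^sub>R (1::'a)"
      by (simp add: scaleR_conv_of_real)
    finally have "(\<Sum>i\<in>I - {j}. 1 - b i) = (N - 1) *\<^sub>R 1 + b j"
      by (simp only: card)
    then show ?thesis using N by (simp add: g_def scaleR_right_distrib scaleR_left_diff_distrib)
  qed
  also have "norm \<dots> \<le> 1 + (\<Sum>i\<in>I - {j}. 1)"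
    using norm_triangle_ineq[of 1 "\<Sum>i\<in>I - {j}. 1 - b i"] sum_norm_le[of "I - {j}" "\<lambda>i. 1 - b i" "\<lambda>_. 1"] le
    by auto
  also have "\<dots> = N" using card by simp
  finally have p: "norm (1 + g) \<le> 1" using N by simp
  have "N *\<^sub>R (1 - g) = (N - 1) *\<^sub>R 1 + (1 - b j)"
    using N by (simp add: g_def scaleR_right_diff_distrib scaleR_left_diff_distrib)
  also have "norm \<dots> \<le> (N - 1) + 1"
    using norm_triangle_ineq[of "(N - 1) *\<^sub>R 1" "1 - b j"] le[OF j] N by simp
  finally have m: "norm (1 - g) \<le> 1" using N by simp
  have sag: "st g = g" using sa[OF j] by (simp add: g_def)
  \<comment> \<open>The bounds for \<open>1 + g\<close> and \<open>1 - g\<close> control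
    \<open>1 + g * g\<close>, which is the square modulus of \<open>1 + sc \<i> g\<close> and of
    \<open>1 - sc \<i> g\<close>. So the imaginary directions follow from the real ones.\<close>
  have "2 *\<^sub>R (1 + g * g) = (1 + g) * (1 + g) + (1 - g) * (1 - g)"
    by (simp add: algebra_simps scaleR_2)
  also have "norm \<dots> \<le> 1 * 1 + 1 * 1"
    using norm_mult_ineq[of "1 + g" "1 + g"] norm_mult_ineq[of "1 - g" "1 - g"] p m
      mult_mono[OF p p] mult_mono[OF m m]
    by (intro norm_triangle_le add_mono) (auto intro: order_trans)
  finally have gg: "norm (1 + g * g) \<le> 1" by simp
  have i: "norm (1 + sc \<i> g) \<le> 1" "norm (1 - sc \<i> g) \<le> 1"
  proof -
    have "st (1 + sc \<i> g) * (1 + sc \<i> g) = 1 + g * g" "st (1 - sc \<i> g) * (1 - sc \<i> g) = 1 + g * g"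
      by (simp_all add: st_add st_diff sag algebra_simps sc_diff_right sc_add_right)
    with gg have "(norm (1 + sc \<i> g))\<^sup>2 \<le> 1" "(norm (1 - sc \<i> g))\<^sup>2 \<le> 1"
      by (metis norm_st_mult)+
    then show "norm (1 + sc \<i> g) \<le> 1" "norm (1 - sc \<i> g) \<le> 1" by (simp_all add: power_le_one_iff)
  qed
  \<comment> \<open>The bound is known for \<open>z\<close> equal to 1, -1, \<open>\<i>\<close> and
    \<open>-\<i>\<close>. It is convex in \<open>z\<close>, and the convex hull of these points
    contains the disc of radius 1/2.\<close>
  have "norm (1 + sc z g) \<le> 1" if z: "cmod z \<le> 1/2" for z
  proof -
    define a b where "a = \<bar>Re z\<bar>" and "b = \<bar>Im z\<bar>"
    have ab: "0 \<le> a" "0 \<le> b" "a + b \<le> 1"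
      using abs_Re_le_cmod[of z] abs_Im_le_cmod[of z] z by (auto simp: a_def b_def)
    define s t where "s = (if Re z \<ge> 0 then 1 else -1 :: real)" and "t = (if Im z \<ge> 0 then 1 else -1 :: real)"
    have "norm (1 + s *\<^sub>R g) \<le> 1" using p m by (auto simp: s_def)
    moreover have "norm (1 + t *\<^sub>R sc \<i> g) \<le> 1" using i by (auto simp: t_def)
    moreover have "1 + sc z g = (1 - a - b) *\<^sub>R 1 + (a *\<^sub>R (1 + s *\<^sub>R g) + b *\<^sub>R (1 + t *\<^sub>R sc \<i> g))"
    proof -
      have "sc z g = sc (complex_of_real (a * s) + complex_of_real (b * t) * \<i>) g"
        by (rule arg_cong[where f = "\<lambda>u. sc u g"]) (auto simp: a_def b_def s_def t_def complex_eq_iff)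
      also have "\<dots> = (a * s) *\<^sub>R g + (b * t) *\<^sub>R sc \<i> g"
        by (simp only: sc_add_left sc_sc[symmetric] sc_of_real)
      finally show ?thesis by (simp add: algebra_simps)
    qed
    ultimately have "norm (1 + sc z g) \<le> (1 - a - b) * 1 + (a * 1 + b * 1)"
      using ab by (simp only:) (intro norm_triangle_le add_mono; simp add: mult_left_le)
    then show ?thesis by simp
  qed
  then have "g = 0" by (intro zero_if_contractive_disc[of "1/2"]) auto
  then show ?thesis using N by (simp add: g_def)
qed

text \<open>\<open>b = sqrt (1 - a\<^sup>2)\<close> by the binomial series.\<close>
lemma sqrt_one_minus_square:
  assumes B: "cstar_sub st sc B" "1 \<in> B" and a: "a \<in> B" "st a = a" "norm a < 1"
  shows "\<exists>b\<in>B. st b = b \<and> a * b = b * a \<and> b * b = 1 - a * a"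
proof -
  define c where "c = (\<lambda>k. ((1/2::real) gchoose k) * (- 1) ^ k)"
  define t where "t = (\<lambda>k. c k *\<^sub>R (a * a) ^ k)"
  have na: "norm (a * a) < 1" using a(2,3) norm_st_mult[of a] by (simp add: power_less_one_iff abs_square_less_1)
  have "summable (\<lambda>k. norm (((1/2::real) gchoose k) * (norm (a * a)) ^ k))"
    by (rule abs_summable_in_conv_radius) (use na in \<open>auto simp: conv_radius_gchoose\<close>)
  moreover have "norm (norm (t k)) \<le> norm (((1/2::real) gchoose k) * (norm (a * a)) ^ k)" for k
    using norm_power_ineq[of "a * a" k] by (simp add: t_def c_def abs_mult mult_left_mono power_abs)
  ultimately have snt: "summable (\<lambda>k. norm (t k))"
    by (rule summable_comparison_test'[where N = 0])
  then have st': "summable t" by (rule summable_norm_cancel)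
  define b where "b = suminf t"
  have lim: "(\<lambda>n. \<Sum>k<n. t k) \<longlonglongrightarrow> b" using summable_LIMSEQ[OF st'] by (simp add: b_def)
  have tB: "t k \<in> B" for k unfolding t_def by (intro subalg_scaleR subalg_power subalgD B a)
  have "b \<in> B"
    by (rule closed_sequentially[OF subalgD(2)[OF B(1)] _ lim]) (intro subalg_sum B tB)
  moreover have "st b = b"
  proof -
    have "st (t k) = t k" for k using a by (simp add: t_def)
    then show ?thesis unfolding b_def using bounded_linear.suminf[OF bounded_linear_st st'] by simp
  qed
  moreover have "a * b = b * a"
  proof -
    have "a * t k = t k * a" for k unfolding t_def
      by (simp add: power_commuting_commutes mult.assoc)
    then show ?thesis
      unfolding b_def using suminf_mult[OF st', of a] suminf_mult2[OF st', of a] by simp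
  qed
  moreover have "b * b = 1 - a * a"
  proof -
    \<comment> \<open>By Vandermonde convolution the Cauchy square of the series with exponent 1/2
      is the series with exponent 1, which ends after its linear term.\<close>
    have "(\<Sum>i\<le>k. t i * t (k - i)) = ((1 gchoose k) * (- 1) ^ k) *\<^sub>R (a * a) ^ k" for k
    proof -
      have "(\<Sum>i\<le>k. t i * t (k - i)) = (\<Sum>i\<le>k. (((1/2::real) gchoose i) * ((1/2) gchoose (k - i)) * (-1) ^ k) *\<^sub>R (a * a) ^ k)"
        by (rule sum.cong) (auto simp: t_def c_def simp flip: power_add)
      also have "\<dots> = ((\<Sum>i\<le>k. ((1/2::real) gchoose i) * ((1/2) gchoose (k - i))) * (-1) ^ k) *\<^sub>R (a * a) ^ k"
        by (simp add: sum_distrib_right scaleR_sum_left)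
      finally show ?thesis using gbinomial_Vandermonde[of "1/2::real" "1/2" k] by (simp add: atLeast0AtMost)
    qed
    then have "b * b = (\<Sum>k. ((1 gchoose k) * (- 1) ^ k) *\<^sub>R (a * a) ^ k)"
      unfolding b_def by (subst Cauchy_product[OF snt snt]) simp
    also have "\<dots> = (\<Sum>k\<in>{..1}. ((1 gchoose k) * (- 1) ^ k) *\<^sub>R (a * a) ^ k)"
    proof (rule suminf_finite)
      fix k :: nat assume "k \<notin> {..1}"
      then have "(1::real) gchoose k = 0" using binomial_gbinomial[of 1 k, where ?'a = real] by (simp add: binomial_eq_0)
      then show "((1 gchoose k) * (- 1) ^ k) *\<^sub>R (a * a) ^ k = 0" by simp
    qed simp
    also have "\<dots> = 1 - a * a" by (simp add: numeral_2_eq_2)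
    finally show ?thesis .
  qed
  ultimately show ?thesis by blast
qed

text \<open>A self-adjoint strict contraction \<open>a\<close> is the real part of the unitary
  \<open>a + \<i> sqrt (1 - a\<^sup>2)\<close>, and a unital *-homomorphism maps unitaries to unitaries.\<close>
lemma star_endo_contractive:
  assumes B: "cstar_sub st sc B" "1 \<in> B" and \<phi>: "star_endo st sc B \<phi>" and \<phi>1: "\<phi> 1 = 1" and x: "x \<in> B"
  shows "norm (\<phi> x) \<le> norm x"
proof -
  have add: "\<phi> (x + y) = \<phi> x + \<phi> y" and mul: "\<phi> (x * y) = \<phi> x * \<phi> y" if "x \<in> B" "y \<in> B" for x y
    using \<phi> that unfolding star_endo_def by auto
  have scl: "\<phi> (sc c x) = sc c (\<phi> x)" and star: "\<phi> (st x) = st (\<phi> x)" if "x \<in> B" for x c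
    using \<phi> that unfolding star_endo_def by auto
  have *: "norm (\<phi> a) \<le> 1" if a: "a \<in> B" "st a = a" "norm a < 1" for a
  proof -
    obtain b where b: "b \<in> B" "st b = b" "a * b = b * a" "b * b = 1 - a * a"
      using sqrt_one_minus_square[OF B a] by blast
    define u where "u = a + sc \<i> b"
    have uB: "u \<in> B" "st u \<in> B" using a b B by (auto simp: u_def intro!: subalgD)
    have uu: "st u * u = 1"
      using b a by (simp add: u_def st_add algebra_simps sc_diff_right sc_add_right)
    have "st (\<phi> u) * \<phi> u = 1" using uB uu \<phi>1 by (metis mul star)
    then have nu: "norm (\<phi> u) = 1" by (rule norm_isom)
    have "2 *\<^sub>R a = u + st u" using a b by (simp add: u_def st_add scaleR_2)
    then have "a = sc (1/2) (u + st u)"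
      by (metis sc_of_real sc_sc sc_one of_real_numeral nonzero_divide_eq_eq zero_neq_numeral)
    then have "\<phi> a = sc (1/2) (\<phi> u + st (\<phi> u))"
      using uB B by (simp add: scl add star subalgD)
    then have "norm (\<phi> a) = 1/2 * norm (\<phi> u + st (\<phi> u))" by simp
    also have "\<dots> \<le> 1/2 * (norm (\<phi> u) + norm (st (\<phi> u)))" by (intro mult_left_mono norm_triangle_ineq) auto
    finally show ?thesis using nu by simp
  qed
  have sa: "norm (\<phi> a) \<le> norm a" if a: "a \<in> B" "st a = a" for a
  proof (rule field_le_epsilon)
    fix e :: real assume e: "e > 0"
    define r where "r = norm a + e"
    have r: "r > 0" "norm a < r" using e by (auto simp: r_def add_nonneg_pos)
    have "norm (\<phi> (sc (1 / r) a)) \<le> 1"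
      using a r B by (intro *) (auto simp: subalgD norm_divide)
    then show "norm (\<phi> a) \<le> norm a + e" using r a by (simp add: scl norm_divide) (simp add: r_def)
  qed
  have "(norm (\<phi> x))\<^sup>2 = norm (\<phi> (st x * x))"
    using x B by (simp add: mul star subalgD norm_st_mult)
  also have "\<dots> \<le> norm (st x * x)" using x B by (intro sa) (auto simp: subalgD)
  also have "\<dots> = (norm x)\<^sup>2" by (rule norm_st_mult)
  finally show ?thesis by (simp add: power2_le_iff_abs_le)
qed

text \<open>\<open>star_endo\<close> does not ask for \<open>\<phi> 1 = 1\<close>; surjectivity
  supplies it, since \<open>\<phi> 1\<close> is a unit for the whole range.\<close>

lemma star_auto_one:
  assumes B: "1 \<in> B" and \<phi>: "star_auto st sc B \<phi>"
  shows "\<phi> 1 = 1"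
proof -
  obtain e where e: "e \<in> B" "\<phi> e = 1"
    using \<phi> B unfolding star_auto_def bij_betw_def by (metis imageE)
  have "\<phi> 1 * \<phi> e = \<phi> (1 * e)"
    using \<phi> B e unfolding star_auto_def star_endo_def by metis
  then show ?thesis using e by simp
qed

end

section \<open>Cuntz families\<close>

declare One_nat_def [simp del]

section \<open>Words and sums over words\<close>

definition words :: "nat \<Rightarrow> nat \<Rightarrow> nat list set" where
  "words n k = {\<mu>. set \<mu> \<subseteq> {1..n} \<and> length \<mu> = k}"

lemma finite_words [simp]: "finite (words n k)"
  unfolding words_def by (rule finite_lists_length_eq) simp

lemma words_0 [simp]: "words n 0 = {[]}"
  by (auto simp: words_def)

lemma words_append: "\<mu> \<in> words n k \<Longrightarrow> \<nu> \<in> words n l \<Longrightarrow> \<mu> @ \<nu> \<in> words n (k + l)"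
  by (auto simp: words_def)

lemma words_appendE:
  assumes "\<mu> \<in> words n (k + l)"
  obtains \<alpha> \<beta> where "\<mu> = \<alpha> @ \<beta>" "\<alpha> \<in> words n k" "\<beta> \<in> words n l"
proof (rule that[of "take k \<mu>" "drop k \<mu>"])
  show "take k \<mu> \<in> words n k" "drop k \<mu> \<in> words n l"
    using assms set_take_subset[of k \<mu>] set_drop_subset[of k \<mu>] by (auto simp: words_def)
qed simp

lemma words_1: "words n 1 = (\<lambda>i. [i]) ` {1..n}"
  by (auto simp: words_def length_Suc_conv image_iff One_nat_def)

lemma words_1_singleton: "[i] \<in> words n 1 \<longleftrightarrow> i \<in> {1..n}"
  by (auto simp: words_def)

lemma replicate_words: "i \<in> {1..n} \<Longrightarrow> replicate k i \<in> words n k"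
  by (auto simp: words_def)

lemma sum_words_add: "(\<Sum>\<mu>\<in>words n (k + l). f \<mu>) = (\<Sum>\<alpha>\<in>words n k. \<Sum>\<beta>\<in>words n l. f (\<alpha> @ \<beta>))"
proof -
  have "(\<Sum>\<mu>\<in>words n (k + l). f \<mu>) = (\<Sum>p\<in>words n k \<times> words n l. f (fst p @ snd p))"
  proof (rule sum.reindex_bij_witness[where j = "\<lambda>\<mu>. (take k \<mu>, drop k \<mu>)" and i = "\<lambda>p. fst p @ snd p"])
    fix \<mu> assume "\<mu> \<in> words n (k + l)"
    then show "(take k \<mu>, drop k \<mu>) \<in> words n k \<times> words n l"
      by (elim words_appendE) (auto simp: words_def)
  qed (auto simp: words_append words_def)
  then show ?thesis by (simp add: sum.cartesian_product case_prod_unfold)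
qed

lemma sum_words_1: "(\<Sum>\<mu>\<in>words n 1. f \<mu>) = (\<Sum>i=1..n. f [i])"
  unfolding words_1 by (subst sum.reindex) (auto simp: inj_on_def)

lemma smon_Nil [simp]: "smon s [] = 1"
  and smon_singleton [simp]: "smon s [i] = s i"
  and smon_append [simp]: "smon s (\<mu> @ \<nu>) = smon s \<mu> * smon s \<nu>"
  and smon_replicate [simp]: "smon s (replicate k i) = s i ^ k"
  by (auto simp: smon_def prod_list_replicate)

lemma smon_Cons [simp]: "smon s (i # \<mu>) = s i * smon s \<mu>"
  by (simp add: smon_def)

locale cuntz_alg = cstar st sc
  for st :: "'a::{real_normed_algebra_1,banach} \<Rightarrow> 'a" and sc :: "complex \<Rightarrow> 'a \<Rightarrow> 'a" +
  fixes n :: nat and s :: "nat \<Rightarrow> 'a"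
  assumes n_ge_2: "n \<ge> 2" and family: "cuntz_family st n s"
begin

section \<open>Orthogonality and completeness of words\<close>

abbreviation S :: "nat list \<Rightarrow> 'a" where "S \<equiv> smon s"

text \<open>A Cuntz family is only required to consist of isometries whose range projections sum to
  1. Sandwiching that sum between \<open>st (s j)\<close> and \<open>s j\<close> gives 1 again, and
  the term \<open>k = j\<close> already contributes 1. The other terms are positive with sum 0, so
  each vanishes.\<close>

lemma st_s_s:
  assumes i: "i \<in> {1..n}" and j: "j \<in> {1..n}"
  shows "st (s i) * s j = (if i = j then 1 else 0)"
proof (cases "i = j")
  case True
  then show ?thesis using family i by (auto simp: cuntz_family_def)
next
  case False
  have isom: "st (s k) * s k = 1" if "k \<in> {1..n}" for k
    using family that by (auto simp: cuntz_family_def)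
  have sum1: "(\<Sum>k=1..n. s k * st (s k)) = 1"
    using family by (auto simp: cuntz_family_def)
  define b where "b = (\<lambda>k. st (s j) * (s k * st (s k)) * s j)"
  have "(\<Sum>k\<in>{1..n}. b k) = st (s j) * (\<Sum>k=1..n. s k * st (s k)) * s j"
    by (simp add: b_def sum_distrib_left sum_distrib_right)
  also have "\<dots> = 1" using isom[OF j] by (simp add: sum1)
  also have "(\<Sum>k\<in>{1..n}. b k) = b j + (\<Sum>k\<in>{1..n} - {j}. b k)"
    by (rule sum.remove) (use j in auto)
  also have "b j = 1"
    using isom[OF j] by (simp add: b_def mult.assoc)
  finally have s0: "(\<Sum>k\<in>{1..n} - {j}. b k) = 0" by simp
  have "b i = 0"
  proof (rule sum_pos_eq_0[OF _ _ s0])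
    fix k assume k: "k \<in> {1..n} - {j}"
    \<comment> \<open>\<open>q\<close> is a projection, hence a contraction, and
      \<open>1 - b k\<close> is its compression by \<open>s j\<close>. This yields the norm
      condition that stands for positivity of \<open>b k\<close>.\<close>
    define q where "q = 1 - s k * st (s k)"
    have "st q * q = q"
      using isom[of k] k by (simp add: q_def st_diff algebra_simps) (metis mult.assoc mult.right_neutral)
    then have "(norm q)\<^sup>2 = norm q" by (metis norm_st_mult)
    then have "norm q \<le> 1" by (auto simp: power2_eq_square)
    moreover have "1 - b k = st (s j) * (q * s j)"
      using isom[OF j] by (simp add: b_def q_def algebra_simps)
    ultimately show "norm (1 - b k) \<le> 1"
      using norm_isom_le[OF isom[OF j]] by (metis order_trans)
    show "st (b k) = b k" by (simp add: b_def mult.assoc)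
  qed (use i False in auto)
  moreover have "b i = st (st (s i) * s j) * (st (s i) * s j)" by (simp add: b_def mult.assoc)
  ultimately show ?thesis using False by (simp only: st_mult_self_eq_0_iff if_False)
qed

lemma isom_s: "i \<in> {1..n} \<Longrightarrow> st (s i) * s i = 1"
  by (simp add: st_s_s)

lemma sum_s: "(\<Sum>i=1..n. s i * st (s i)) = 1"
  using family by (auto simp: cuntz_family_def)

lemma st_S_S: "\<mu> \<in> words n k \<Longrightarrow> \<nu> \<in> words n k \<Longrightarrow> st (S \<mu>) * S \<nu> = (if \<mu> = \<nu> then 1 else 0)"
proof (induction k arbitrary: \<mu> \<nu>)
  case (Suc k)
  then obtain i \<alpha> j \<beta> where [simp]: "\<mu> = i # \<alpha>" "\<nu> = j # \<beta>"
    by (auto simp: words_def length_Suc_conv)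
  have *: "\<alpha> \<in> words n k" "\<beta> \<in> words n k" "i \<in> {1..n}" "j \<in> {1..n}"
    using Suc.prems by (auto simp: words_def)
  have "st (S \<mu>) * S \<nu> = st (S \<alpha>) * (st (s i) * s j) * S \<beta>" by (simp add: mult.assoc)
  then show ?case using Suc.IH[OF *(1,2)] st_s_s[OF *(3,4)] by auto
qed simp

lemma isom_S: "\<mu> \<in> words n k \<Longrightarrow> st (S \<mu>) * S \<mu> = 1"
  by (simp add: st_S_S)

lemma sum_S: "(\<Sum>\<mu>\<in>words n k. S \<mu> * st (S \<mu>)) = 1"
proof (induction k)
  case (Suc k)
  have "(\<Sum>\<mu>\<in>words n (Suc k). S \<mu> * st (S \<mu>)) = (\<Sum>\<mu>\<in>words n (k + 1). S \<mu> * st (S \<mu>))" by (simp only: Suc_eq_plus1)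
  also have "\<dots> = (\<Sum>\<mu>\<in>words n k. S \<mu> * (\<Sum>i=1..n. s i * st (s i)) * st (S \<mu>))"
    unfolding sum_words_add sum_words_1 by (simp add: sum_distrib_left sum_distrib_right mult.assoc)
  finally show ?case using Suc by (simp add: sum_s)
qed simp

lemma expand_left: "x = (\<Sum>\<mu>\<in>words n k. S \<mu> * (st (S \<mu>) * x))"
  using arg_cong[OF sum_S[of k], of "\<lambda>y. y * x"] by (simp add: sum_distrib_right mult.assoc)

lemma expand_right: "x = (\<Sum>\<mu>\<in>words n k. x * S \<mu> * st (S \<mu>))"
  using arg_cong[OF sum_S[of k], of "\<lambda>y. x * y"] by (simp add: sum_distrib_left mult.assoc)

lemma expand: "x = (\<Sum>\<mu>\<in>words n k. \<Sum>\<nu>\<in>words n l. S \<mu> * (st (S \<mu>) * x * S \<nu>) * st (S \<nu>))"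
proof -
  have "x = (\<Sum>\<mu>\<in>words n k. S \<mu> * (st (S \<mu>) * (\<Sum>\<nu>\<in>words n l. x * S \<nu> * st (S \<nu>))))"
    using expand_left[of x k] expand_right[of x l] by simp
  then show ?thesis by (simp add: sum_distrib_left mult.assoc)
qed

text \<open>\<open>H k l\<close> is the span of all \<open>s\<^sub>\<mu> s\<^sub>\<nu>\<^sup>*\<close> with \<open>\<bar>\<mu>\<bar> = k\<close> and \<open>\<bar>\<nu>\<bar> = l\<close>.\<close>
definition H :: "nat \<Rightarrow> nat \<Rightarrow> 'a set" where
  "H k l = {x. \<forall>\<mu>\<in>words n k. \<forall>\<nu>\<in>words n l. \<exists>c. st (S \<mu>) * x * S \<nu> = sc c 1}"

lemma H_entry: "x \<in> H k l \<Longrightarrow> \<mu> \<in> words n k \<Longrightarrow> \<nu> \<in> words n l \<Longrightarrow> \<exists>c. st (S \<mu>) * x * S \<nu> = sc c 1"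
  by (auto simp: H_def)

lemma H_E:
  assumes "x \<in> H k l"
  obtains c where "\<And>\<mu> \<nu>. \<mu> \<in> words n k \<Longrightarrow> \<nu> \<in> words n l \<Longrightarrow> st (S \<mu>) * x * S \<nu> = sc (c \<mu> \<nu>) 1"
    "x = (\<Sum>\<mu>\<in>words n k. \<Sum>\<nu>\<in>words n l. sc (c \<mu> \<nu>) (S \<mu> * st (S \<nu>)))"
proof -
  have "\<forall>\<mu> \<nu>. \<exists>c. \<mu> \<in> words n k \<and> \<nu> \<in> words n l \<longrightarrow> st (S \<mu>) * x * S \<nu> = sc c 1"
    using assms by (auto simp: H_def)
  then obtain c where c: "\<And>\<mu> \<nu>. \<mu> \<in> words n k \<Longrightarrow> \<nu> \<in> words n l \<Longrightarrow> st (S \<mu>) * x * S \<nu> = sc (c \<mu> \<nu>) 1"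
    by metis
  show ?thesis
  proof (rule that[OF c])
    show "x = (\<Sum>\<mu>\<in>words n k. \<Sum>\<nu>\<in>words n l. sc (c \<mu> \<nu>) (S \<mu> * st (S \<nu>)))"
      by (rule trans[OF expand[where x = x and k = k and l = l]], intro sum.cong refl) (simp add: c)
  qed
qed

lemma H_0: "0 \<in> H k l"
  by (auto simp: H_def intro: exI[of _ 0])

lemma H_add: "x \<in> H k l \<Longrightarrow> y \<in> H k l \<Longrightarrow> x + y \<in> H k l"
  unfolding H_def by (auto simp: distrib_left distrib_right) (metis sc_add_left)

lemma H_sc: "x \<in> H k l \<Longrightarrow> sc a x \<in> H k l"
  unfolding H_def by (auto) (metis sc_sc)

lemma H_scaleR: "x \<in> H k l \<Longrightarrow> r *\<^sub>R x \<in> H k l"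
  by (metis H_sc sc_of_real)

lemma H_minus: "x \<in> H k l \<Longrightarrow> - x \<in> H k l"
  by (metis H_sc sc_minus_one)

lemma H_diff: "x \<in> H k l \<Longrightarrow> y \<in> H k l \<Longrightarrow> x - y \<in> H k l"
  using H_add[of x k l "-y"] H_minus[of y k l] by simp

lemma H_sum: "(\<And>i. i \<in> I \<Longrightarrow> f i \<in> H k l) \<Longrightarrow> sum f I \<in> H k l"
  by (induction I rule: infinite_finite_induct) (auto simp: H_0 H_add)

lemma H_st: "x \<in> H k l \<Longrightarrow> st x \<in> H l k"
  unfolding H_def
proof safe
  fix \<mu> \<nu> assume x: "\<forall>\<mu>\<in>words n k. \<forall>\<nu>\<in>words n l. \<exists>c. st (S \<mu>) * x * S \<nu> = sc c 1"
    and \<mu>: "\<mu> \<in> words n l" and \<nu>: "\<nu> \<in> words n k"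
  then obtain c where "st (S \<nu>) * x * S \<mu> = sc c 1" by blast
  then have "st (st (S \<nu>) * x * S \<mu>) = sc (cnj c) 1" by simp
  then show "\<exists>c. st (S \<mu>) * st x * S \<nu> = sc c 1" by (auto simp: mult.assoc)
qed

lemma H_mult:
  assumes "x \<in> H k m" "y \<in> H m l" shows "x * y \<in> H k l"
  unfolding H_def
proof safe
  fix \<mu> \<nu> assume \<mu>: "\<mu> \<in> words n k" and \<nu>: "\<nu> \<in> words n l"
  obtain c where c: "\<And>\<mu> \<nu>. \<mu> \<in> words n k \<Longrightarrow> \<nu> \<in> words n m \<Longrightarrow> st (S \<mu>) * x * S \<nu> = sc (c \<mu> \<nu>) 1"
    using H_E[OF assms(1)] by metis
  obtain d where d: "\<And>\<mu> \<nu>. \<mu> \<in> words n m \<Longrightarrow> \<nu> \<in> words n l \<Longrightarrow> st (S \<mu>) * y * S \<nu> = sc (d \<mu> \<nu>) 1"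
    using H_E[OF assms(2)] by metis
  have "st (S \<mu>) * (x * y) * S \<nu> = st (S \<mu>) * x * (\<Sum>\<rho>\<in>words n m. S \<rho> * (st (S \<rho>) * (y * S \<nu>)))"
    by (subst expand_left[of "y * S \<nu>" m, symmetric]) (simp add: mult.assoc)
  also have "\<dots> = (\<Sum>\<rho>\<in>words n m. (st (S \<mu>) * x * S \<rho>) * (st (S \<rho>) * y * S \<nu>))"
    by (simp add: sum_distrib_left mult.assoc)
  also have "\<dots> = sc (\<Sum>\<rho>\<in>words n m. c \<mu> \<rho> * d \<rho> \<nu>) 1"
    by (simp add: c[OF \<mu>] d[OF _ \<nu>] sc_sum_left mult.commute)
  finally show "\<exists>c. st (S \<mu>) * (x * y) * S \<nu> = sc c 1" by blast
qed

text \<open>The inclusion \<open>x \<mapsto> x \<otimes> 1\<close> of matrix spaces: both word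
  lengths may be increased together, so that only the degree \<open>k - l\<close> is intrinsic to
  \<open>x\<close>.\<close>

lemma H_raise:
  assumes "x \<in> H k l" shows "x \<in> H (k + r) (l + r)"
  unfolding H_def
proof safe
  fix \<mu> \<nu> assume "\<mu> \<in> words n (k + r)" "\<nu> \<in> words n (l + r)"
  then obtain \<mu>1 \<mu>2 \<nu>1 \<nu>2 where *: "\<mu> = \<mu>1 @ \<mu>2" "\<mu>1 \<in> words n k" "\<mu>2 \<in> words n r"
    "\<nu> = \<nu>1 @ \<nu>2" "\<nu>1 \<in> words n l" "\<nu>2 \<in> words n r" by (metis words_appendE)
  obtain c where c: "st (S \<mu>1) * x * S \<nu>1 = sc c 1" using H_entry[OF assms *(2,5)] by blast
  have "st (S \<mu>) * x * S \<nu> = st (S \<mu>2) * (st (S \<mu>1) * x * S \<nu>1) * S \<nu>2"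
    by (simp add: * mult.assoc)
  also have "\<dots> = sc c (if \<mu>2 = \<nu>2 then 1 else 0)"
    using st_S_S[OF *(3,6)] by (simp add: c)
  finally show "\<exists>c. st (S \<mu>) * x * S \<nu> = sc c 1" by (cases "\<mu>2 = \<nu>2") (auto intro: exI[of _ 0])
qed

lemma H_raise':
  assumes "x \<in> H k l" "k \<le> k'" "int k' - int l' = int k - int l"
  shows "x \<in> H k' l'"
proof -
  have "k' = k + (k' - k)" "l' = l + (k' - k)" using assms by linarith+
  then show ?thesis using H_raise[OF assms(1)] by metis
qed

lemma closed_H: "closed (H k l)"
proof -
  have "H k l = (\<Inter>\<mu>\<in>words n k. \<Inter>\<nu>\<in>words n l. (\<lambda>x. st (S \<mu>) * x * S \<nu>) -` range (\<lambda>c. sc c 1))"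
    by (auto simp: H_def image_iff)
  also have "closed \<dots>"
    by (intro closed_INT ballI closed_vimage closed_scalars continuous_intros)
  finally show ?thesis .
qed

lemma H_S: "\<mu> \<in> words n k \<Longrightarrow> S \<mu> \<in> H k 0"
  unfolding H_def by (auto simp: st_S_S intro: exI[of _ 0] exI[of _ 1])

lemma H_SS: "\<mu> \<in> words n k \<Longrightarrow> \<nu> \<in> words n l \<Longrightarrow> S \<mu> * st (S \<nu>) \<in> H k l"
  using H_mult[OF H_S H_st[OF H_S]] by blast

lemma H_s: "i \<in> {1..n} \<Longrightarrow> s i \<in> H 1 0"
  using H_S[of "[i]" 1] by (simp add: words_1_singleton)

lemma H_00: "x \<in> H 0 0 \<longleftrightarrow> (\<exists>c. x = sc c 1)"
  by (auto simp: H_def)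

lemma H_1: "1 \<in> H k k"
proof -
  have "1 \<in> H 0 0" unfolding H_00 by (rule exI[of _ 1]) simp
  from H_raise[OF this, of k] show ?thesis by simp
qed

lemma H_power: "x \<in> H k k \<Longrightarrow> x ^ m \<in> H k k"
  by (induction m) (auto simp: H_1 intro: H_mult)

section \<open>Iterated shift and intertwining\<close>

definition sh :: "nat \<Rightarrow> 'a \<Rightarrow> 'a" where
  "sh k x = (\<Sum>\<mu>\<in>words n k. S \<mu> * x * st (S \<mu>))"

lemma sh_0 [simp]: "sh 0 x = x"
  by (simp add: sh_def)

lemma sh_1: "sh 1 x = cshift st n s x"
  unfolding sh_def cshift_def sum_words_1 by simp

lemma sh_one [simp]: "sh k 1 = 1"
  by (simp add: sh_def sum_S)

lemma sh_zero [simp]: "sh k 0 = 0"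
  by (simp add: sh_def)

lemma sh_add: "sh k (x + y) = sh k x + sh k y"
  by (simp add: sh_def distrib_left distrib_right sum.distrib)

lemma sh_diff: "sh k (x - y) = sh k x - sh k y"
  by (simp add: sh_def left_diff_distrib right_diff_distrib sum_subtractf)

lemma sh_sc: "sh k (sc a x) = sc a (sh k x)"
  by (simp add: sh_def sc_sum_right)

lemma sh_sum: "sh k (sum f I) = (\<Sum>i\<in>I. sh k (f i))"
  by (induction I rule: infinite_finite_induct) (auto simp: sh_add)

lemma sh_st: "sh k (st x) = st (sh k x)"
  by (simp add: sh_def st_sum mult.assoc)

lemma sh_S: assumes "\<nu> \<in> words n k" shows "sh k x * S \<nu> = S \<nu> * x"
proof -
  have "sh k x * S \<nu> = (\<Sum>\<mu>\<in>words n k. S \<mu> * x * (st (S \<mu>) * S \<nu>))"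
    by (simp add: sh_def sum_distrib_right mult.assoc)
  also have "\<dots> = (\<Sum>\<mu>\<in>words n k. if \<mu> = \<nu> then S \<nu> * x else 0)"
    by (rule sum.cong) (auto simp: st_S_S[OF _ assms])
  finally show ?thesis using assms by simp
qed

lemma st_S_sh: assumes "\<nu> \<in> words n k" shows "st (S \<nu>) * sh k x = x * st (S \<nu>)"
  using arg_cong[OF sh_S[OF assms, of "st x"], of st] by (simp add: sh_st)

lemma sh_mult: "sh k (x * y) = sh k x * sh k y"
proof -
  have "sh k x * sh k y = (\<Sum>\<mu>\<in>words n k. sh k x * S \<mu> * y * st (S \<mu>))"
    by (subst (2) sh_def) (simp add: sum_distrib_left mult.assoc)
  also have "\<dots> = (\<Sum>\<mu>\<in>words n k. S \<mu> * x * y * st (S \<mu>))" by (simp only: sh_S cong: sum.cong)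
  finally show ?thesis by (simp add: sh_def mult.assoc)
qed

lemma sh_sh: "sh k (sh l x) = sh (k + l) x"
  by (simp add: sh_def sum_words_add sum_distrib_left sum_distrib_right mult.assoc)

lemma norm_sh_le: "norm (sh k x) \<le> norm x"
proof (rule star_endo_contractive[of UNIV])
  show "cstar_sub st sc UNIV" by (simp add: cstar_sub_def)
  show "star_endo st sc UNIV (sh k)" by (simp add: star_endo_def sh_add sh_mult sh_sc sh_st)
qed auto

lemma isom_sh: "st v * v = 1 \<Longrightarrow> st (sh k v) * sh k v = 1"
  by (simp flip: sh_st sh_mult)

text \<open>Compressing either side by words of lengths \<open>k\<close> and \<open>l\<close> gives
  a scalar times \<open>y\<close>. For \<open>k = l\<close> this says that operators on the first
  \<open>k\<close> tensor legs commute with operators on the remaining ones.\<close>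

lemma intertwine:
  assumes "x \<in> H k l" shows "x * sh l y = sh k y * x"
proof -
  obtain c where c: "\<And>\<mu> \<nu>. \<mu> \<in> words n k \<Longrightarrow> \<nu> \<in> words n l \<Longrightarrow> st (S \<mu>) * x * S \<nu> = sc (c \<mu> \<nu>) 1"
    using H_E[OF assms] by metis
  have "x * sh l y = (\<Sum>\<mu>\<in>words n k. \<Sum>\<nu>\<in>words n l. S \<mu> * (st (S \<mu>) * (x * sh l y) * S \<nu>) * st (S \<nu>))"
    by (rule expand)
  also have "\<dots> = (\<Sum>\<mu>\<in>words n k. \<Sum>\<nu>\<in>words n l. S \<mu> * (st (S \<mu>) * (sh k y * x) * S \<nu>) * st (S \<nu>))"
  proof (intro sum.cong refl)
    fix \<mu> \<nu> assume *: "\<mu> \<in> words n k" "\<nu> \<in> words n l"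
    have "st (S \<mu>) * (x * sh l y) * S \<nu> = st (S \<mu>) * x * (sh l y * S \<nu>)" by (simp add: mult.assoc)
    also have "\<dots> = sc (c \<mu> \<nu>) y" by (simp only: sh_S[OF *(2)] mult.assoc[symmetric] c[OF *]) simp
    also have "\<dots> = y * (st (S \<mu>) * x * S \<nu>)" by (simp add: c[OF *])
    also have "\<dots> = st (S \<mu>) * sh k y * x * S \<nu>" by (simp only: st_S_sh[OF *(1)] mult.assoc)
    finally show "S \<mu> * (st (S \<mu>) * (x * sh l y) * S \<nu>) * st (S \<nu>) = S \<mu> * (st (S \<mu>) * (sh k y * x) * S \<nu>) * st (S \<nu>)"
      by (simp add: mult.assoc)
  qed
  also have "\<dots> = sh k y * x" by (rule expand[symmetric])
  finally show ?thesis .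
qed

lemma one_n: "1 \<in> {1..n}" "2 \<in> {1..n}"
  using n_ge_2 by auto

lemma isom_12: "st (s 1) * s 1 = 1" "st (s 2) * s 2 = 1"
  using isom_s one_n by auto

section \<open>Compression to degree 0\<close>

definition gap :: "nat \<Rightarrow> 'a" where "gap m = s 1 ^ m * s 2"

lemma isom_gap: "st (gap m) * gap m = 1"
  unfolding gap_def by (intro isom_mult isom_power isom_12)

text \<open>The word \<open>1\<^sup>m 2\<close> has no nontrivial overlap with itself.\<close>
lemma gap_S_gap:
  assumes "\<mu> \<in> words n j" "0 < j" "j \<le> m"
  shows "st (gap m) * S \<mu> * gap m = 0"
proof -
  have m: "m = j + (m - j)" "m = (m - j) + j" using assms by auto
  have "st (gap m) * S \<mu> * gap m = st (s 2) * (st (s 1 ^ (m - j)) * (st (S (replicate j 1)) * S \<mu>) * gap m)"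
    by (subst gap_def, subst m(1), subst power_add) (simp add: mult.assoc)
  also have "st (S (replicate j 1)) * S \<mu> = (if replicate j 1 = \<mu> then 1 else 0)"
    by (rule st_S_S) (use assms one_n replicate_words in auto)
  also have "st (s 2) * (st (s 1 ^ (m - j)) * (if replicate j 1 = \<mu> then 1 else 0) * gap m) =
      (if replicate j 1 = \<mu> then st (s 2) * (st (s 1 ^ (m - j)) * gap m) else 0)" by simp
  also have "st (s 1 ^ (m - j)) * gap m = (st (s 1 ^ (m - j)) * s 1 ^ (m - j)) * (s 1 ^ j * s 2)"
    by (subst gap_def, subst m(2), subst power_add) (simp add: mult.assoc)
  also have "\<dots> = s 1 ^ j * s 2" by (simp only: isom_power isom_12 mult_1_left)
  also have "st (s 2) * (s 1 ^ j * s 2) = (st (s 2) * s 1) * (s 1 ^ (j - 1) * s 2)"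
    using assms(2) by (cases j) (auto simp: mult.assoc)
  also have "st (s 2) * s 1 = 0" using st_s_s one_n by auto
  finally show ?thesis by simp
qed

lemma gap_sh_gap:
  assumes "0 < j" "j \<le> m" shows "st (gap m) * sh j (gap m) = 0"
proof -
  have "st (gap m) * sh j (gap m) = (\<Sum>\<mu>\<in>words n j. st (gap m) * S \<mu> * gap m * st (S \<mu>))"
    by (simp add: sh_def sum_distrib_left mult.assoc)
  also have "\<dots> = 0" by (intro sum.neutral ballI) (simp add: gap_S_gap assms)
  finally show ?thesis .
qed

text \<open>Compression by the isometry \<open>Z L m\<close> replaces averaging over the gauge action.\<close>
definition Z :: "nat \<Rightarrow> nat \<Rightarrow> 'a" where "Z L m = sh L (gap m)"

lemma isom_Z: "st (Z L m) * Z L m = 1"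
  by (simp add: Z_def isom_sh isom_gap)

lemma Z_compress_0:
  assumes "x \<in> H k k" "k \<le> L" shows "st (Z L m) * x * Z L m = x" "x * Z L m = Z L m * x"
proof -
  have "x \<in> H L L" by (rule H_raise'[OF assms(1)]) (use assms in auto)
  then show *: "x * Z L m = Z L m * x" unfolding Z_def by (rule intertwine)
  show "st (Z L m) * x * Z L m = x" by (simp add: mult.assoc *) (simp add: isom_Z flip: mult.assoc)
qed

text \<open>Passing \<open>Z L m\<close> through an element of degree \<open>k - l\<close> shifts
  its word by \<open>k - l\<close> further places, where it is orthogonal to the unshifted word as
  long as \<open>k - l \<le> m\<close>.\<close>

lemma Z_compress_gt:
  assumes "x \<in> H k l" "l < k" "l \<le> L" "k - l \<le> m" shows "st (Z L m) * x * Z L m = 0"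
proof -
  have "x \<in> H (L + (k - l)) L" by (rule H_raise'[OF assms(1)]) (use assms in auto)
  then have "x * Z L m = sh (L + (k - l)) (gap m) * x" unfolding Z_def by (rule intertwine)
  then have "st (Z L m) * x * Z L m = st (sh L (gap m)) * sh L (sh (k - l) (gap m)) * x"
    by (simp add: mult.assoc Z_def sh_sh)
  also have "\<dots> = 0" using gap_sh_gap[of "k - l" m] assms by (simp flip: sh_st sh_mult)
  finally show ?thesis .
qed

lemma Z_compress_lt:
  assumes "x \<in> H k l" "k < l" "k \<le> L" "l - k \<le> m" shows "st (Z L m) * x * Z L m = 0"
proof -
  have "st (Z L m) * st x * Z L m = 0" by (rule Z_compress_gt[OF H_st[OF assms(1)]]) (use assms in auto)
  then have "st (st (Z L m) * st x * Z L m) = 0" by simp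
  then show ?thesis by (simp add: mult.assoc)
qed

section \<open>The generated algebra\<close>

abbreviation alg :: "'a set" where "alg \<equiv> cuntz st sc n s"

lemma alg_sub: "cstar_sub st sc alg"
  unfolding cuntz_def by (rule cstar_sub_gen)

lemma s_alg: "i \<in> {1..n} \<Longrightarrow> s i \<in> alg"
  unfolding cuntz_def using gen_subset[of "s ` {1..n}"] by auto

lemma one_alg: "1 \<in> alg"
  unfolding sum_s[symmetric] by (intro subalg_sum alg_sub) (auto intro!: subalgD[OF alg_sub] s_alg)

lemma S_alg: "set \<mu> \<subseteq> {1..n} \<Longrightarrow> S \<mu> \<in> alg"
  by (induction \<mu>) (auto simp: one_alg intro!: subalgD[OF alg_sub] s_alg)

lemma S_words_alg: "\<mu> \<in> words n k \<Longrightarrow> S \<mu> \<in> alg"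
  by (simp add: words_def S_alg)

lemma H_alg: "x \<in> H k l \<Longrightarrow> x \<in> alg"
  by (erule H_E, simp) (auto intro!: subalg_sum alg_sub subalgD[OF alg_sub] S_words_alg)

end

section \<open>Comparing two Cuntz families\<close>

text \<open>Limits in the two parameters of \<open>Z L m\<close>: \<open>L\<close> has to exceed the
  lengths of the words involved, \<open>m\<close> their degrees. The threshold for \<open>m\<close>
  may depend on \<open>L\<close>.\<close>

definition eventually2 :: "(nat \<Rightarrow> nat \<Rightarrow> bool) \<Rightarrow> bool" where
  "eventually2 P \<longleftrightarrow> (\<forall>\<^sub>F L in sequentially. \<forall>\<^sub>F m in sequentially. P L m)"

lemma eventually2_mono: "eventually2 P \<Longrightarrow> (\<And>L m. P L m \<Longrightarrow> Q L m) \<Longrightarrow> eventually2 Q"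
  unfolding eventually2_def by (auto elim!: eventually_mono)

lemma eventually2_conj: "eventually2 P \<Longrightarrow> eventually2 Q \<Longrightarrow> eventually2 (\<lambda>L m. P L m \<and> Q L m)"
  unfolding eventually2_def by (auto intro: eventually_elim2 simp: eventually_conj_iff)

lemma eventually2_ball: "finite I \<Longrightarrow> (\<And>i. i \<in> I \<Longrightarrow> eventually2 (P i)) \<Longrightarrow> eventually2 (\<lambda>L m. \<forall>i\<in>I. P i L m)"
  unfolding eventually2_def by (simp add: eventually_ball_finite_distrib)

lemma eventually2_ex: "eventually2 P \<Longrightarrow> \<exists>L m. P L m"
  unfolding eventually2_def eventually_sequentially by blast

lemma eventually2_ge: "(\<And>L m. L \<ge> K \<Longrightarrow> m \<ge> M \<Longrightarrow> P L m) \<Longrightarrow> eventually2 P"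
  unfolding eventually2_def eventually_sequentially by blast

lemma eventually2_Suc: "eventually2 (\<lambda>L m. P (Suc L) m) \<longleftrightarrow> eventually2 P"
  unfolding eventually2_def by (rule eventually_sequentially_Suc)

abbreviation degs :: "nat \<Rightarrow> int set" where "degs d \<equiv> {- int d..int d}"

locale cuntz_pair = cuntz_alg st sc n s + B: cuntz_alg st sc n s'
  for st :: "'a::{real_normed_algebra_1,banach} \<Rightarrow> 'a" and sc :: "complex \<Rightarrow> 'a \<Rightarrow> 'a"
    and n :: nat and s s' :: "nat \<Rightarrow> 'a"
begin

section \<open>Change of family on homogeneous elements\<close>

definition V :: "nat \<Rightarrow> 'a" where "V k = (\<Sum>\<mu>\<in>words n k. B.S \<mu> * st (S \<mu>))"

lemma V_S: assumes "\<nu> \<in> words n k" shows "V k * S \<nu> = B.S \<nu>"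
proof -
  have "V k * S \<nu> = (\<Sum>\<mu>\<in>words n k. B.S \<mu> * (st (S \<mu>) * S \<nu>))"
    by (simp add: V_def sum_distrib_right mult.assoc)
  also have "\<dots> = (\<Sum>\<mu>\<in>words n k. if \<mu> = \<nu> then B.S \<nu> else 0)"
    by (rule sum.cong) (auto simp: st_S_S[OF _ assms])
  finally show ?thesis using assms by simp
qed

lemma V_unitary: "st (V k) * V k = 1" "V k * st (V k) = 1"
proof -
  have "st (V k) * V k = (\<Sum>\<mu>\<in>words n k. \<Sum>\<nu>\<in>words n k. S \<mu> * (st (B.S \<mu>) * B.S \<nu>) * st (S \<nu>))"
    by (simp add: V_def st_sum sum_product mult.assoc)
  also have "\<dots> = (\<Sum>\<mu>\<in>words n k. \<Sum>\<nu>\<in>words n k. if \<nu> = \<mu> then S \<mu> * st (S \<mu>) else 0)"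
    by (intro sum.cong refl) (auto simp: B.st_S_S)
  finally show "st (V k) * V k = 1" by (simp add: sum_S)
  have "V k * st (V k) = (\<Sum>\<mu>\<in>words n k. \<Sum>\<nu>\<in>words n k. B.S \<mu> * (st (S \<mu>) * S \<nu>) * st (B.S \<nu>))"
    by (simp add: V_def st_sum sum_product mult.assoc)
  also have "\<dots> = (\<Sum>\<mu>\<in>words n k. \<Sum>\<nu>\<in>words n k. if \<nu> = \<mu> then B.S \<mu> * st (B.S \<mu>) else 0)"
    by (intro sum.cong refl) (auto simp: st_S_S)
  finally show "V k * st (V k) = 1" by (simp add: B.sum_S)
qed

lemma V_0 [simp]: "V 0 = 1"
  by (simp add: V_def)

lemma V_add: "V (k + r) = V k * sh k (V r)"
proof -
  have "V k * sh k (V r) = (\<Sum>\<mu>\<in>words n k. (V k * S \<mu>) * V r * st (S \<mu>))"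
    by (simp add: sh_def sum_distrib_left mult.assoc)
  also have "\<dots> = (\<Sum>\<mu>\<in>words n k. B.S \<mu> * V r * st (S \<mu>))" by (simp only: V_S cong: sum.cong)
  also have "\<dots> = V (k + r)"
    by (simp add: V_def sum_words_add sum_distrib_left sum_distrib_right mult.assoc)
  finally show ?thesis by simp
qed

text \<open>The substitution does not depend on the level at which \<open>x\<close> is represented:
  the extra factor \<open>sh k (V r)\<close> passes through \<open>x\<close> and cancels against its
  adjoint.\<close>

lemma V_raise:
  assumes "x \<in> H k l" shows "V (k + r) * x * st (V (l + r)) = V k * x * st (V l)"
proof -
  have "V (k + r) * x * st (V (l + r)) = V k * (sh k (V r) * x) * sh l (st (V r)) * st (V l)"
    by (simp add: V_add sh_st mult.assoc)
  also have "sh k (V r) * x = x * sh l (V r)" using intertwine[OF assms] by simp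
  also have "V k * (x * sh l (V r)) * sh l (st (V r)) * st (V l) = V k * x * sh l (V r * st (V r)) * st (V l)"
    by (simp add: sh_mult mult.assoc)
  finally show ?thesis by (simp add: V_unitary)
qed

lemma V_entry:
  assumes "\<mu> \<in> words n k" "\<nu> \<in> words n l"
  shows "st (B.S \<mu>) * (V k * x * st (V l)) * B.S \<nu> = st (S \<mu>) * x * S \<nu>"
proof -
  have "st (B.S \<mu>) * V k = st (S \<mu>) * (st (V k) * V k)"
    using V_S[OF assms(1), symmetric] by (simp add: mult.assoc)
  moreover have "st (V l) * B.S \<nu> = (st (V l) * V l) * S \<nu>"
    using V_S[OF assms(2), symmetric] by (simp add: mult.assoc)
  ultimately show ?thesis by (simp add: V_unitary) (metis mult.assoc)
qed

lemma V_H: "x \<in> H k l \<Longrightarrow> V k * x * st (V l) \<in> B.H k l"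
  by (simp add: H_def B.H_def V_entry)

text \<open>\<open>hrel j x y\<close>: \<open>x\<close> is a homogeneous polynomial of degree \<open>j\<close> in the
  generators \<open>s\<close> and their adjoints, and \<open>y\<close> the same polynomial in \<open>s'\<close>.\<close>
definition hrel :: "int \<Rightarrow> 'a \<Rightarrow> 'a \<Rightarrow> bool" where
  "hrel j x y \<longleftrightarrow> (\<exists>K. \<forall>k l. K \<le> k \<and> K \<le> l \<and> int k - int l = j \<longrightarrow> x \<in> H k l \<and> y = V k * x * st (V l))"

lemma hrelI:
  assumes "x \<in> H k l" shows "hrel (int k - int l) x (V k * x * st (V l))"
  unfolding hrel_def
proof (intro exI allI impI)
  fix k' l' assume *: "max k l \<le> k' \<and> max k l \<le> l' \<and> int k' - int l' = int k - int l"
  then have e: "k' = k + (k' - k)" "l' = l + (k' - k)" by linarith+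
  show "x \<in> H k' l' \<and> V k * x * st (V l) = V k' * x * st (V l')"
    using H_raise[OF assms] V_raise[OF assms] e by metis
qed

lemma hrel_0 [simp]: "hrel j 0 0"
  by (auto simp: hrel_def H_0)

lemma hrel_add:
  assumes "hrel j x y" "hrel j x' y'" shows "hrel j (x + x') (y + y')"
proof -
  obtain K K' where "\<forall>k l. K \<le> k \<and> K \<le> l \<and> int k - int l = j \<longrightarrow> x \<in> H k l \<and> y = V k * x * st (V l)"
    "\<forall>k l. K' \<le> k \<and> K' \<le> l \<and> int k - int l = j \<longrightarrow> x' \<in> H k l \<and> y' = V k * x' * st (V l)"
    using assms unfolding hrel_def by blast
  then show ?thesis unfolding hrel_def
    by (intro exI[of _ "max K K'"] allI impI) (auto simp: H_add distrib_left distrib_right)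
qed

lemma hrel_sum: "(\<And>i. i \<in> I \<Longrightarrow> hrel j (f i) (g i)) \<Longrightarrow> hrel j (sum f I) (sum g I)"
  by (induction I rule: infinite_finite_induct) (auto intro: hrel_add)

lemma hrel_sc:
  assumes "hrel j x y" shows "hrel j (sc a x) (sc a y)"
proof -
  obtain K where "\<forall>k l. K \<le> k \<and> K \<le> l \<and> int k - int l = j \<longrightarrow> x \<in> H k l \<and> y = V k * x * st (V l)"
    using assms unfolding hrel_def by blast
  then show ?thesis unfolding hrel_def
    by (intro exI[of _ K] allI impI) (auto simp: H_sc)
qed

lemma hrel_mult:
  assumes "hrel i x y" "hrel j x' y'" shows "hrel (i + j) (x * x') (y * y')"
proof -
  obtain K K' where K: "\<And>k l. K \<le> k \<Longrightarrow> K \<le> l \<Longrightarrow> int k - int l = i \<Longrightarrow> x \<in> H k l \<and> y = V k * x * st (V l)"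
    and K': "\<And>k l. K' \<le> k \<Longrightarrow> K' \<le> l \<Longrightarrow> int k - int l = j \<Longrightarrow> x' \<in> H k l \<and> y' = V k * x' * st (V l)"
    using assms unfolding hrel_def by blast
  show ?thesis unfolding hrel_def
  \<comment> \<open>The margin \<open>nat \<bar>j\<bar>\<close> keeps the intermediate length
    \<open>m = l + j\<close> nonnegative and above both thresholds.\<close>
  proof (intro exI[of _ "max K K' + nat \<bar>j\<bar>"] allI impI)
    fix k l assume *: "max K K' + nat \<bar>j\<bar> \<le> k \<and> max K K' + nat \<bar>j\<bar> \<le> l \<and> int k - int l = i + j"
    define m where "m = nat (int l + j)"
    have m: "int m = int l + j" "K \<le> m" "K' \<le> m" using * by (auto simp: m_def)
    have 1: "x \<in> H k m" "y = V k * x * st (V m)" using K[of k m] m * by auto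
    have 2: "x' \<in> H m l" "y' = V m * x' * st (V l)" using K'[of m l] m * by auto
    have "y * y' = V k * x * (st (V m) * V m) * x' * st (V l)" unfolding 1(2) 2(2) by (simp add: mult.assoc)
    then show "x * x' \<in> H k l \<and> y * y' = V k * (x * x') * st (V l)"
      using H_mult[OF 1(1) 2(1)] by (simp add: V_unitary mult.assoc)
  qed
qed

lemma hrel_st:
  assumes "hrel j x y" shows "hrel (- j) (st x) (st y)"
proof -
  obtain K where "\<And>k l. K \<le> k \<Longrightarrow> K \<le> l \<Longrightarrow> int k - int l = j \<Longrightarrow> x \<in> H k l \<and> y = V k * x * st (V l)"
    using assms unfolding hrel_def by blast
  then have "\<And>k l. K \<le> k \<Longrightarrow> K \<le> l \<Longrightarrow> int k - int l = - j \<Longrightarrow> st x \<in> H k l \<and> st y = V k * st x * st (V l)"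
    by (metis H_st st_mult st_st mult.assoc minus_diff_eq minus_minus)
  then show ?thesis unfolding hrel_def by blast
qed

lemma hrelD:
  assumes "hrel j x y"
  obtains k l where "int k - int l = j" "x \<in> H k l" "y = V k * x * st (V l)" "K \<le> k" "K \<le> l"
proof -
  obtain K' where K: "\<And>k l. K' \<le> k \<Longrightarrow> K' \<le> l \<Longrightarrow> int k - int l = j \<Longrightarrow> x \<in> H k l \<and> y = V k * x * st (V l)"
    using assms unfolding hrel_def by blast
  define M where "M = max K K'"
  have "int (M + nat j) - int (M + nat (- j)) = j" by (cases "j \<ge> 0") auto
  then show ?thesis
    using that[of "M + nat j" "M + nat (- j)"] K[of "M + nat j" "M + nat (- j)"] by (auto simp: M_def)
qed

lemma hrel_norm: assumes "hrel j x y" shows "norm y = norm x"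
proof -
  obtain k l where "y = V k * x * st (V l)" using hrelD[OF assms, of 0] by metis
  then show ?thesis by (simp add: norm_mult_coisom norm_isom_mult V_unitary)
qed

lemma hrel_s: assumes "i \<in> {1..n}" shows "hrel 1 (s i) (s' i)"
proof -
  have "V 1 * s i = s' i" using V_S[of "[i]" 1] assms by (simp add: words_1_singleton)
  then show ?thesis using hrelI[OF H_s[OF assms]] by simp
qed

lemma hrel_one: "hrel 0 1 1"
  using hrelI[OF H_1[of 0]] by simp

lemma hrel_power: "hrel j x y \<Longrightarrow> hrel (int k * j) (x ^ k) (y ^ k)"
proof (induction k)
  case (Suc k)
  then show ?case using hrel_mult[of j x y "int k * j" "x ^ k" "y ^ k"] by (simp add: algebra_simps)
qed (simp add: hrel_one)

section \<open>Polynomials and their homogeneous components\<close>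

definition comps :: "nat \<Rightarrow> (int \<Rightarrow> 'a) \<Rightarrow> (int \<Rightarrow> 'a) \<Rightarrow> bool" where
  "comps d f g \<longleftrightarrow> (\<forall>j. hrel j (f j) (g j)) \<and> (\<forall>j. \<bar>j\<bar> > int d \<longrightarrow> f j = 0 \<and> g j = 0)"

text \<open>The degree bound is recorded because the number \<open>2 * d + 1\<close> of components
  is the factor in the crude norm estimate.\<close>

definition rel :: "nat \<Rightarrow> 'a \<Rightarrow> 'a \<Rightarrow> bool" where
  "rel d x y \<longleftrightarrow> (\<exists>f g. comps d f g \<and> x = sum f (degs d) \<and> y = sum g (degs d))"

lemma relI: "comps d f g \<Longrightarrow> x = sum f (degs d) \<Longrightarrow> y = sum g (degs d) \<Longrightarrow> rel d x y"
  unfolding rel_def by blast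

lemma relE:
  assumes "rel d x y"
  obtains f g where "comps d f g" "x = sum f (degs d)" "y = sum g (degs d)"
  using assms unfolding rel_def by blast

lemma rel_components:
  assumes "rel d x y"
  obtains f g where "\<And>j. hrel j (f j) (g j)" "x = sum f (degs d)" "y = sum g (degs d)"
  using assms unfolding rel_def comps_def by blast

lemma compsD: "comps d f g \<Longrightarrow> hrel j (f j) (g j)" "comps d f g \<Longrightarrow> \<bar>j\<bar> > int d \<Longrightarrow> f j = 0"
    "comps d f g \<Longrightarrow> \<bar>j\<bar> > int d \<Longrightarrow> g j = 0"
  by (auto simp: comps_def)

lemma rel_mono: assumes "rel d x y" "d \<le> e" shows "rel e x y"
  using assms(1)
proof (rule relE)
  fix f g assume f: "comps d f g" and xy: "x = sum f (degs d)" "y = sum g (degs d)"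
  have "x = sum f (degs e)" "y = sum g (degs e)"
    unfolding xy by (intro sum.mono_neutral_left; use assms(2) compsD[OF f] in auto)+
  moreover have "comps e f g" using f assms(2) by (auto simp: comps_def)
  ultimately show ?thesis by (intro relI)
qed

lemma rel_hrel: assumes "hrel j x y" shows "rel (nat \<bar>j\<bar>) x y"
  by (rule relI[of _ "\<lambda>i. if i = j then x else 0" "\<lambda>i. if i = j then y else 0"])
     (use assms in \<open>auto simp: comps_def\<close>)

lemma rel_add: "rel d x y \<Longrightarrow> rel d x' y' \<Longrightarrow> rel d (x + x') (y + y')"
  by (elim relE, rule_tac f = "\<lambda>j. f j + fa j" and g = "\<lambda>j. g j + ga j" in relI)
     (auto simp: comps_def sum.distrib intro: hrel_add)

lemma rel_sc: "rel d x y \<Longrightarrow> rel d (sc a x) (sc a y)"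
  by (elim relE, rule_tac f = "\<lambda>j. sc a (f j)" and g = "\<lambda>j. sc a (g j)" in relI)
     (auto simp: comps_def sc_sum_right intro: hrel_sc)

lemma sum_int_neg: "(\<Sum>j\<in>degs d. h (- j)) = sum h (degs d)"
  by (rule sum.reindex_bij_witness[of _ uminus uminus]) auto

lemma rel_st: assumes "rel d x y" shows "rel d (st x) (st y)"
  using assms
proof (rule relE)
  fix f g assume f: "comps d f g" and xy: "x = sum f (degs d)" "y = sum g (degs d)"
  have "hrel j (st (f (- j))) (st (g (- j)))" for j using hrel_st[OF compsD(1)[OF f, of "-j"]] by simp
  then have "comps d (\<lambda>j. st (f (- j))) (\<lambda>j. st (g (- j)))" using f by (auto simp: comps_def)
  then show ?thesis
    by (rule relI) (simp_all add: xy st_sum sum_int_neg[of "\<lambda>j. st (f j)"] sum_int_neg[of "\<lambda>j. st (g j)"])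
qed

lemma convolution:
  fixes f f' :: "int \<Rightarrow> 'a"
  assumes "\<And>j. \<bar>j\<bar> > int e \<Longrightarrow> f' j = 0"
  shows "(\<Sum>j\<in>degs d. f j) * (\<Sum>j\<in>degs e. f' j) =
    (\<Sum>k\<in>degs (d + e). \<Sum>i\<in>degs d. f i * f' (k - i))"
proof -
  have "(\<Sum>k\<in>degs (d + e). f' (k - i)) = (\<Sum>j\<in>degs e. f' j)"
    if i: "i \<in> degs d" for i
  proof -
    have "(\<Sum>k\<in>degs (d + e). f' (k - i)) = (\<Sum>j\<in>{- int (d + e) - i..int (d + e) - i}. f' j)"
      by (rule sum.reindex_bij_witness[of _ "\<lambda>j. j + i" "\<lambda>k. k - i"]) auto
    also have "\<dots> = (\<Sum>j\<in>degs e. f' j)"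
      by (rule sum.mono_neutral_right) (use i assms in auto)
    finally show ?thesis .
  qed
  then show ?thesis
    by (subst sum.swap) (simp add: sum_distrib_right flip: sum_distrib_left)
qed

lemma rel_mult: assumes "rel d x y" "rel e x' y'" shows "rel (d + e) (x * x') (y * y')"
proof -
  obtain f g where f: "comps d f g" and xy: "x = sum f (degs d)" "y = sum g (degs d)" using assms(1) by (rule relE)
  obtain f' g' where f': "comps e f' g'" and xy': "x' = sum f' (degs e)" "y' = sum g' (degs e)"
    using assms(2) by (rule relE)
  show ?thesis
  proof (rule relI)
    show "x * x' = (\<Sum>k\<in>degs (d + e). \<Sum>i\<in>degs d. f i * f' (k - i))"
      unfolding xy xy' by (rule convolution[OF compsD(2)[OF f']])
    show "y * y' = (\<Sum>k\<in>degs (d + e). \<Sum>i\<in>degs d. g i * g' (k - i))"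
      unfolding xy xy' by (rule convolution[OF compsD(3)[OF f']])
    have "hrel k (\<Sum>i\<in>degs d. f i * f' (k - i)) (\<Sum>i\<in>degs d. g i * g' (k - i))" for k
      using hrel_mult[OF compsD(1)[OF f] compsD(1)[OF f']]
      by (intro hrel_sum) (metis add_diff_cancel_left' add_diff_eq)
    moreover have "f' (k - i) = 0 \<and> g' (k - i) = 0" if "\<bar>k\<bar> > int (d + e)" "i \<in> degs d" for k i
      using that compsD(2,3)[OF f', of "k - i"] by auto
    ultimately show "comps (d + e) (\<lambda>k. \<Sum>i\<in>degs d. f i * f' (k - i)) (\<lambda>k. \<Sum>i\<in>degs d. g i * g' (k - i))"
      unfolding comps_def by (auto intro!: sum.neutral)
  qed
qed

lemma rel_one: "rel d 1 1"
  using rel_mono[OF rel_hrel[OF hrel_one]] by simp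

lemma rel_power: "rel d x y \<Longrightarrow> rel (d * k) (x ^ k) (y ^ k)"
  by (induction k) (auto simp: rel_one intro: rel_mult)

section \<open>Extraction of components and norm estimates\<close>

lemma hrel_compress:
  assumes "hrel j x y"
  shows "eventually2 (\<lambda>L m. st (Z L m) * x * Z L m = (if j = 0 then x else 0))"
proof -
  obtain k l where kl: "int k - int l = j" "x \<in> H k l" using hrelD[OF assms, of 0] by metis
  show ?thesis
  proof (rule eventually2_ge[where K = "max k l" and M = "k + l"])
    fix L m assume "max k l \<le> L" "k + l \<le> m"
    then show "st (Z L m) * x * Z L m = (if j = 0 then x else 0)"
      using Z_compress_0[of x k L m] Z_compress_gt[of x k l L m] Z_compress_lt[of x k l L m] kl
      by (cases k l rule: linorder_cases) auto
  qed
qed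

lemma compress_sum:
  assumes I: "finite I" "0 \<in> I" and f: "\<And>j. j \<in> I \<Longrightarrow> hrel j (f j) (g j)"
  shows "eventually2 (\<lambda>L m. st (Z L m) * (\<Sum>j\<in>I. f j) * Z L m = f 0)"
proof -
  have "eventually2 (\<lambda>L m. \<forall>j\<in>I. st (Z L m) * f j * Z L m = (if j = 0 then f j else 0))"
    by (intro eventually2_ball I) (rule hrel_compress[OF f])
  then show ?thesis
  proof (rule eventually2_mono)
    fix L m assume *: "\<forall>j\<in>I. st (Z L m) * f j * Z L m = (if j = 0 then f j else 0)"
    have "st (Z L m) * (\<Sum>j\<in>I. f j) * Z L m = (\<Sum>j\<in>I. st (Z L m) * f j * Z L m)"
      by (simp add: sum_distrib_left sum_distrib_right)
    also have "\<dots> = (\<Sum>j\<in>I. if j = 0 then f j else 0)" by (rule sum.cong) (use * in auto)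
    finally show "st (Z L m) * (\<Sum>j\<in>I. f j) * Z L m = f 0" using I by (simp add: sum.delta)
  qed
qed

text \<open>The factor \<open>Z L m\<close> is kept in the bound because smallness of elements of
  \<open>null\<close> is measured after multiplication by it. Discarding it gives the plain norm
  estimate.\<close>

lemma coeff0_le:
  assumes I: "finite I" "0 \<in> I" and f: "\<And>j. j \<in> I \<Longrightarrow> hrel j (f j) (g j)"
  shows "eventually2 (\<lambda>L m. norm (f 0) \<le> norm ((\<Sum>j\<in>I. f j) * Z L m))"
  using compress_sum[OF assms]
proof (rule eventually2_mono)
  fix L m assume "st (Z L m) * (\<Sum>j\<in>I. f j) * Z L m = f 0"
  then have "f 0 = st (Z L m) * ((\<Sum>j\<in>I. f j) * Z L m)" by (simp add: mult.assoc)
  then show "norm (f 0) \<le> norm ((\<Sum>j\<in>I. f j) * Z L m)"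
    using norm_isom_le(2)[OF isom_Z] by metis
qed

text \<open>Multiplication by a power of \<open>s 1\<close> moves the component of degree \<open>j\<close> to degree \<open>0\<close>.\<close>
lemma coeff_le:
  assumes I: "finite I" "j \<in> I" and f: "\<And>j. j \<in> I \<Longrightarrow> hrel j (f j) (g j)"
  obtains a b where "a \<in> alg" "b \<in> alg" "norm a \<le> 1" "norm b \<le> 1"
    "eventually2 (\<lambda>L m. norm (f j) \<le> norm (a * (\<Sum>j\<in>I. f j) * b * Z L m))"
proof -
  define v where "v = s 1 ^ nat \<bar>j\<bar>"
  have v: "st v * v = 1" unfolding v_def by (intro isom_power isom_12)
  have v_alg: "v \<in> alg" "st v \<in> alg"
    unfolding v_def by (auto intro!: subalg_power alg_sub one_alg s_alg one_n subalgD(6)[OF alg_sub])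
  have nv: "norm v \<le> 1" "norm (st v) \<le> 1" using norm_isom[OF v] by auto
  have hv: "hrel \<bar>j\<bar> v (s' 1 ^ nat \<bar>j\<bar>)"
    using hrel_power[OF hrel_s[OF one_n(1)], of "nat \<bar>j\<bar>"] by (simp add: v_def)
  define I' where "I' = (\<lambda>i. i - j) ` I"
  have I': "finite I'" "0 \<in> I'" using I by (auto simp: I'_def)
  have re: "(\<Sum>i\<in>I'. h (i + j)) = (\<Sum>i\<in>I. h i)" for h :: "int \<Rightarrow> 'a"
    unfolding I'_def by (subst sum.reindex) (auto simp: inj_on_def)
  show ?thesis
  proof (cases "j \<ge> 0")
    case True
    define f' where "f' = (\<lambda>i. f (i + j) * st v)"
    have "hrel i (f' i) (g (i + j) * st (s' 1 ^ nat \<bar>j\<bar>))" if "i \<in> I'" for i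
      using hrel_mult[OF f[of "i + j"] hrel_st[OF hv]] that True by (auto simp: I'_def f'_def)
    from coeff0_le[OF I' this]
    have "eventually2 (\<lambda>L m. norm (f' 0) \<le> norm ((\<Sum>i\<in>I'. f' i) * Z L m))" .
    moreover have "(\<Sum>i\<in>I'. f' i) = 1 * (\<Sum>i\<in>I. f i) * st v"
      using re[of "\<lambda>i. f i * st v"] by (simp add: f'_def sum_distrib_right)
    moreover have "norm (f' 0) = norm (f j)" by (simp add: f'_def norm_mult_coisom v)
    ultimately show ?thesis by (intro that[of 1 "st v"]) (auto simp: one_alg v_alg nv)
  next
    case False
    define f' where "f' = (\<lambda>i. v * f (i + j))"
    have "hrel i (f' i) (s' 1 ^ nat \<bar>j\<bar> * g (i + j))" if "i \<in> I'" for i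
      using hrel_mult[OF hv f[of "i + j"]] that False by (auto simp: I'_def f'_def)
    from coeff0_le[OF I' this]
    have "eventually2 (\<lambda>L m. norm (f' 0) \<le> norm ((\<Sum>i\<in>I'. f' i) * Z L m))" .
    moreover have "(\<Sum>i\<in>I'. f' i) = v * (\<Sum>i\<in>I. f i) * 1"
      using re[of "\<lambda>i. v * f i"] by (simp add: f'_def sum_distrib_left)
    moreover have "norm (f' 0) = norm (f j)" by (simp add: f'_def norm_isom_mult v)
    ultimately show ?thesis by (intro that[of v 1]) (auto simp: one_alg v_alg nv)
  qed
qed

lemma coeff_norm_le:
  assumes I: "finite I" "j \<in> I" and f: "\<And>j. j \<in> I \<Longrightarrow> hrel j (f j) (g j)"
  shows "norm (f j) \<le> norm (\<Sum>j\<in>I. f j)"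
proof -
  obtain a b where ab: "norm a \<le> 1" "norm b \<le> 1"
    "eventually2 (\<lambda>L m. norm (f j) \<le> norm (a * (\<Sum>j\<in>I. f j) * b * Z L m))"
    using coeff_le[OF assms] by metis
  then obtain L m where "norm (f j) \<le> norm (a * (\<Sum>j\<in>I. f j) * b * Z L m)"
    using eventually2_ex by blast
  also have "\<dots> \<le> norm (a * (\<Sum>j\<in>I. f j) * b)" by (rule norm_isom_le(1)[OF isom_Z])
  also have "\<dots> \<le> norm a * norm (\<Sum>j\<in>I. f j) * norm b"
    by (meson norm_mult_ineq mult_right_mono norm_ge_zero order_trans)
  also have "\<dots> \<le> 1 * norm (\<Sum>j\<in>I. f j) * 1" using ab by (intro mult_mono) auto
  finally show ?thesis by simp
qed

lemma rel_norm_le_aux: assumes "rel d x y" shows "norm y \<le> (2 * real d + 1) * norm x"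
proof -
  obtain f g where f: "\<And>j. hrel j (f j) (g j)" "x = sum f (degs d)" "y = sum g (degs d)"
    by (rule rel_components[OF assms]) blast
  have "norm (g j) \<le> norm x" if "j \<in> degs d" for j
    using coeff_norm_le[of "degs d" j f g] f that hrel_norm[OF f(1)] by simp
  then have "norm y \<le> (\<Sum>j\<in>degs d. norm x)" unfolding f(3) by (rule sum_norm_le)
  then show ?thesis by (simp add: algebra_simps)
qed

text \<open>Applying the crude bound to \<open>(x\<^sup>* x)\<^sup>N\<close> removes the factor, as it grows only linearly in \<open>N\<close>.\<close>
lemma rel_norm_le: assumes "rel d x y" shows "norm y \<le> norm x"
proof -
  have "(norm y)\<^sup>2 \<le> (norm x)\<^sup>2"
  \<comment> \<open>The degree of \<open>(st x * x) ^ 2 ^ m\<close> is at most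
    \<open>2 * d * 2 ^ m\<close>, so it has at most \<open>4 * d * 2 ^ m + 1\<close> components,
    which is below \<open>C * 2 ^ m\<close>.\<close>
  proof (rule le_of_power_le[where C = "4 * real d + 1"])
    fix m :: nat
    have "rel ((d + d) * 2 ^ m) ((st x * x) ^ 2 ^ m) ((st y * y) ^ 2 ^ m)"
      by (intro rel_power rel_mult rel_st assms)
    from rel_norm_le_aux[OF this]
    have "(norm y)\<^sup>2 ^ 2 ^ m \<le> (2 * ((real d + real d) * 2 ^ m) + 1) * (norm x)\<^sup>2 ^ 2 ^ m"
      unfolding norm_sq_power by simp
    also have "\<dots> \<le> (4 * real d + 1) * 2 ^ m * (norm x)\<^sup>2 ^ 2 ^ m"
      by (intro mult_right_mono) (auto simp: algebra_simps)
    finally show "(norm y)\<^sup>2 ^ 2 ^ m \<le> (4 * real d + 1) * 2 ^ m * (norm x)\<^sup>2 ^ 2 ^ m" by simp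
  qed auto
  then show ?thesis by (simp add: power2_le_iff_abs_le)
qed

section \<open>Extension to the closure and uniqueness of the algebra\<close>

text \<open>A relation rather than a function, since one element has many polynomial expressions.
  The inequality \<open>norm y \<le> norm x\<close> then gives single-valuedness and the extension
  to limits at once.\<close>

definition graph :: "('a \<times> 'a) set" where "graph = closure {p. \<exists>d. rel d (fst p) (snd p)}"

lemma graph_seq: "(x, y) \<in> graph \<longleftrightarrow> (\<exists>p q. (\<forall>i. \<exists>d. rel d (p i) (q i)) \<and> p \<longlonglongrightarrow> x \<and> q \<longlonglongrightarrow> y)"
proof
  assume "(x, y) \<in> graph"
  then obtain h where "\<forall>i. h i \<in> {p. \<exists>d. rel d (fst p) (snd p)}" and lim: "h \<longlonglongrightarrow> (x, y)"
    unfolding graph_def closure_sequential by blast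
  then have h: "\<And>i. \<exists>d. rel d (fst (h i)) (snd (h i))" by simp
  then show "\<exists>p q. (\<forall>i. \<exists>d. rel d (p i) (q i)) \<and> p \<longlonglongrightarrow> x \<and> q \<longlonglongrightarrow> y"
    using h tendsto_fst[OF lim] tendsto_snd[OF lim]
    by (intro exI[of _ "\<lambda>i. fst (h i)"] exI[of _ "\<lambda>i. snd (h i)"]) simp
next
  assume "\<exists>p q. (\<forall>i. \<exists>d. rel d (p i) (q i)) \<and> p \<longlonglongrightarrow> x \<and> q \<longlonglongrightarrow> y"
  then obtain p q where "\<forall>i. \<exists>d. rel d (p i) (q i)" "p \<longlonglongrightarrow> x" "q \<longlonglongrightarrow> y" by blast
  then show "(x, y) \<in> graph" unfolding graph_def closure_sequential
    using tendsto_Pair[of p x sequentially q y] by (intro exI[of _ "\<lambda>i. (p i, q i)"]) simp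
qed

lemma rel_graph: "rel d x y \<Longrightarrow> (x, y) \<in> graph"
  unfolding graph_def by (rule subsetD[OF closure_subset]) auto

lemma graphI: "(\<And>i. \<exists>d. rel d (p i) (q i)) \<Longrightarrow> p \<longlonglongrightarrow> x \<Longrightarrow> q \<longlonglongrightarrow> y \<Longrightarrow> (x, y) \<in> graph"
  unfolding graph_seq by blast

lemma graph_lift:
  assumes xy: "(x, y) \<in> graph" "(x', y') \<in> graph"
    and op: "\<And>d e a b a' b'. rel d a b \<Longrightarrow> rel e a' b' \<Longrightarrow> \<exists>c. rel c (F a a') (F b b')"
    and lim: "\<And>p q a b. p \<longlonglongrightarrow> a \<Longrightarrow> q \<longlonglongrightarrow> b \<Longrightarrow> (\<lambda>i. F (p i) (q i)) \<longlonglongrightarrow> F a b"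
  shows "(F x x', F y y') \<in> graph"
proof -
  obtain p q where p: "\<And>i. \<exists>d. rel d (p i) (q i)" "p \<longlonglongrightarrow> x" "q \<longlonglongrightarrow> y" using xy(1) unfolding graph_seq by blast
  obtain p' q' where p': "\<And>i. \<exists>d. rel d (p' i) (q' i)" "p' \<longlonglongrightarrow> x'" "q' \<longlonglongrightarrow> y'" using xy(2) unfolding graph_seq by blast
  have "\<exists>d. rel d (F (p i) (p' i)) (F (q i) (q' i))" for i using p(1)[of i] p'(1)[of i] op by blast
  then show ?thesis by (rule graphI[OF _ lim[OF p(2) p'(2)] lim[OF p(3) p'(3)]])
qed

lemma graph_add: "(x, y) \<in> graph \<Longrightarrow> (x', y') \<in> graph \<Longrightarrow> (x + x', y + y') \<in> graph"
  by (erule (1) graph_lift)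
     (rule exI, rule rel_add[OF rel_mono[OF _ max.cobounded1] rel_mono[OF _ max.cobounded2]], auto intro: tendsto_add)

lemma graph_mult: "(x, y) \<in> graph \<Longrightarrow> (x', y') \<in> graph \<Longrightarrow> (x * x', y * y') \<in> graph"
  by (erule (1) graph_lift) (auto intro: rel_mult tendsto_mult)

lemma graph_sc: "(x, y) \<in> graph \<Longrightarrow> (sc a x, sc a y) \<in> graph"
  by (rule graph_lift[where F = "\<lambda>x _. sc a x"]) (auto intro: rel_sc tendsto_sc)

lemma graph_st: "(x, y) \<in> graph \<Longrightarrow> (st x, st y) \<in> graph"
  by (rule graph_lift[where F = "\<lambda>x _. st x"]) (auto intro: rel_st tendsto_st)

lemma graph_norm: assumes "(x, y) \<in> graph" shows "norm y \<le> norm x"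
proof -
  obtain p q where p: "\<And>i. \<exists>d. rel d (p i) (q i)" "p \<longlonglongrightarrow> x" "q \<longlonglongrightarrow> y" using assms(1) unfolding graph_seq by blast
  have "norm (q i) \<le> norm (p i)" for i using p(1)[of i] rel_norm_le by blast
  then show ?thesis by (intro LIMSEQ_le[OF tendsto_norm[OF p(3)] tendsto_norm[OF p(2)]]) auto
qed

lemma graph_unique: assumes "(x, y) \<in> graph" "(x, y') \<in> graph" shows "y = y'"
proof -
  have "(x + sc (-1) x, y + sc (-1) y') \<in> graph" by (intro graph_add graph_sc assms)
  from graph_norm[OF this] show ?thesis by (simp)
qed

lemma rel_alg: assumes "rel d x y" shows "x \<in> alg" "y \<in> B.alg"
proof -
  obtain f g where f: "\<And>j. hrel j (f j) (g j)" "x = sum f (degs d)" "y = sum g (degs d)"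
    by (rule rel_components[OF assms]) blast
  have "f j \<in> alg \<and> g j \<in> B.alg" for j
    using hrelD[OF f(1)[of j], of 0] by (metis H_alg B.H_alg V_H)
  then show "x \<in> alg" "y \<in> B.alg" unfolding f(2,3) by (auto intro!: subalg_sum alg_sub B.alg_sub)
qed

lemma alg_closure_rel: assumes "x \<in> alg" shows "x \<in> closure {x. \<exists>d y. rel d x y}"
proof -
  have "cstar_sub st sc (closure {x. \<exists>d y. rel d x y})"
  proof (rule cstar_sub_closureI)
    fix x y assume "x \<in> {x. \<exists>d y. rel d x y}" "y \<in> {x. \<exists>d y. rel d x y}"
    then obtain d e x' y' where "rel d x x'" "rel e y y'" by blast
    then have "rel (max d e) (x + y) (x' + y')" "rel (d + e) (x * y) (x' * y')"
      by (auto intro!: rel_mult rel_add[OF rel_mono[OF _ max.cobounded1] rel_mono[OF _ max.cobounded2]])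
    then show "x + y \<in> {x. \<exists>d y. rel d x y}" "x * y \<in> {x. \<exists>d y. rel d x y}" by blast+
  next
    show "0 \<in> {x. \<exists>d y. rel d x y}" using rel_hrel[OF hrel_0] by blast
  qed (use rel_sc rel_st in blast)+
  moreover have "s ` {1..n} \<subseteq> closure {x. \<exists>d y. rel d x y}"
    by (rule order_trans[OF _ closure_subset]) (use rel_hrel[OF hrel_s] in blast)
  ultimately have "alg \<subseteq> closure {x. \<exists>d y. rel d x y}" unfolding cuntz_def by (rule gen_least)
  then show ?thesis using assms by blast
qed

lemma graph_total: assumes "x \<in> alg" shows "\<exists>y. (x, y) \<in> graph"
proof -
  obtain p where p: "\<And>i. \<exists>d y. rel d (p i) y" "p \<longlonglongrightarrow> x"
    using alg_closure_rel[OF assms] unfolding closure_sequential by auto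
  then obtain q where q: "\<And>i. \<exists>d. rel d (p i) (q i)" by metis
  have "norm (q i - q j) \<le> norm (p i - p j)" for i j
  proof -
    have "(p i + sc (-1) (p j), q i + sc (-1) (q j)) \<in> graph"
      using q[of i] q[of j] by (intro graph_add graph_sc) (auto intro: rel_graph)
    from graph_norm[OF this] show ?thesis by simp
  qed
  then have "Cauchy q"
    using LIMSEQ_imp_Cauchy[OF p(2)] unfolding Cauchy_def dist_norm by (meson le_less_trans)
  then obtain y where "q \<longlonglongrightarrow> y" using Cauchy_convergent convergent_def by blast
  then show ?thesis using p q unfolding graph_seq by blast
qed

lemma graph_range: assumes "(x, y) \<in> graph" shows "y \<in> B.alg"
proof -
  obtain p q where p: "\<And>i. \<exists>d. rel d (p i) (q i)" "q \<longlonglongrightarrow> y" using assms(1) unfolding graph_seq by blast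
  have "q i \<in> B.alg" for i using p(1)[of i] rel_alg by blast
  then show ?thesis using closed_sequentially[OF subalgD(2)[OF B.alg_sub] _ p(2)] by blast
qed

definition hom :: "'a \<Rightarrow> 'a" where "hom x = (THE y. (x, y) \<in> graph)"

lemma hom_eq: "(x, y) \<in> graph \<Longrightarrow> hom x = y"
  unfolding hom_def using graph_unique by blast

lemma hom_graph: "x \<in> alg \<Longrightarrow> (x, hom x) \<in> graph"
  using graph_total hom_eq by metis

lemma hom_add: "x \<in> alg \<Longrightarrow> y \<in> alg \<Longrightarrow> hom (x + y) = hom x + hom y"
  by (rule hom_eq[OF graph_add[OF hom_graph hom_graph]])

lemma hom_mult: "x \<in> alg \<Longrightarrow> y \<in> alg \<Longrightarrow> hom (x * y) = hom x * hom y"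
  by (rule hom_eq[OF graph_mult[OF hom_graph hom_graph]])

lemma hom_sc: "x \<in> alg \<Longrightarrow> hom (sc a x) = sc a (hom x)"
  by (rule hom_eq[OF graph_sc[OF hom_graph]])

lemma hom_st: "x \<in> alg \<Longrightarrow> hom (st x) = st (hom x)"
  by (rule hom_eq[OF graph_st[OF hom_graph]])

lemma hom_alg: "x \<in> alg \<Longrightarrow> hom x \<in> B.alg"
  by (rule graph_range[OF hom_graph])

lemma norm_hom: "x \<in> alg \<Longrightarrow> norm (hom x) \<le> norm x"
  by (rule graph_norm[OF hom_graph])

lemma hom_H: "x \<in> H k l \<Longrightarrow> hom x = V k * x * st (V l)"
  by (rule hom_eq[OF rel_graph[OF rel_hrel[OF hrelI]]])

lemma hom_s: "i \<in> {1..n} \<Longrightarrow> hom (s i) = s' i"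
  by (rule hom_eq[OF rel_graph[OF rel_hrel[OF hrel_s]]])

end

context cuntz_alg
begin

text \<open>The fixed points of \<open>\<psi>\<close> form a *-algebra containing the generators;
  contractivity makes this algebra closed.\<close>

lemma cstar_map_id:
  assumes add: "\<And>x y. x \<in> alg \<Longrightarrow> y \<in> alg \<Longrightarrow> \<psi> (x + y) = \<psi> x + \<psi> y"
    and mult: "\<And>x y. x \<in> alg \<Longrightarrow> y \<in> alg \<Longrightarrow> \<psi> (x * y) = \<psi> x * \<psi> y"
    and sc: "\<And>x a. x \<in> alg \<Longrightarrow> \<psi> (sc a x) = sc a (\<psi> x)"
    and st: "\<And>x. x \<in> alg \<Longrightarrow> \<psi> (st x) = st (\<psi> x)"
    and norm: "\<And>x. x \<in> alg \<Longrightarrow> norm (\<psi> x) \<le> norm x"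
    and s: "\<And>i. i \<in> {1..n} \<Longrightarrow> \<psi> (s i) = s i"
    and x: "x \<in> alg"
  shows "\<psi> x = x"
proof -
  define E where "E = {x \<in> alg. \<psi> x = x}"
  have "cstar_sub st sc E"
    unfolding cstar_sub_def
  proof (intro conjI ballI allI)
    show "closed E" unfolding closed_sequential_limits
    proof safe
      fix f x assume f: "\<forall>i. f i \<in> E" and lim: "f \<longlonglongrightarrow> x"
      have xa: "x \<in> alg" by (rule closed_sequentially[OF subalgD(2)[OF alg_sub] _ lim]) (use f in \<open>auto simp: E_def\<close>)
      have "norm (\<psi> x - f i) \<le> norm (x - f i)" for i
      proof -
        have fi: "f i \<in> alg" "\<psi> (f i) = f i" using f by (auto simp: E_def)
        have m: "sc (-1) (f i) \<in> alg" by (rule subalgD(5)[OF alg_sub fi(1)])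
        have "\<psi> (x + sc (-1) (f i)) = \<psi> x - f i"
          using add[OF xa m] sc[OF fi(1), of "-1"] fi by simp
        then show ?thesis using norm[OF subalgD(3)[OF alg_sub xa m]] by simp
      qed
      then have "(\<lambda>i. \<psi> x - f i) \<longlonglongrightarrow> 0"
        by (intro Lim_null_comparison[OF _ tendsto_norm_zero[OF LIM_zero[OF lim, THEN tendsto_minus, simplified]]])
           (auto simp: norm_minus_commute)
      from tendsto_diff[OF tendsto_const[of "\<psi> x"] this] have "f \<longlonglongrightarrow> \<psi> x" by simp
      then have "\<psi> x = x" using lim LIMSEQ_unique by blast
      then show "x \<in> E" using xa by (simp add: E_def)
    qed
    show "0 \<in> E" using sc[of 0 0] by (auto simp: E_def subalgD(1)[OF alg_sub])
  qed (auto simp: E_def add mult sc st subalgD[OF alg_sub])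
  moreover have "s ` {1..n} \<subseteq> E" using s s_alg by (auto simp: E_def)
  ultimately have "alg \<subseteq> E" unfolding cuntz_def by (rule gen_least)
  then show ?thesis using x by (auto simp: E_def)
qed

end

context cuntz_pair
begin

lemma swap: "cuntz_pair st sc n s' s"
  by unfold_locales

lemma swap_hom_hom: assumes "x \<in> alg" shows "cuntz_pair.hom st sc n s' s (hom x) = x"
proof -
  interpret rev: cuntz_pair st sc n s' s by (rule swap)
  show ?thesis
  proof (rule cstar_map_id[where \<psi> = "\<lambda>x. rev.hom (hom x)"])
    show "norm (rev.hom (hom x)) \<le> norm x" if "x \<in> alg" for x
      using order_trans[OF rev.norm_hom[OF hom_alg[OF that]] norm_hom[OF that]] .
    fix x y :: 'a and a assume *: "x \<in> alg" "y \<in> alg"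
    show "rev.hom (hom (x + y)) = rev.hom (hom x) + rev.hom (hom y)"
      unfolding hom_add[OF *] by (intro rev.hom_add hom_alg *)
    show "rev.hom (hom (x * y)) = rev.hom (hom x) * rev.hom (hom y)"
      unfolding hom_mult[OF *] by (intro rev.hom_mult hom_alg *)
  next
    fix x :: 'a and a assume *: "x \<in> alg"
    show "rev.hom (hom (sc a x)) = sc a (rev.hom (hom x))"
      unfolding hom_sc[OF *] by (intro rev.hom_sc hom_alg *)
    show "rev.hom (hom (st x)) = st (rev.hom (hom x))"
      unfolding hom_st[OF *] by (intro rev.hom_st hom_alg *)
  next
    fix i assume i: "i \<in> {1..n}"
    show "rev.hom (hom (s i)) = s i" unfolding hom_s[OF i] by (rule rev.hom_s[OF i])
  qed (rule assms)
qed

end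

context cuntz_pair
begin

lemma bij_hom: "bij_betw hom alg B.alg"
proof -
  interpret rev: cuntz_pair st sc n s' s by (rule swap)
  show ?thesis
  proof (rule bij_betw_byWitness[where f' = rev.hom])
    show "\<forall>x\<in>alg. rev.hom (hom x) = x" by (intro ballI swap_hom_hom)
    show "\<forall>y\<in>B.alg. hom (rev.hom y) = y" by (intro ballI rev.swap_hom_hom)
    show "hom ` alg \<subseteq> B.alg" using hom_alg by (rule image_subsetI)
    show "rev.hom ` B.alg \<subseteq> alg" using rev.hom_alg by (rule image_subsetI)
  qed
qed

end

section \<open>The diagonal is maximal abelian\<close>

context cuntz_alg
begin

text \<open>Pairing the family with itself makes the decomposition into homogeneous components
  available for a single family.\<close>

interpretation P: cuntz_pair st sc n s s by unfold_locales

section \<open>Faithfulness of the compression to degree 0\<close>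

lemma alg_approx:
  assumes "x \<in> alg" "e > 0"
  obtains b b' d where "P.rel d b b'" "norm (x - b) < e"
proof -
  obtain b where "b \<in> {x. \<exists>d y. P.rel d x y}" "dist b x < e"
    using P.alg_closure_rel[OF assms(1)] assms(2) unfolding closure_approachable by blast
  then show ?thesis using that by (auto simp: dist_norm norm_minus_commute)
qed

text \<open>On \<open>alg\<close> the compressions by \<open>Z L m\<close> converge to the
  projection onto degree 0. Inside \<open>alg\<close>, this set consists of those \<open>z\<close>
  for which that projection kills \<open>st z * z\<close>, and its triviality is the faithfulness of
  the projection.\<close>

definition null :: "'a set" where
  "null = {z. \<forall>e>0. eventually2 (\<lambda>L m. norm (z * Z L m) < e)}"

lemma null_add: assumes "x \<in> null" "y \<in> null" shows "x + y \<in> null"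
  unfolding null_def
proof safe
  fix e :: real assume "e > 0"
  then have "eventually2 (\<lambda>L m. norm (x * Z L m) < e / 2)" "eventually2 (\<lambda>L m. norm (y * Z L m) < e / 2)"
    using assms half_gt_zero unfolding null_def by blast+
  from eventually2_conj[OF this] show "eventually2 (\<lambda>L m. norm ((x + y) * Z L m) < e)"
    by (rule eventually2_mono) (auto simp: distrib_right intro: norm_triangle_lt)
qed

lemma null_bounded:
  assumes z: "z \<in> null" and e: "e > 0" and K: "K \<ge> 0"
    and le: "\<And>L m. norm (w * Z L m) \<le> K * norm (z * Z L m)"
  shows "eventually2 (\<lambda>L m. norm (w * Z L m) < e)"
proof -
  have "e / (K + 1) > 0" using e K by simp
  then have "eventually2 (\<lambda>L m. norm (z * Z L m) < e / (K + 1))" using z unfolding null_def by blast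
  then show ?thesis
  proof (rule eventually2_mono)
    fix L m assume *: "norm (z * Z L m) < e / (K + 1)"
    have "norm (w * Z L m) \<le> K * norm (z * Z L m)" by (rule le)
    also have "\<dots> \<le> K * (e / (K + 1))" using * K by (intro mult_left_mono) auto
    also have "\<dots> < e" using e K by (simp add: field_simps)
    finally show "norm (w * Z L m) < e" .
  qed
qed

lemma null_mult_left: assumes "z \<in> null" shows "a * z \<in> null"
  unfolding null_def
proof safe
  fix e :: real assume "e > 0"
  then show "eventually2 (\<lambda>L m. norm (a * z * Z L m) < e)"
    by (rule null_bounded[OF assms _ norm_ge_zero[of a]]) (simp add: mult.assoc norm_mult_ineq)
qed

lemma null_sc: "z \<in> null \<Longrightarrow> sc c z \<in> null"
  using null_mult_left[of z "sc c 1"] by simp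

lemma null_closed:
  assumes "\<And>e. e > 0 \<Longrightarrow> \<exists>w\<in>null. norm (z - w) < e" shows "z \<in> null"
  unfolding null_def
proof safe
  fix e :: real assume e: "e > 0"
  then obtain w where w: "w \<in> null" "norm (z - w) < e / 2" using assms[of "e/2"] by auto
  have "eventually2 (\<lambda>L m. norm (w * Z L m) < e / 2)" using w(1) half_gt_zero[OF e] unfolding null_def by blast
  then show "eventually2 (\<lambda>L m. norm (z * Z L m) < e)"
  proof (rule eventually2_mono)
    fix L m assume *: "norm (w * Z L m) < e / 2"
    have "z * Z L m = w * Z L m + (z - w) * Z L m" by (simp add: algebra_simps)
    moreover have "norm ((z - w) * Z L m) < e / 2"
      using norm_isom_le(1)[OF isom_Z] w(2) by (rule order.strict_trans1)
    ultimately show "norm (z * Z L m) < e" using * norm_triangle_lt[of "w * Z L m" "(z - w) * Z L m" e] by simp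
  qed
qed

lemma s_Z: assumes "i \<in> {1..n}"
  shows "s i * Z L m = Z (Suc L) m * s i" "st (s i) * Z (Suc L) m = Z L m * st (s i)"
proof -
  show "s i * Z L m = Z (Suc L) m * s i"
    using intertwine[OF H_s[OF assms], of "Z L m"] by (simp add: Z_def sh_sh plus_1_eq_Suc)
  show "st (s i) * Z (Suc L) m = Z L m * st (s i)"
    using intertwine[OF H_st[OF H_s[OF assms]], of "Z L m"] by (simp add: Z_def sh_sh plus_1_eq_Suc)
qed

text \<open>A left kernel is in general only a left ideal. Here a generator passes through
  \<open>Z L m\<close> at the price of changing \<open>L\<close> by one, which the limit
  ignores.\<close>

lemma null_mult_right:
  assumes z: "z \<in> null" and a: "a \<in> alg" shows "z * a \<in> null"
proof -
  define T where "T = {a. \<forall>z\<in>null. z * a \<in> null \<and> z * st a \<in> null}"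
  have "cstar_sub st sc T"
    unfolding cstar_sub_def
  proof (intro conjI ballI allI)
    show "0 \<in> T" using null_mult_left[of _ 0] by (auto simp: T_def)
    show "closed T" unfolding closed_sequential_limits
    proof safe
      fix f x assume f: "\<forall>i. f i \<in> T" and lim: "f \<longlonglongrightarrow> x"
      have *: "z * y \<in> null" if z: "z \<in> null" and g: "\<And>i. z * g i \<in> null" and lim: "g \<longlonglongrightarrow> y" for z g y
      proof (rule null_closed)
        fix e :: real assume "e > 0"
        then obtain i where "norm (z * g i - z * y) < e"
          using LIMSEQ_D[OF tendsto_mult[OF tendsto_const lim]] by blast
        then show "\<exists>w\<in>null. norm (z * y - w) < e"
          using g[of i] by (intro bexI[of _ "z * g i"]) (simp_all add: norm_minus_commute)
      qed
      show "x \<in> T" using f *[OF _ _ lim] *[OF _ _ tendsto_st[OF lim]] by (auto simp: T_def)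
    qed
  qed (auto simp: T_def distrib_left null_add null_sc st_add mult.assoc[symmetric])
  moreover have "s ` {1..n} \<subseteq> T"
  proof safe
    fix i assume i: "i \<in> {1..n}"
    show "s i \<in> T" unfolding T_def null_def
    proof safe
      fix z :: 'a and e :: real assume "\<forall>e>0. eventually2 (\<lambda>L m. norm (z * Z L m) < e)" "e > 0"
      then have ev: "eventually2 (\<lambda>L m. norm (z * Z L m) < e)" by blast
      have le1: "norm (z * s i * Z L m) \<le> norm (z * Z (Suc L) m)" for L m
      proof -
        have "z * s i * Z L m = z * Z (Suc L) m * s i" by (simp add: mult.assoc s_Z[OF i])
        then show ?thesis using norm_isom_le(1)[OF isom_s[OF i]] by metis
      qed
      have "eventually2 (\<lambda>L m. norm (z * Z (Suc L) m) < e)"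
        using ev eventually2_Suc[of "\<lambda>L m. norm (z * Z L m) < e"] by simp
      then show "eventually2 (\<lambda>L m. norm (z * s i * Z L m) < e)"
      proof (rule eventually2_mono)
        show "norm (z * Z (Suc L) m) < e \<Longrightarrow> norm (z * s i * Z L m) < e" for L m
          using le1[of L m] by linarith
      qed
      have le2: "norm (z * st (s i) * Z (Suc L) m) \<le> norm (z * Z L m)" for L m
      proof -
        have "z * st (s i) * Z (Suc L) m = z * Z L m * st (s i)" by (simp add: mult.assoc s_Z[OF i])
        then show ?thesis using norm_isom_le(4)[OF isom_s[OF i]] by metis
      qed
      from ev have "eventually2 (\<lambda>L m. norm (z * st (s i) * Z (Suc L) m) < e)"
      proof (rule eventually2_mono)
        show "norm (z * Z L m) < e \<Longrightarrow> norm (z * st (s i) * Z (Suc L) m) < e" for L m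
          using le2[of L m] by linarith
      qed
      then show "eventually2 (\<lambda>L m. norm (z * st (s i) * Z L m) < e)"
        using eventually2_Suc[of "\<lambda>L m. norm (z * st (s i) * Z L m) < e"] by simp
    qed
  qed
  ultimately have "alg \<subseteq> T" unfolding cuntz_def by (rule gen_least)
  then show ?thesis using assms by (auto simp: T_def)
qed

text \<open>\<open>X\<close> and \<open>Y\<close> agree modulo \<open>null\<close>, so each
  component of \<open>X\<close>, being visible after multiplication by \<open>Z L m\<close>, is
  bounded by \<open>norm Y\<close>. The number of components is linear in the power, and roots
  remove it.\<close>

lemma null_approx_norm:
  assumes z: "z \<in> null" "z \<in> alg" "st z = z" and b: "P.rel d b b'"
  shows "norm b \<le> norm (z - b)"
proof -
  have b_alg: "b \<in> alg" using P.rel_alg[OF b] by simp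
  define e where "e = b - z"
  have "(norm b)\<^sup>2 \<le> (norm e)\<^sup>2"
  proof (rule le_of_power_le[where C = "4 * real d + 1"])
    fix k :: nat
    define X Y where "X = (st b * b) ^ 2 ^ k" and "Y = (st e * e) ^ 2 ^ k"
    have XY: "X - Y \<in> null" unfolding X_def Y_def e_def
      by (rule square_power_diff[OF null_add null_mult_left null_mult_right null_mult_right z(1,3)])
         (simp_all add: b_alg subalgD(6)[OF alg_sub])
    define D where "D = (d + d) * 2 ^ k"
    have "P.rel D X ((st b' * b') ^ 2 ^ k)"
      unfolding D_def X_def by (intro P.rel_power P.rel_mult P.rel_st b)
    then obtain f g where f: "\<And>j. P.hrel j (f j) (g j)" "X = sum f (degs D)"
      by (rule P.rel_components) blast
    have "norm (f j) \<le> norm Y" if j: "j \<in> degs D" for j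
    proof (rule field_le_epsilon)
      fix \<delta> :: real assume \<delta>: "\<delta> > 0"
      obtain a c where ac: "a \<in> alg" "c \<in> alg" "norm a \<le> 1" "norm c \<le> 1"
        "eventually2 (\<lambda>L m. norm (f j) \<le> norm (a * X * c * Z L m))"
        using P.coeff_le[of "degs D" j f g] f j by (metis finite_atLeastAtMost_int)
      have "a * (X - Y) * c \<in> null" by (intro null_mult_right null_mult_left XY ac)
      then have "eventually2 (\<lambda>L m. norm (a * (X - Y) * c * Z L m) < \<delta>)" using \<delta> by (auto simp: null_def)
      from eventually2_ex[OF eventually2_conj[OF ac(5) this]] obtain L m where
        *: "norm (f j) \<le> norm (a * X * c * Z L m)" "norm (a * (X - Y) * c * Z L m) < \<delta>" by blast
      have "norm (a * Y * c * Z L m) \<le> norm (a * Y * c)" by (rule norm_isom_le(1)[OF isom_Z])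
      also have "\<dots> \<le> norm a * norm Y * norm c"
        by (meson norm_mult_ineq mult_right_mono norm_ge_zero order_trans)
      also have "\<dots> \<le> 1 * norm Y * 1" using ac by (intro mult_mono) auto
      finally have Y: "norm (a * Y * c * Z L m) \<le> norm Y" by simp
      have "a * X * c * Z L m = a * Y * c * Z L m + a * (X - Y) * c * Z L m" by (simp add: algebra_simps)
      then show "norm (f j) \<le> norm Y + \<delta>"
        using * Y norm_triangle_ineq[of "a * Y * c * Z L m" "a * (X - Y) * c * Z L m"] by simp
    qed
    then have "norm X \<le> (\<Sum>j\<in>degs D. norm Y)" unfolding f(2) by (rule sum_norm_le)
    also have "\<dots> = (2 * real D + 1) * norm Y" by (simp add: algebra_simps)
    also have "\<dots> \<le> ((4 * real d + 1) * 2 ^ k) * norm Y"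
      by (intro mult_right_mono) (auto simp: D_def algebra_simps)
    finally show "(norm b)\<^sup>2 ^ 2 ^ k \<le> (4 * real d + 1) * 2 ^ k * (norm e)\<^sup>2 ^ 2 ^ k"
      unfolding X_def Y_def norm_sq_power .
  qed auto
  then show ?thesis by (simp add: power2_le_iff_abs_le e_def norm_minus_commute)
qed

lemma null_zero_sa:
  assumes z: "z \<in> null" "z \<in> alg" "st z = z" shows "z = 0"
proof (rule zero_if_approx)
  fix e :: real assume "e > 0"
  then obtain b b' d where "P.rel d b b'" "norm (z - b) < e" using alg_approx[OF z(2)] by metis
  then show "\<exists>b. norm (z - b) < e \<and> norm b \<le> norm (z - b)" using null_approx_norm[OF z] by blast
qed

lemma null_zero: assumes "z \<in> null" "z \<in> alg" shows "z = 0"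
proof -
  have "st z * z = 0"
    by (rule null_zero_sa) (auto intro!: null_mult_left subalgD alg_sub assms)
  then show ?thesis by simp
qed

section \<open>Diagonal projections and pinching\<close>

abbreviation proj :: "nat list \<Rightarrow> 'a" where "proj \<mu> \<equiv> S \<mu> * st (S \<mu>)"

lemma proj_mult: "\<mu> \<in> words n k \<Longrightarrow> \<nu> \<in> words n k \<Longrightarrow> proj \<mu> * proj \<nu> = (if \<mu> = \<nu> then proj \<mu> else 0)"
  using st_S_S[of \<mu> k \<nu>] by (auto simp: mult.assoc) (metis mult.assoc mult_1_left mult_zero_left mult_zero_right)+

abbreviation D :: "'a set" where "D \<equiv> diag st sc n s"

lemma D_sub: "cstar_sub st sc D"
  unfolding diag_def by (rule cstar_sub_gen)

lemma proj_D: "\<mu> \<in> words n k \<Longrightarrow> proj \<mu> \<in> D"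
  unfolding diag_def by (rule subsetD[OF gen_subset]) (auto simp: words_def)

lemma proj_alg: "\<mu> \<in> words n k \<Longrightarrow> proj \<mu> \<in> alg"
  by (intro subalgD alg_sub S_words_alg)

lemma D_alg: "D \<subseteq> alg"
  unfolding diag_def by (intro gen_least alg_sub) (auto intro!: subalgD alg_sub S_alg)

lemma commutes_proj_D:
  assumes d: "d \<in> H k k" and c: "\<And>\<mu>. \<mu> \<in> words n k \<Longrightarrow> proj \<mu> * d = d * proj \<mu>"
  shows "d \<in> D"
proof -
  obtain a where a: "\<And>\<mu> \<nu>. \<mu> \<in> words n k \<Longrightarrow> \<nu> \<in> words n k \<Longrightarrow> st (S \<mu>) * d * S \<nu> = sc (a \<mu> \<nu>) 1"
    using H_E[OF d] by metis
  have "d = (\<Sum>\<mu>\<in>words n k. proj \<mu> * d)" using expand_left[of d k] by (simp add: mult.assoc)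
  also have "\<dots> = (\<Sum>\<mu>\<in>words n k. sc (a \<mu> \<mu>) (proj \<mu>))"
  proof (rule sum.cong[OF refl])
    fix \<mu> assume \<mu>: "\<mu> \<in> words n k"
    have "proj \<mu> * d = proj \<mu> * (proj \<mu> * d)" using proj_mult[OF \<mu> \<mu>] by (simp flip: mult.assoc)
    also have "\<dots> = proj \<mu> * (d * proj \<mu>)" by (simp only: c[OF \<mu>])
    also have "\<dots> = S \<mu> * (st (S \<mu>) * d * S \<mu>) * st (S \<mu>)" by (simp only: mult.assoc)
    also have "\<dots> = sc (a \<mu> \<mu>) (proj \<mu>)" by (simp add: a[OF \<mu> \<mu>])
    finally show "proj \<mu> * d = sc (a \<mu> \<mu>) (proj \<mu>)" .
  qed
  also have "\<dots> \<in> D" by (auto intro!: subalg_sum D_sub subalgD(5)[OF D_sub] proj_D)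
  finally show ?thesis .
qed

text \<open>Averaging over the symmetries \<open>2 proj \<mu> - 1\<close> one after the other.\<close>
lemma pinch:
  assumes T: "T \<subseteq> words n k" and y: "y \<in> H k k" and w: "\<And>\<mu>. \<mu> \<in> words n k \<Longrightarrow> proj \<mu> * w = w * proj \<mu>"
  shows "\<exists>d\<in>H k k. (\<forall>\<mu>\<in>T. proj \<mu> * d = d * proj \<mu>) \<and> norm (d - w) \<le> norm (y - w)"
proof -
  have "finite T" using T finite_words finite_subset by blast
  then show ?thesis using T
  proof (induction T)
    case empty
    show ?case using y by auto
  next
    case (insert \<mu> T)
    then obtain d where d: "d \<in> H k k" "\<And>\<nu>. \<nu> \<in> T \<Longrightarrow> proj \<nu> * d = d * proj \<nu>" "norm (d - w) \<le> norm (y - w)"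
      by auto
    have \<mu>: "\<mu> \<in> words n k" using insert by auto
    define p where "p = proj \<mu>"
    define u where "u = p + p - 1"
    have pp: "p * p = p" using proj_mult[OF \<mu> \<mu>] by (simp add: p_def)
    have stp: "st p = p" by (simp add: p_def)
    have uu: "u * u = 1" using pp by (simp add: u_def algebra_simps)
    have stu: "st u = u" by (simp add: u_def st_add st_diff stp)
    have isom: "st u * u = 1" by (simp add: stu uu)
    have uw: "u * w = w * u" using w[OF \<mu>] by (simp add: u_def p_def algebra_simps)
    define d' where "d' = (1/2) *\<^sub>R (d + u * d * u)"
    have u: "u \<in> H k k" unfolding u_def p_def by (intro H_diff H_add H_SS H_1 \<mu>)
    have "d' \<in> H k k" unfolding d'_def by (intro H_scaleR H_add H_mult[where m = k] u d(1))
    \<comment> \<open>\<open>w\<close> commutes with \<open>u\<close> and is fixed by the averaging,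
      which is a contraction; so \<open>d'\<close> is no farther from \<open>w\<close> than
      \<open>d\<close> is.\<close>
    moreover have "norm (d' - w) \<le> norm (y - w)"
    proof -
      have "u * w * u = w" using uw uu by (simp add: mult.assoc)
      then have e1: "(d + u * d * u) - (w + w) = (d - w) + u * (d - w) * u"
        by (simp add: left_diff_distrib right_diff_distrib)
      have e2: "d' - w = (1/2) *\<^sub>R ((d + u * d * u) - (w + w))"
        by (simp add: d'_def scaleR_right_diff_distrib)
      have "norm (d' - w) = (1/2) * norm ((d - w) + u * (d - w) * u)" unfolding e2 e1 by simp
      also have "\<dots> \<le> (1/2) * (norm (d - w) + norm (u * (d - w) * u))"
        by (intro mult_left_mono norm_triangle_ineq) simp
      also have "norm (u * (d - w) * u) \<le> norm (d - w)"
        using norm_isom_le(1)[OF isom, of "u * (d - w)"] norm_isom_mult[OF isom] by simp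
      finally show ?thesis using d(3) by simp
    qed
    moreover have "proj \<nu> * d' = d' * proj \<nu>" if \<nu>: "\<nu> \<in> insert \<mu> T" for \<nu>
    proof (cases "\<nu> = \<mu>")
      case True
      have up: "u * p = p" "p * u = p" using pp by (simp_all add: u_def algebra_simps)
      have "p * (d + u * d * u) = (d + u * d * u) * p"
      proof -
        have "p * (d + u * d * u) = p * d + p * d * u" by (simp add: distrib_left flip: mult.assoc) (simp add: up)
        also have "\<dots> = p * d * p + p * d * p" by (simp add: u_def algebra_simps)
        also have "\<dots> = d * p + u * d * p" by (simp add: u_def algebra_simps)
        also have "\<dots> = (d + u * d * u) * p" by (simp add: distrib_right mult.assoc up)
        finally show ?thesis .
      qed
      then show ?thesis using True by (simp add: d'_def flip: p_def)
    next
      case False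
      then have \<nu>': "\<nu> \<in> T" "\<nu> \<in> words n k" using \<nu> insert.prems by auto
      have "proj \<nu> * p = p * proj \<nu>" unfolding p_def using proj_mult \<mu> \<nu>'(2) False by auto
      then have "proj \<nu> * u = u * proj \<nu>" by (simp add: u_def algebra_simps)
      then have "proj \<nu> * (d + u * d * u) = (d + u * d * u) * proj \<nu>"
        using d(2)[OF \<nu>'(1)] by (simp add: distrib_left distrib_right) (metis mult.assoc)
      then show ?thesis by (simp add: d'_def)
    qed
    ultimately show ?case by blast
  qed
qed

lemma Z_commute_proj:
  assumes "\<mu> \<in> words n k" "k \<le> L" shows "proj \<mu> * Z L m = Z L m * proj \<mu>" "proj \<mu> * st (Z L m) = st (Z L m) * proj \<mu>"
proof -
  show *: "proj \<mu> * Z L m = Z L m * proj \<mu>" by (rule Z_compress_0(2)[OF H_SS assms(2)]) (use assms in auto)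
  show "proj \<mu> * st (Z L m) = st (Z L m) * proj \<mu>" using arg_cong[OF *, of st] by (simp add: mult.assoc)
qed

lemma ZZ_D: "Z L m * st (Z L m) \<in> D"
proof -
  have "Z L m * st (Z L m) = sh L (gap m * st (gap m))" by (simp add: Z_def sh_mult sh_st)
  also have "\<dots> = (\<Sum>\<mu>\<in>words n L. proj (\<mu> @ replicate m 1 @ [2]))"
    by (simp add: sh_def gap_def mult.assoc)
  also have "\<dots> \<in> D"
  proof (intro subalg_sum D_sub)
    fix \<mu> assume "\<mu> \<in> words n L"
    then have "\<mu> @ replicate m 1 @ [2] \<in> words n (L + (m + 1))"
      using one_n by (auto simp: words_def)
    then show "proj (\<mu> @ replicate m 1 @ [2]) \<in> D" by (rule proj_D)
  qed
  finally show ?thesis .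
qed

text \<open>For \<open>x\<close> in the commutant of \<open>D\<close>, the compressions \<open>(Z L m)\<^sup>* x (Z L m)\<close> converge to some
  \<open>d \<in> D\<close>, and \<open>x - d\<close> is annihilated in the limit because it commutes with the range
  projection of \<open>Z L m\<close>.\<close>
lemma commutant_D_approx:
  assumes x: "x \<in> alg" and c: "\<And>d. d \<in> D \<Longrightarrow> d * x = x * d" and e: "e > 0"
  shows "\<exists>d\<in>D. eventually2 (\<lambda>L m. norm ((x - d) * Z L m) < e \<and> st (Z L m) * d * Z L m = d)"
proof -
  define \<delta> where "\<delta> = e / 4"
  have \<delta>: "\<delta> > 0" using e by (simp add: \<delta>_def)
  obtain b b' r where b: "P.rel r b b'" "norm (x - b) < \<delta>" using alg_approx[OF x \<delta>] by metis
  obtain f g where f: "\<And>j. P.hrel j (f j) (g j)" "b = sum f (degs r)"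
    by (rule P.rel_components[OF b(1)]) blast
  have comp: "eventually2 (\<lambda>L m. st (Z L m) * b * Z L m = f 0)"
    unfolding f(2) by (rule P.compress_sum[where g = g]) (use f in auto)
  obtain k where k: "f 0 \<in> H k k" using P.hrelD[OF f(1)[of 0], of 0] by (metis eq_iff_diff_eq_0 of_nat_eq_iff)
  have near: "norm (f 0 - st (Z L m) * x * Z L m) < \<delta>" if "st (Z L m) * b * Z L m = f 0" for L m
  proof -
    have "f 0 - st (Z L m) * x * Z L m = st (Z L m) * (b - x) * Z L m"
      using that by (simp add: algebra_simps)
    also have "norm \<dots> \<le> norm (b - x)"
      using norm_isom_le(1)[OF isom_Z] norm_isom_le(2)[OF isom_Z] order_trans by blast
    finally show ?thesis using b(2) by (simp add: norm_minus_commute)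
  qed
  have geK: "eventually2 (\<lambda>L m. k \<le> L)" by (rule eventually2_ge) auto
  obtain L0 m0 where 0: "st (Z L0 m0) * b * Z L0 m0 = f 0" "k \<le> L0"
    using eventually2_ex[OF eventually2_conj[OF comp geK]] by blast
  \<comment> \<open>\<open>w\<close> is close to \<open>f 0\<close> and commutes exactly with the
    projections of words of length \<open>k\<close>. Pinching fixes \<open>w\<close>, so it moves
    \<open>f 0\<close> by less than \<open>2 * \<delta>\<close>.\<close>
  define w where "w = st (Z L0 m0) * x * Z L0 m0"
  have "proj \<mu> * w = w * proj \<mu>" if \<mu>: "\<mu> \<in> words n k" for \<mu>
  proof -
    note cp = Z_commute_proj[OF \<mu> 0(2), of m0] c[OF proj_D[OF \<mu>]]
    have "proj \<mu> * w = (proj \<mu> * st (Z L0 m0)) * x * Z L0 m0" by (simp add: w_def mult.assoc)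
    also have "\<dots> = st (Z L0 m0) * (proj \<mu> * x) * Z L0 m0" unfolding cp(2) by (simp add: mult.assoc)
    also have "\<dots> = st (Z L0 m0) * x * (proj \<mu> * Z L0 m0)" unfolding cp(3) by (simp add: mult.assoc)
    also have "\<dots> = w * proj \<mu>" unfolding cp(1) w_def by (simp add: mult.assoc)
    finally show ?thesis .
  qed
  from pinch[OF subset_refl k this] obtain d where d: "d \<in> H k k" "\<And>\<mu>. \<mu> \<in> words n k \<Longrightarrow> proj \<mu> * d = d * proj \<mu>"
    "norm (d - w) \<le> norm (f 0 - w)" by blast
  have dD: "d \<in> D" using commutes_proj_D[OF d(1,2)] .
  have fw: "norm (f 0 - w) < \<delta>" unfolding w_def by (rule near[OF 0(1)])
  have "d - f 0 = (d - w) - (f 0 - w)" by simp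
  then have df: "norm (d - f 0) < 2 * \<delta>"
    using norm_triangle_ineq4[of "d - w" "f 0 - w"] d(3) fw by simp
  have "eventually2 (\<lambda>L m. norm ((x - d) * Z L m) < e \<and> st (Z L m) * d * Z L m = d)"
    using eventually2_conj[OF comp geK]
  proof (rule eventually2_mono)
    fix L m assume *: "st (Z L m) * b * Z L m = f 0 \<and> k \<le> L"
    let ?q = "Z L m * st (Z L m)"
    have d': "st (Z L m) * d * Z L m = d" using Z_compress_0(1)[OF d(1)] * by blast
    have "?q * d = d * ?q"
      using Z_compress_0(2)[OF d(1), of L m] Z_compress_0(2)[OF H_st[OF d(1)], of L m] *
      by (metis mult.assoc st_mult st_st)
    then have "(x - d) * ?q = ?q * (x - d)" using c[OF ZZ_D, of L m] by (simp add: algebra_simps)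
    moreover have "(x - d) * Z L m = (x - d) * ?q * Z L m" by (simp add: mult.assoc isom_Z)
    ultimately have "(x - d) * Z L m = Z L m * (st (Z L m) * (x - d) * Z L m)" by (simp add: mult.assoc)
    then have "norm ((x - d) * Z L m) = norm (st (Z L m) * (x - d) * Z L m)"
      by (simp add: norm_isom_mult isom_Z)
    also have "st (Z L m) * (x - d) * Z L m = (f 0 - d) - (f 0 - st (Z L m) * x * Z L m)"
      using d' by (simp add: left_diff_distrib right_diff_distrib)
    also have "norm \<dots> < 2 * \<delta> + \<delta>"
      using norm_triangle_ineq4[of "f 0 - d" "f 0 - st (Z L m) * x * Z L m"] df near[of L m] *
      by (simp add: norm_minus_commute)
    also have "\<dots> < e" using e by (simp add: \<delta>_def)
    finally show "norm ((x - d) * Z L m) < e \<and> st (Z L m) * d * Z L m = d" using d' by simp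
  qed
  then show ?thesis using dD by blast
qed

theorem diag_maximal:
  assumes x: "x \<in> alg" and c: "\<And>d. d \<in> D \<Longrightarrow> d * x = x * d"
  shows "x \<in> D"
proof -
  have "\<forall>i::nat. \<exists>d\<in>D. eventually2 (\<lambda>L m. norm ((x - d) * Z L m) < 1 / Suc i \<and> st (Z L m) * d * Z L m = d)"
    using commutant_D_approx[OF x c] by simp
  from this[unfolded Bex_def, THEN choice] obtain d where d: "\<And>i. d i \<in> D"
    "\<And>i::nat. eventually2 (\<lambda>L m. norm ((x - d i) * Z L m) < 1 / Suc i \<and> st (Z L m) * d i * Z L m = d i)"
    by blast
  \<comment> \<open>Compression by one common \<open>Z L m\<close> fixes both \<open>d i\<close> and
    \<open>d j\<close>; in the difference \<open>x\<close> cancels and the two errors bound the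
    distance.\<close>
  have dist: "norm (d i - d j) < 1 / Suc i + 1 / Suc j" for i j
  proof -
    obtain L m where *: "norm ((x - d i) * Z L m) < 1 / Suc i" "st (Z L m) * d i * Z L m = d i"
      "norm ((x - d j) * Z L m) < 1 / Suc j" "st (Z L m) * d j * Z L m = d j"
      using eventually2_ex[OF eventually2_conj[OF d(2)[of i] d(2)[of j]]] by blast
    have "d i - d j = st (Z L m) * ((x - d j) * Z L m - (x - d i) * Z L m)"
      using *(2,4) by (simp add: algebra_simps)
    then have "norm (d i - d j) \<le> norm ((x - d j) * Z L m - (x - d i) * Z L m)"
      by (simp add: norm_isom_le(2)[OF isom_Z])
    also have "\<dots> \<le> norm ((x - d j) * Z L m) + norm ((x - d i) * Z L m)" by (rule norm_triangle_ineq4)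
    finally show ?thesis using * by linarith
  qed
  have small: "\<exists>N. \<forall>i\<ge>N. 1 / real (Suc i) < e" if e: "e > 0" for e
  proof -
    obtain N where N: "inverse (real (Suc N)) < e" using reals_Archimedean[OF e] by blast
    have "1 / real (Suc i) < e" if "i \<ge> N" for i
      using that N order.strict_trans1[of "1 / real (Suc i)" "1 / real (Suc N)" e]
      by (simp add: inverse_eq_divide frac_le)
    then show ?thesis by blast
  qed
  have "Cauchy d" unfolding Cauchy_def dist_norm
  proof (intro allI impI)
    fix e :: real assume "e > 0"
    then obtain N where N: "\<And>i. i \<ge> N \<Longrightarrow> 1 / real (Suc i) < e / 2" using small[of "e / 2"] by auto
    have "norm (d i - d j) < e" if "i \<ge> N" "j \<ge> N" for i j
      using dist[of i j] N[OF that(1)] N[OF that(2)] by linarith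
    then show "\<exists>M. \<forall>m\<ge>M. \<forall>n\<ge>M. norm (d m - d n) < e" by blast
  qed
  then obtain d0 where lim: "d \<longlonglongrightarrow> d0" using Cauchy_convergent convergent_def by blast
  have d0: "d0 \<in> D" by (rule closed_sequentially[OF subalgD(2)[OF D_sub] d(1) lim])
  have "x - d0 \<in> null" unfolding null_def
  proof safe
    fix e :: real assume e: "e > 0"
    then obtain N where N: "\<And>i. i \<ge> N \<Longrightarrow> 1 / real (Suc i) < e / 2" using small[of "e / 2"] by auto
    obtain N' where N': "\<And>i. i \<ge> N' \<Longrightarrow> norm (d i - d0) < e / 2" using LIMSEQ_D[OF lim, of "e / 2"] e by auto
    define i where "i = max N N'"
    show "eventually2 (\<lambda>L m. norm ((x - d0) * Z L m) < e)"
      using d(2)[of i]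
    proof (rule eventually2_mono)
      fix L m assume "norm ((x - d i) * Z L m) < 1 / Suc i \<and> st (Z L m) * d i * Z L m = d i"
      then have 1: "norm ((x - d i) * Z L m) < e / 2" using N[of i] by (simp add: i_def)
      have 2: "norm ((d i - d0) * Z L m) < e / 2"
        using norm_isom_le(1)[OF isom_Z] N'[of i] by (rule order.strict_trans1) (simp add: i_def)
      have "(x - d0) * Z L m = (x - d i) * Z L m + (d i - d0) * Z L m" by (simp add: algebra_simps)
      then show "norm ((x - d0) * Z L m) < e"
        using norm_triangle_lt[of "(x - d i) * Z L m" "(d i - d0) * Z L m" e] 1 2 by simp
    qed
  qed
  moreover have "x - d0 \<in> alg" using x d0 D_alg by (intro subalg_diff alg_sub) auto
  ultimately have "x - d0 = 0" by (rule null_zero)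
  then show ?thesis using d0 by simp
qed

end

section \<open>The gauge action and its fixed points\<close>

context cuntz_alg
begin

interpretation P: cuntz_pair st sc n s s by unfold_locales

text \<open>The UHF algebra generated by the increasing matrix algebras \<open>H k k\<close> of size
  \<open>n ^ k\<close>.\<close>

definition core :: "'a set" where "core = closure (\<Union>k. H k k)"

lemma H_core: "x \<in> H k k \<Longrightarrow> x \<in> core"
  unfolding core_def by (rule subsetD[OF closure_subset]) auto

lemma core_sub: "cstar_sub st sc core"
  unfolding core_def
proof (rule cstar_sub_closureI)
  fix x y assume "x \<in> (\<Union>k. H k k)" "y \<in> (\<Union>k. H k k)"
  then obtain k l where *: "x \<in> H k k" "y \<in> H l l" by blast
  have "x \<in> H (max k l) (max k l)" "y \<in> H (max k l) (max k l)"
    by (rule H_raise'[OF *(1)] H_raise'[OF *(2)]; simp)+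
  then have "x + y \<in> H (max k l) (max k l)" "x * y \<in> H (max k l) (max k l)"
    by (auto intro: H_add H_mult)
  then show "x + y \<in> (\<Union>k. H k k)" "x * y \<in> (\<Union>k. H k k)" by blast+
qed (auto intro: H_0 H_sc H_st)

lemma core_alg: "core \<subseteq> alg"
  unfolding core_def by (rule closure_minimal) (use H_alg subalgD(2)[OF alg_sub] in auto)

lemma core_approx:
  assumes "x \<in> core" "e > 0"
  obtains k b where "k \<ge> K" "b \<in> H k k" "norm (x - b) < e"
proof -
  obtain b where b: "b \<in> (\<Union>k. H k k)" "dist b x < e"
    using assms unfolding core_def closure_approachable by blast
  then obtain k where "b \<in> H k k" by blast
  then have "b \<in> H (max k K) (max k K)" by (rule H_raise') auto
  with b show ?thesis using that[of "max k K" b] by (simp add: dist_norm norm_minus_commute)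
qed

section \<open>Gauge automorphisms\<close>

lemma gauge_family: assumes "cmod t = 1" shows "cuntz_alg st sc n (\<lambda>i. sc t (s i))"
proof
  have t: "cnj t * t = 1" "t * cnj t = 1"
    using assms complex_norm_square[of t] by (simp_all add: mult.commute)
  show "cuntz_family st n (\<lambda>i. sc t (s i))"
    unfolding cuntz_family_def using sum_s t by (simp add: isom_s)
qed (rule n_ge_2)

lemma smon_gauge: "smon (\<lambda>i. sc t (s i)) \<mu> = sc (t ^ length \<mu>) (S \<mu>)"
  by (induction \<mu>) (auto simp: mult.commute)

lemma alg_gauge: assumes "cmod t = 1" shows "cuntz st sc n (\<lambda>i. sc t (s i)) = alg"
proof
  interpret G: cuntz_alg st sc n "\<lambda>i. sc t (s i)" by (rule gauge_family[OF assms])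
  show "G.alg \<subseteq> alg" unfolding cuntz_def[of _ _ _ "\<lambda>i. sc t (s i)"]
    by (rule gen_least[OF alg_sub]) (auto intro!: subalgD(5)[OF alg_sub] s_alg)
  have "s i \<in> G.alg" if "i \<in> {1..n}" for i
  proof -
    have "sc (1 / t) (sc t (s i)) \<in> G.alg" by (intro subalgD(5)[OF G.alg_sub] G.s_alg that)
    then show ?thesis using assms by (cases "t = 0") auto
  qed
  then show "alg \<subseteq> G.alg" unfolding cuntz_def[of _ _ _ s] by (intro gen_least G.alg_sub) auto
qed

definition gauge_aut :: "complex \<Rightarrow> 'a \<Rightarrow> 'a" where
  "gauge_aut t = cuntz_pair.hom st sc n s (\<lambda>i. sc t (s i))"

lemma gauge_pair: "cmod t = 1 \<Longrightarrow> cuntz_pair st sc n s (\<lambda>i. sc t (s i))"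
  using gauge_family by (simp add: cuntz_pair_def cuntz_alg_axioms)

lemma gauge_props:
  assumes t: "cmod t = 1"
  shows "star_auto st sc alg (gauge_aut t)" "i \<in> {1..n} \<Longrightarrow> gauge_aut t (s i) = sc t (s i)"
    "x \<in> alg \<Longrightarrow> norm (gauge_aut t x) \<le> norm x" "x \<in> H k l \<Longrightarrow> gauge_aut t x = sc (t ^ k * cnj t ^ l) x"
    "x \<in> alg \<Longrightarrow> y \<in> alg \<Longrightarrow> gauge_aut t (x + y) = gauge_aut t x + gauge_aut t y"
    "x \<in> alg \<Longrightarrow> gauge_aut t (sc a x) = sc a (gauge_aut t x)"
proof -
  interpret G: cuntz_pair st sc n s "\<lambda>i. sc t (s i)" by (rule gauge_pair[OF t])
  have hom_alg: "\<And>x. x \<in> alg \<Longrightarrow> G.hom x \<in> alg" using G.hom_alg alg_gauge[OF t] by blast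
  have "star_endo st sc alg G.hom"
    unfolding star_endo_def using hom_alg by (auto simp: G.hom_add G.hom_mult G.hom_sc G.hom_st)
  moreover have "bij_betw G.hom alg alg" using G.bij_hom by (simp only: alg_gauge[OF t])
  ultimately show "star_auto st sc alg (gauge_aut t)" by (simp add: star_auto_def gauge_aut_def)
  show "i \<in> {1..n} \<Longrightarrow> gauge_aut t (s i) = sc t (s i)" unfolding gauge_aut_def by (rule G.hom_s)
  show "x \<in> alg \<Longrightarrow> norm (gauge_aut t x) \<le> norm x" unfolding gauge_aut_def by (rule G.norm_hom)
  show "x \<in> alg \<Longrightarrow> y \<in> alg \<Longrightarrow> gauge_aut t (x + y) = gauge_aut t x + gauge_aut t y" unfolding gauge_aut_def by (rule G.hom_add)
  show "x \<in> alg \<Longrightarrow> gauge_aut t (sc a x) = sc a (gauge_aut t x)" unfolding gauge_aut_def by (rule G.hom_sc)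
  have V: "G.V k = sc (t ^ k) 1" for k
  proof -
    have "G.V k = (\<Sum>\<mu>\<in>words n k. sc (t ^ k) (S \<mu> * st (S \<mu>)))"
      unfolding G.V_def smon_gauge by (intro sum.cong refl) (auto simp: words_def)
    then show ?thesis by (simp add: sum_S flip: sc_sum_right)
  qed
  show "x \<in> H k l \<Longrightarrow> gauge_aut t x = sc (t ^ k * cnj t ^ l) x"
    unfolding gauge_aut_def by (simp add: G.hom_H V mult.commute)
qed

text \<open>\<open>gauge_fixed\<close> quantifies over all automorphisms with the right values on
  the generators. Any such \<open>\<omega>\<close> is contractive, and following it by the inverse
  of \<open>gauge_aut t\<close> fixes the generators and hence everything.\<close>

lemma gauge_unique:
  assumes t: "cmod t = 1" and \<omega>: "star_auto st sc alg \<omega>" and \<omega>s: "\<And>i. i \<in> {1..n} \<Longrightarrow> \<omega> (s i) = sc t (s i)"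
    and x: "x \<in> alg"
  shows "\<omega> x = gauge_aut t x"
proof -
  interpret G: cuntz_pair st sc n s "\<lambda>i. sc t (s i)" by (rule gauge_pair[OF t])
  interpret R: cuntz_pair st sc n "\<lambda>i. sc t (s i)" s by (rule G.swap)
  note e = alg_gauge[OF t]
  have en: "star_endo st sc alg \<omega>" using \<omega> by (simp add: star_auto_def)
  have \<omega>_alg: "\<omega> x \<in> G.B.alg" if "x \<in> alg" for x using en that e by (auto simp: star_endo_def)
  have \<omega>_norm: "norm (\<omega> x) \<le> norm x" if "x \<in> alg" for x
    by (rule star_endo_contractive[OF alg_sub one_alg en star_auto_one[OF one_alg \<omega>] that])
  have "R.hom (\<omega> x) = x"
  proof (rule cstar_map_id[where \<psi> = "\<lambda>x. R.hom (\<omega> x)"])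
    fix x y assume *: "x \<in> alg" "y \<in> alg"
    have "\<omega> (x + y) = \<omega> x + \<omega> y" "\<omega> (x * y) = \<omega> x * \<omega> y" using en * by (auto simp: star_endo_def)
    then show "R.hom (\<omega> (x + y)) = R.hom (\<omega> x) + R.hom (\<omega> y)" "R.hom (\<omega> (x * y)) = R.hom (\<omega> x) * R.hom (\<omega> y)"
      using R.hom_add R.hom_mult \<omega>_alg * by simp_all
  next
    fix x a assume *: "x \<in> alg"
    have "\<omega> (sc a x) = sc a (\<omega> x)" "\<omega> (st x) = st (\<omega> x)" using en * by (auto simp: star_endo_def)
    then show "R.hom (\<omega> (sc a x)) = sc a (R.hom (\<omega> x))" "R.hom (\<omega> (st x)) = st (R.hom (\<omega> x))"
      using R.hom_sc R.hom_st \<omega>_alg * by simp_all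
    show "norm (R.hom (\<omega> x)) \<le> norm x"
      by (rule order_trans[OF R.norm_hom[OF \<omega>_alg[OF *]] \<omega>_norm[OF *]])
  next
    fix i assume i: "i \<in> {1..n}"
    show "R.hom (\<omega> (s i)) = s i" unfolding \<omega>s[OF i] by (rule R.hom_s[OF i])
  qed (rule x)
  then show ?thesis unfolding gauge_aut_def using R.swap_hom_hom[OF \<omega>_alg[OF x]] by simp
qed

lemma core_gauge: assumes t: "cmod t = 1" and x: "x \<in> core" shows "gauge_aut t x = x"
proof (rule ccontr)
  assume "gauge_aut t x \<noteq> x"
  then have pos: "norm (gauge_aut t x - x) / 2 > 0" by simp
  obtain k b where b: "b \<in> H k k" "norm (x - b) < norm (gauge_aut t x - x) / 2" using core_approx[OF x pos] by metis
  have x_alg: "x \<in> alg" "b \<in> alg" "x - b \<in> alg"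
    using x core_alg H_alg[OF b(1)] subalg_diff[OF alg_sub] by auto
  have "t ^ k * cnj t ^ k = 1"
    using complex_norm_square[of t] t by (simp flip: power_mult_distrib)
  then have "gauge_aut t b = b" using gauge_props(4)[OF t b(1)] by simp
  moreover have "gauge_aut t x = gauge_aut t (x - b) + gauge_aut t b"
    using gauge_props(5)[OF t x_alg(3,2)] by simp
  ultimately have "gauge_aut t x - x = gauge_aut t (x - b) - (x - b)" by simp
  then have "norm (gauge_aut t x - x) \<le> norm (gauge_aut t (x - b)) + norm (x - b)"
    by (simp only: norm_triangle_ineq4)
  then show False using b(2) gauge_props(3)[OF t x_alg(3)] by linarith
qed

text \<open>An invariant \<open>x\<close> is no farther from the degree-0 part of a polynomial
  \<open>b\<close> than from \<open>b\<close> itself: the gauge automorphisms turn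
  \<open>x - b\<close> into a trigonometric polynomial in \<open>t\<close> bounded by
  \<open>norm (x - b)\<close>, whose coefficient of degree 0 is \<open>x - f 0\<close>.\<close>

lemma gauge_fixed_core: assumes x: "x \<in> alg" and fix': "\<And>t. cmod t = 1 \<Longrightarrow> gauge_aut t x = x" shows "x \<in> core"
  unfolding core_def closure_approachable
proof (intro allI impI)
  fix e :: real assume "e > 0"
  then obtain b b' r where b: "P.rel r b b'" "norm (x - b) < e" using alg_approx[OF x] by metis
  obtain f g where f: "\<And>j. P.hrel j (f j) (g j)" "b = sum f (degs r)"
    by (rule P.rel_components[OF b(1)]) blast
  have b_alg: "b \<in> alg" using P.rel_alg[OF b(1)] by simp
  have xb: "x - b \<in> alg" by (intro subalg_diff alg_sub x b_alg)
  have f_alg: "f j \<in> alg" for j using P.hrelD[OF f(1)[of j], of 0] H_alg by metis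
  \<comment> \<open>Index \<open>i\<close> stands for degree \<open>i - r\<close>, which makes all
    exponents of \<open>t\<close> nonnegative; \<open>x\<close>, being invariant, is placed in
    degree 0.\<close>
  define h where "h = (\<lambda>i::nat. (if i = r then x else 0) - f (int i - int r))"
  have "norm (h r) \<le> norm (x - b)"
  proof (rule fourier_coeff_le[where M = "2 * r + 1"])
    fix t :: complex assume t: "cmod t = 1"
    have tt: "t * cnj t = 1" using complex_norm_square[of t] t by simp
    have gf: "sc (t ^ r) (gauge_aut t (f j)) = sc (t ^ nat (j + int r)) (f j)" if j: "j \<in> degs r" for j
    proof -
      obtain k l where kl: "int k - int l = j" "f j \<in> H k l" using P.hrelD[OF f(1)[of j], of 0] by metis
      have "k + r = l + nat (j + int r)" using kl(1) j by auto
      then have "t ^ r * (t ^ k * cnj t ^ l) = t ^ nat (j + int r) * (t ^ l * cnj t ^ l)"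
        by (metis (no_types, opaque_lifting) mult.assoc mult.commute power_add)
      also have "t ^ l * cnj t ^ l = 1" using tt by (simp flip: power_mult_distrib)
      finally show ?thesis using gauge_props(4)[OF t kl(2)] by simp
    qed
    have "gauge_aut t (sum f I) = (\<Sum>j\<in>I. gauge_aut t (f j))" if "finite I" for I
      using that
    proof (induction I)
      case empty
      show ?case using gauge_props(6)[OF t, of 0 0] subalgD(1)[OF alg_sub] by simp
    next
      case (insert j I)
      have "sum f I \<in> alg" by (rule subalg_sum[OF alg_sub f_alg])
      then show ?case using insert gauge_props(5)[OF t f_alg, of "sum f I"] by simp
    qed
    then have gb: "gauge_aut t b = (\<Sum>j\<in>degs r. gauge_aut t (f j))" unfolding f(2) by simp
    have "gauge_aut t (x + sc (-1) b) = gauge_aut t x + sc (-1) (gauge_aut t b)"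
      using gauge_props(5)[OF t x subalgD(5)[OF alg_sub b_alg]] gauge_props(6)[OF t b_alg] by metis
    then have "gauge_aut t (x - b) = x - gauge_aut t b" using fix'[OF t] by simp
    then have "sc (t ^ r) (gauge_aut t (x - b)) = sc (t ^ r) x - (\<Sum>j\<in>degs r. sc (t ^ r) (gauge_aut t (f j)))"
      by (simp only: gb sc_diff_right sc_sum_right)
    also have "(\<Sum>j\<in>degs r. sc (t ^ r) (gauge_aut t (f j))) = (\<Sum>j\<in>degs r. sc (t ^ nat (j + int r)) (f j))"
      by (intro sum.cong refl gf)
    also have "\<dots> = (\<Sum>i<2 * r + 1. sc (t ^ i) (f (int i - int r)))"
      by (rule sum.reindex_bij_witness[where j = "\<lambda>j. nat (j + int r)" and i = "\<lambda>i. int i - int r"]) auto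
    also have "sc (t ^ r) x = (\<Sum>i<2 * r + 1. sc (t ^ i) (if i = r then x else 0))"
      by (simp add: if_distrib[of "sc _"] cong: if_cong)
    finally have "(\<Sum>i<2 * r + 1. sc (t ^ i) (h i)) = sc (t ^ r) (gauge_aut t (x - b))"
      by (simp only: h_def sc_diff_right sum_subtractf)
    also have "norm \<dots> \<le> norm (x - b)"
      using gauge_props(3)[OF t xb] t by (simp add: norm_power)
    finally show "norm (\<Sum>i<2 * r + 1. sc (t ^ i) (h i)) \<le> norm (x - b)" .
  qed simp
  then have "norm (x - f 0) < e" using b(2) by (simp add: h_def)
  moreover obtain k where "f 0 \<in> H k k" using P.hrelD[OF f(1)[of 0], of 0] by (metis eq_iff_diff_eq_0 of_nat_eq_iff)
  ultimately show "\<exists>y\<in>\<Union>k. H k k. dist y x < e"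
    by (intro bexI[of _ "f 0"]) (auto simp: dist_norm norm_minus_commute)
qed

theorem gauge_fixed_eq: "gauge_fixed st sc n s = core"
proof safe
  fix x assume "x \<in> gauge_fixed st sc n s"
  then show "x \<in> core"
    using gauge_props(1,2) unfolding gauge_fixed_def by (intro gauge_fixed_core) auto
next
  fix x assume x: "x \<in> core"
  then have x_alg: "x \<in> alg" using core_alg by blast
  have "\<omega> x = x" if "cmod t = 1" "star_auto st sc alg \<omega>" "\<forall>i\<in>{1..n}. \<omega> (s i) = sc t (s i)" for t \<omega>
    using gauge_unique[OF that(1,2) _ x_alg] that(3) core_gauge[OF that(1) x] by simp
  then show "x \<in> gauge_fixed st sc n s" unfolding gauge_fixed_def using x_alg by blast
qed

text \<open>The left kernel of the vector functionals attached to the infinite words ending in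
  \<open>111\<dots>\<close>.\<close>
definition vnull :: "'a set" where
  "vnull = {y. \<forall>k. \<forall>\<alpha>\<in>words n k. (\<lambda>m. y * S \<alpha> * s 1 ^ m) \<longlonglongrightarrow> 0}"

lemma vnullD: "y \<in> vnull \<Longrightarrow> \<alpha> \<in> words n k \<Longrightarrow> (\<lambda>m. y * S \<alpha> * s 1 ^ m) \<longlonglongrightarrow> 0"
  by (auto simp: vnull_def)

lemma vnull_add: assumes "x \<in> vnull" "y \<in> vnull" shows "x + y \<in> vnull"
  unfolding vnull_def
proof safe
  fix k \<alpha> assume "\<alpha> \<in> words n k"
  from tendsto_add[OF vnullD[OF assms(1) this] vnullD[OF assms(2) this]]
  show "(\<lambda>m. (x + y) * S \<alpha> * s 1 ^ m) \<longlonglongrightarrow> 0" by (simp add: distrib_right)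
qed

lemma vnull_mult_left: assumes "y \<in> vnull" shows "a * y \<in> vnull"
  unfolding vnull_def
proof safe
  fix k \<alpha> assume "\<alpha> \<in> words n k"
  from tendsto_mult[OF tendsto_const vnullD[OF assms(1) this], of a]
  show "(\<lambda>m. a * y * S \<alpha> * s 1 ^ m) \<longlonglongrightarrow> 0" by (simp add: mult.assoc)
qed

text \<open>Applied to \<open>S \<alpha> * s 1 ^ (m + k)\<close>, \<open>f\<close> changes only the
  first \<open>j + k\<close> letters, so the result is a combination of columns still ending in
  \<open>m\<close> letters 1. The \<open>k\<close> letters consumed are lost in the limit.\<close>

lemma vnull_mult_right: assumes y: "y \<in> vnull" and f: "f \<in> H k k" shows "y * f \<in> vnull"
  unfolding vnull_def
proof safe
  fix j \<alpha> assume \<alpha>: "\<alpha> \<in> words n j"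
  define \<alpha>' where "\<alpha>' = \<alpha> @ replicate k 1"
  have \<alpha>': "\<alpha>' \<in> words n (j + k)" unfolding \<alpha>'_def using \<alpha> one_n by (intro words_append replicate_words)
  have f': "f \<in> H (j + k) (j + k)" by (rule H_raise'[OF f]) auto
  obtain c where c: "\<And>\<beta>. \<beta> \<in> words n (j + k) \<Longrightarrow> st (S \<beta>) * f * S \<alpha>' = sc (c \<beta>) 1"
    using H_E[OF f'] \<alpha>' by metis
  have "y * f * S \<alpha> * s 1 ^ (m + k) = (\<Sum>\<beta>\<in>words n (j + k). sc (c \<beta>) (y * S \<beta> * s 1 ^ m))" for m
  proof -
    have "y * f * S \<alpha> * s 1 ^ (m + k) = y * (f * S \<alpha>') * s 1 ^ m"
      by (simp add: \<alpha>'_def mult.assoc add.commute[of m] power_add)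
    also have "f * S \<alpha>' = (\<Sum>\<beta>\<in>words n (j + k). S \<beta> * (st (S \<beta>) * f * S \<alpha>'))"
      using expand_left[of "f * S \<alpha>'" "j + k"] by (simp only: mult.assoc)
    also have "\<dots> = (\<Sum>\<beta>\<in>words n (j + k). sc (c \<beta>) (S \<beta>))" by (intro sum.cong refl) (simp add: c)
    finally show ?thesis by (simp add: sum_distrib_left sum_distrib_right)
  qed
  moreover have "(\<lambda>m. \<Sum>\<beta>\<in>words n (j + k). sc (c \<beta>) (y * S \<beta> * s 1 ^ m)) \<longlonglongrightarrow> (\<Sum>\<beta>\<in>words n (j + k). sc (c \<beta>) 0)"
    by (intro tendsto_sum tendsto_sc vnullD[OF y])
  ultimately have "(\<lambda>m. y * f * S \<alpha> * s 1 ^ (m + k)) \<longlonglongrightarrow> 0" by simp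
  then show "(\<lambda>m. y * f * S \<alpha> * s 1 ^ m) \<longlonglongrightarrow> 0" by (rule LIMSEQ_offset)
qed

text \<open>\<open>st \<eta> * \<eta>\<close> is a scalar and passes through \<open>v\<close>. For a
  general element, right multiplication by an isometry gives only an inequality.\<close>

lemma norm_column_isom: assumes \<eta>: "\<eta> \<in> H l 0" and v: "st v * v = 1" shows "norm (\<eta> * v) = norm \<eta>"
proof -
  obtain c where c: "st \<eta> * \<eta> = sc c 1" using H_mult[OF H_st[OF \<eta>] \<eta>] H_00 by blast
  have "st (\<eta> * v) * (\<eta> * v) = st v * (st \<eta> * \<eta>) * v" by (simp add: mult.assoc)
  also have "\<dots> = st \<eta> * \<eta>" by (simp add: c v)
  finally have "(norm (\<eta> * v))\<^sup>2 = (norm \<eta>)\<^sup>2" by (metis norm_st_mult)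
  then show ?thesis by simp
qed

text \<open>The power argument with the columns \<open>X * S \<beta>\<close> in place of homogeneous
  components; their number does not depend on the power.\<close>

lemma vnull_approx_norm:
  assumes z: "z \<in> vnull" "st z = z" and b: "b \<in> H l l"
  shows "norm b \<le> norm (z - b)"
proof -
  define e where "e = b - z"
  have bb: "st b * b \<in> H l l" by (intro H_mult[where m = l] H_st b)
  have cong_pow: "(st b * b) ^ k - (st e * e) ^ k \<in> vnull" for k
    unfolding e_def
    by (rule square_power_diff[OF vnull_add vnull_mult_left vnull_mult_right[OF _ b] vnull_mult_right[OF _ H_st[OF b]] z])
  have "(norm b)\<^sup>2 \<le> (norm e)\<^sup>2"
  proof (rule le_of_power_le[where C = "real (card (words n l))"])
    fix k :: nat
    define X Y where "X = (st b * b) ^ 2 ^ k" and "Y = (st e * e) ^ 2 ^ k"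
    have X: "X \<in> H l l" unfolding X_def by (rule H_power[OF bb])
    have "norm (X * S \<beta> * st (S \<beta>)) \<le> norm Y" if \<beta>: "\<beta> \<in> words n l" for \<beta>
    proof -
      have XS: "X * S \<beta> \<in> H l 0" by (rule H_mult[OF X H_S[OF \<beta>]])
      have v: "st (s 1 ^ m) * s 1 ^ m = 1" for m by (intro isom_power isom_12)
      have "norm (X * S \<beta>) \<le> norm Y + norm ((X - Y) * S \<beta> * s 1 ^ m)" for m
      proof -
        have "norm (X * S \<beta>) = norm (X * S \<beta> * s 1 ^ m)" by (rule norm_column_isom[OF XS v, symmetric])
        also have "X * S \<beta> * s 1 ^ m = Y * S \<beta> * s 1 ^ m + (X - Y) * S \<beta> * s 1 ^ m" by (simp add: algebra_simps)
        also have "norm \<dots> \<le> norm (Y * S \<beta> * s 1 ^ m) + norm ((X - Y) * S \<beta> * s 1 ^ m)" by (rule norm_triangle_ineq)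
        finally show ?thesis
          using norm_isom_le(1)[OF v[of m], of "Y * S \<beta>"] norm_isom_le(1)[OF isom_S[OF \<beta>], of Y] by linarith
      qed
      moreover have "(\<lambda>m. norm Y + norm ((X - Y) * S \<beta> * s 1 ^ m)) \<longlonglongrightarrow> norm Y + 0"
        unfolding X_def Y_def by (intro tendsto_add tendsto_const tendsto_norm_zero vnullD[OF cong_pow \<beta>])
      ultimately have "norm (X * S \<beta>) \<le> norm Y" by (intro LIMSEQ_le_const) auto
      then show ?thesis using norm_isom_le(4)[OF isom_S[OF \<beta>], of "X * S \<beta>"] by linarith
    qed
    then have "norm X \<le> (\<Sum>\<beta>\<in>words n l. norm Y)"
      by (subst expand_right[of X l]) (rule sum_norm_le)
    also have "\<dots> = real (card (words n l)) * 1 * norm Y" by simp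
    also have "\<dots> \<le> real (card (words n l)) * 2 ^ k * norm Y"
      by (intro mult_right_mono mult_left_mono) auto
    finally show "(norm b)\<^sup>2 ^ 2 ^ k \<le> real (card (words n l)) * 2 ^ k * (norm e)\<^sup>2 ^ 2 ^ k"
      unfolding X_def Y_def norm_sq_power .
  qed auto
  then show ?thesis by (simp add: power2_le_iff_abs_le e_def norm_minus_commute)
qed

lemma vnull_zero_sa:
  assumes z: "z \<in> vnull" "st z = z" "z \<in> core" shows "z = 0"
proof (rule zero_if_approx)
  fix e :: real assume "e > 0"
  then obtain k b where "b \<in> H k k" "norm (z - b) < e" using core_approx[OF z(3)] by metis
  then show "\<exists>b. norm (z - b) < e \<and> norm b \<le> norm (z - b)" using vnull_approx_norm[OF z(1,2)] by blast
qed

lemma vnull_zero: assumes "z \<in> vnull" "z \<in> core" shows "z = 0"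
proof -
  have "st z * z = 0"
    by (rule vnull_zero_sa) (auto intro!: vnull_mult_left subalgD core_sub assms)
  then show ?thesis by simp
qed

section \<open>Slices in all tensor legs but the first\<close>

lemma s_intertwine: "i \<in> {1..n} \<Longrightarrow> s i * x = sh 1 x * s i"
  using intertwine[OF H_s, of i x] by simp

lemma st_s_intertwine: "i \<in> {1..n} \<Longrightarrow> st (s i) * sh 1 x = x * st (s i)"
  using intertwine[OF H_st[OF H_s], of i x] by simp

lemma isom_1_power: "st (s 1 ^ m) * s 1 ^ m = 1"
  by (intro isom_power isom_12)

text \<open>Matrix coefficient at the words \<open>\<alpha>111...\<close> and
  \<open>\<beta>111...\<close> in all legs but the first, cut off after \<open>m\<close> letters 1.
  For \<open>x\<close> in some \<open>H l l\<close> it is a matrix on the first leg as soon as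
  \<open>m\<close> is large, for \<open>x\<close> in \<open>core\<close> in the limit.\<close>

definition slice :: "nat list \<Rightarrow> nat list \<Rightarrow> nat \<Rightarrow> 'a \<Rightarrow> 'a" where
  "slice \<alpha> \<beta> m x = sh 1 (st (S \<alpha> * s 1 ^ m)) * x * sh 1 (S \<beta> * s 1 ^ m)"

lemma sum_slice:
  "(\<Sum>\<alpha>\<in>words n l. sh 1 (S \<alpha>) * slice \<alpha> \<beta> m z) = sh (Suc l) (st (s 1 ^ m)) * z * sh 1 (S \<beta> * s 1 ^ m)"
proof -
  have "sh (Suc l) (st (s 1 ^ m)) = sh 1 (sh l (st (s 1 ^ m)))" by (simp add: sh_sh plus_1_eq_Suc)
  also have "\<dots> = (\<Sum>\<alpha>\<in>words n l. sh 1 (S \<alpha>) * sh 1 (st (S \<alpha> * s 1 ^ m)))"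
    by (simp add: sh_def[of l] sh_sum mult.assoc flip: sh_mult)
  finally show ?thesis by (simp add: slice_def sum_distrib_right mult.assoc)
qed

text \<open>\<open>b\<close> does not reach the legs on which \<open>s 1 ^ m\<close> acts, so that
  isometry passes through and cancels. Together with \<open>sum_slice\<close> this writes a column
  of \<open>b\<close> as a finite sum over its slices.\<close>

lemma column_slice:
  assumes b: "b \<in> H (Suc l) (Suc l)" and \<beta>: "\<beta> \<in> words n l"
  shows "b * sh 1 (S \<beta>) = sh (Suc l) (st (s 1 ^ m)) * b * sh 1 (S \<beta> * s 1 ^ m)"
proof -
  let ?v = "s 1 ^ m"
  have "sh 1 (S \<beta> * ?v) = sh 1 (sh l ?v * S \<beta>)" by (simp add: sh_S[OF \<beta>])
  also have "\<dots> = sh (Suc l) ?v * sh 1 (S \<beta>)" by (simp add: sh_mult sh_sh plus_1_eq_Suc)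
  finally have "b * sh 1 (S \<beta> * ?v) = sh (Suc l) ?v * (b * sh 1 (S \<beta>))"
    using intertwine[OF b, of ?v] by (simp flip: mult.assoc)
  then have "sh (Suc l) (st ?v) * b * sh 1 (S \<beta> * ?v) = sh (Suc l) (st ?v * ?v) * (b * sh 1 (S \<beta>))"
    by (simp add: sh_mult mult.assoc)
  then show ?thesis by (simp only: isom_1_power sh_one mult_1_left)
qed

lemma isom_S_power: "\<alpha> \<in> words n k \<Longrightarrow> st (S \<alpha> * s 1 ^ m) * (S \<alpha> * s 1 ^ m) = 1"
  by (rule isom_mult[OF isom_S isom_1_power])

lemma norm_slice_le: "\<alpha> \<in> words n k \<Longrightarrow> \<beta> \<in> words n l \<Longrightarrow> norm (slice \<alpha> \<beta> m x) \<le> norm x"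
proof -
  assume *: "\<alpha> \<in> words n k" "\<beta> \<in> words n l"
  show ?thesis unfolding slice_def
    using norm_isom_le(1)[OF isom_sh[where k = 1, OF isom_S_power[where m = m, OF *(2)]], where x = "sh 1 (st (S \<alpha> * s 1 ^ m)) * x"]
      norm_isom_le(2)[OF isom_sh[where k = 1, OF isom_S_power[where m = m, OF *(1)]], where x = x] by (simp only: sh_st)
qed

lemma slice_diff: "slice \<alpha> \<beta> m (x - y) = slice \<alpha> \<beta> m x - slice \<alpha> \<beta> m y"
  by (simp add: slice_def left_diff_distrib right_diff_distrib)

text \<open>A finite-level approximation \<open>b\<close> of \<open>y\<close> has columns made of
  finitely many slices; using the slices of \<open>y\<close> instead costs at most
  \<open>norm (y - b)\<close>. Slices leave the first leg free, so each word in \<open>vnull\<close>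
  is split into its first letter and a shifted remainder.\<close>

lemma slice_zero_vnull:
  assumes y: "y \<in> core"
    and lim: "\<And>k \<alpha> \<beta>. \<alpha> \<in> words n k \<Longrightarrow> \<beta> \<in> words n k \<Longrightarrow> (\<lambda>m. slice \<alpha> \<beta> m y) \<longlonglongrightarrow> 0"
  shows "y \<in> vnull"
proof -
  have main: "(\<lambda>m. y * sh 1 (S \<beta> * s 1 ^ m)) \<longlonglongrightarrow> 0" if \<beta>: "\<beta> \<in> words n j" for \<beta> j
  proof (rule LIMSEQ_I)
    fix e :: real assume e: "e > 0"
    then have "e / 3 > 0" by simp
    from core_approx[OF y this, of "Suc j"] obtain k b where b0: "Suc j \<le> k" "b \<in> H k k" "norm (y - b) < e / 3" by metis
    obtain r where r: "k = Suc (j + r)" using b0(1) by (metis add_Suc le_Suc_ex)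
    define l where "l = j + r"
    have b: "b \<in> H (Suc l) (Suc l)" using b0 r by (simp add: l_def)
    define \<beta>' where "\<beta>' = \<beta> @ replicate r 1"
    have \<beta>': "\<beta>' \<in> words n l" unfolding \<beta>'_def l_def using \<beta> one_n by (intro words_append replicate_words)
    have "norm (b * sh 1 (S \<beta>')) \<le> norm (\<Sum>\<alpha>\<in>words n l. sh 1 (S \<alpha>) * slice \<alpha> \<beta>' m y) + norm (y - b)" for m
    proof -
      have "norm (sh (Suc l) (st (s 1 ^ m)) * (b - y) * sh 1 (S \<beta>' * s 1 ^ m)) \<le> norm (b - y)"
        using norm_isom_le(1)[OF isom_sh[where k = 1, OF isom_S_power[where m = m, OF \<beta>']], where x = "sh (Suc l) (st (s 1 ^ m)) * (b - y)"]
          norm_isom_le(2)[OF isom_sh[OF isom_1_power], of "Suc l" m "b - y"] by (simp only: sh_st)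
      moreover have "b * sh 1 (S \<beta>') = sh (Suc l) (st (s 1 ^ m)) * y * sh 1 (S \<beta>' * s 1 ^ m) +
          sh (Suc l) (st (s 1 ^ m)) * (b - y) * sh 1 (S \<beta>' * s 1 ^ m)"
        unfolding column_slice[OF b \<beta>', of m] by (simp add: algebra_simps)
      ultimately show ?thesis
        using norm_triangle_ineq[of "sh (Suc l) (st (s 1 ^ m)) * y * sh 1 (S \<beta>' * s 1 ^ m)"
            "sh (Suc l) (st (s 1 ^ m)) * (b - y) * sh 1 (S \<beta>' * s 1 ^ m)"]
        unfolding sum_slice by (simp add: norm_minus_commute)
    qed
    moreover have "(\<lambda>m. norm (\<Sum>\<alpha>\<in>words n l. sh 1 (S \<alpha>) * slice \<alpha> \<beta>' m y) + norm (y - b)) \<longlonglongrightarrow>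
        norm (\<Sum>\<alpha>\<in>words n l. sh 1 (S \<alpha>) * 0) + norm (y - b)"
      by (intro tendsto_intros lim[OF _ \<beta>']) auto
    ultimately have "norm (b * sh 1 (S \<beta>')) \<le> norm (y - b)"
      by (intro LIMSEQ_le_const) auto
    then have "norm (b * sh 1 (S \<beta>')) < e / 3" using b0 by simp
    moreover have "norm ((y - b) * sh 1 (S \<beta>')) \<le> norm (y - b)"
      by (rule norm_isom_le(1)[OF isom_sh[OF isom_S[OF \<beta>']]])
    moreover have "norm (y * sh 1 (S \<beta>')) \<le> norm (b * sh 1 (S \<beta>')) + norm ((y - b) * sh 1 (S \<beta>'))"
      using norm_triangle_ineq[of "b * sh 1 (S \<beta>')" "(y - b) * sh 1 (S \<beta>')"] by (simp add: left_diff_distrib)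
    ultimately have small: "norm (y * sh 1 (S \<beta>')) < e"
      using b0(3) e by linarith
    show "\<exists>M. \<forall>m\<ge>M. norm (y * sh 1 (S \<beta> * s 1 ^ m) - 0) < e"
    proof (intro exI[of _ r] allI impI)
      fix m assume "r \<le> m"
      then have "s 1 ^ m = s 1 ^ r * s 1 ^ (m - r)" by (simp flip: power_add)
      then have "y * sh 1 (S \<beta> * s 1 ^ m) = y * sh 1 (S \<beta>') * sh 1 (s 1 ^ (m - r))"
        by (simp add: \<beta>'_def mult.assoc flip: sh_mult)
      then show "norm (y * sh 1 (S \<beta> * s 1 ^ m) - 0) < e"
        using small norm_isom_le(1)[OF isom_sh[OF isom_1_power], of "y * sh 1 (S \<beta>')" 1 "m - r"] by simp
    qed
  qed
  have step: "(\<lambda>m. y * S (i # \<beta>) * s 1 ^ m) \<longlonglongrightarrow> 0" if "i \<in> {1..n}" "\<beta> \<in> words n k" for i \<beta> k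
  proof -
    have "y * S (i # \<beta>) * s 1 ^ m = y * sh 1 (S \<beta> * s 1 ^ m) * s i" for m
      using s_intertwine[OF that(1), of "S \<beta> * s 1 ^ m"] by (simp add: mult.assoc)
    then show ?thesis using tendsto_mult[OF main[OF that(2)] tendsto_const, of "s i"] by simp
  qed
  show ?thesis unfolding vnull_def
  proof safe
    fix k \<alpha> assume \<alpha>: "\<alpha> \<in> words n k"
    show "(\<lambda>m. y * S \<alpha> * s 1 ^ m) \<longlonglongrightarrow> 0"
    proof (cases \<alpha>)
      case Nil
      have "(\<lambda>m. y * S [1] * s 1 ^ m) \<longlonglongrightarrow> 0" by (rule step[OF one_n(1), of "[]" 0]) simp
      then have "(\<lambda>m. y * S \<alpha> * s 1 ^ Suc m) \<longlonglongrightarrow> 0" using Nil by (simp add: mult.assoc)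
      then show ?thesis by (rule LIMSEQ_imp_Suc)
    next
      case (Cons i \<beta>)
      then show ?thesis using step[of i \<beta> "length \<beta>"] \<alpha> by (auto simp: words_def)
    qed
  qed
qed

end

section \<open>The second shift\<close>

context cuntz_alg
begin

text \<open>In the tensor product picture \<open>sh2 k\<close> inserts \<open>k\<close> unit factors after the first one.\<close>
definition sh2 :: "nat \<Rightarrow> 'a \<Rightarrow> 'a" where
  "sh2 k x = (\<Sum>i=1..n. \<Sum>j=1..n. s i * sh k (st (s i) * x * s j) * st (s j))"

lemma cshift2_eq: "cshift2 st n s x = sh2 1 x"
  unfolding cshift2_def sh2_def sh_1 cshift_def
  by (simp add: sum_distrib_left sum_distrib_right mult.assoc)

lemma expand_1: "x = (\<Sum>i=1..n. \<Sum>j=1..n. s i * (st (s i) * x * s j) * st (s j))"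
  using expand[of x 1 1] unfolding sum_words_1 smon_singleton .

lemma eq_if_entries_eq:
  assumes "\<And>i j. i \<in> {1..n} \<Longrightarrow> j \<in> {1..n} \<Longrightarrow> st (s i) * x * s j = st (s i) * y * s j"
  shows "x = y"
proof -
  have "x = (\<Sum>i=1..n. \<Sum>j=1..n. s i * (st (s i) * x * s j) * st (s j))" by (rule expand_1)
  also have "\<dots> = (\<Sum>i=1..n. \<Sum>j=1..n. s i * (st (s i) * y * s j) * st (s j))"
    by (intro sum.cong refl) (simp add: assms)
  also have "\<dots> = y" by (rule expand_1[symmetric])
  finally show ?thesis .
qed

lemma sh2_entry:
  assumes "i \<in> {1..n}" "j \<in> {1..n}" shows "st (s i) * sh2 k x * s j = sh k (st (s i) * x * s j)"
proof -
  have "st (s i) * sh2 k x * s j =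
      (\<Sum>a=1..n. \<Sum>b=1..n. (st (s i) * s a) * sh k (st (s a) * x * s b) * (st (s b) * s j))"
    by (simp add: sh2_def sum_distrib_left sum_distrib_right mult.assoc)
  also have "\<dots> = (\<Sum>a=1..n. \<Sum>b=1..n. if b = j then (if a = i then sh k (st (s i) * x * s j) else 0) else 0)"
    by (intro sum.cong refl) (use st_s_s assms in auto)
  also have "\<dots> = sh k (st (s i) * x * s j)" using assms by simp
  finally show ?thesis .
qed

lemma sh2_0 [simp]: "sh2 0 x = x"
  by (rule eq_if_entries_eq) (simp add: sh2_entry)

lemma sh2_sh2: "sh2 k (sh2 l x) = sh2 (k + l) x"
  by (rule eq_if_entries_eq) (simp add: sh2_entry sh_sh)

lemma sh2_H_1: assumes "x \<in> H 1 1" shows "sh2 k x = x"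
proof (rule eq_if_entries_eq)
  fix i j assume *: "i \<in> {1..n}" "j \<in> {1..n}"
  then obtain c where "st (s i) * x * s j = sc c 1"
    using H_entry[OF assms, of "[i]" "[j]"] by (auto simp: words_1_singleton)
  then show "st (s i) * sh2 k x * s j = st (s i) * x * s j" using * by (simp add: sh2_entry sh_sc)
qed

lemma sh2_diff: "sh2 k (x - y) = sh2 k x - sh2 k y"
  by (rule eq_if_entries_eq) (simp add: sh2_entry sh_diff left_diff_distrib right_diff_distrib)

text \<open>\<open>sh (Suc k)\<close> acts beyond the inserted unit factors, where the tail of
  \<open>x\<close> has been moved. Slicing and inserting therefore commute.\<close>

lemma sh2_compress: "sh (Suc k) v * sh2 k x * sh (Suc k) w = sh2 k (sh 1 v * x * sh 1 w)"
proof (rule eq_if_entries_eq)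
  fix i j assume *: "i \<in> {1..n}" "j \<in> {1..n}"
  have sh: "sh (Suc k) v = sh 1 (sh k v)" for v by (simp add: sh_sh plus_1_eq_Suc)
  have "st (s i) * (sh (Suc k) v * sh2 k x * sh (Suc k) w) * s j =
      (st (s i) * sh 1 (sh k v)) * sh2 k x * (sh 1 (sh k w) * s j)"
    by (simp add: sh mult.assoc)
  also have "\<dots> = sh k v * (st (s i) * sh2 k x * s j) * sh k w"
    by (simp add: st_s_intertwine[OF *(1)] s_intertwine[OF *(2), symmetric] mult.assoc)
  also have "\<dots> = sh k (v * (st (s i) * x * s j) * w)" by (simp add: sh2_entry[OF *] sh_mult)
  also have "v * (st (s i) * x * s j) * w = (st (s i) * sh 1 v) * x * (sh 1 w * s j)"
    by (simp add: st_s_intertwine[OF *(1)] s_intertwine[OF *(2), symmetric] mult.assoc)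
  also have "\<dots> = st (s i) * (sh 1 v * x * sh 1 w) * s j" by (simp add: mult.assoc)
  finally show "st (s i) * (sh (Suc k) v * sh2 k x * sh (Suc k) w) * s j =
      st (s i) * sh2 k (sh 1 v * x * sh 1 w) * s j" by (simp add: sh2_entry[OF *])
qed

text \<open>Crude, by summing over the matrix entries; it serves for continuity and for a bound
  independent of \<open>k\<close>.\<close>

lemma norm_sh2_le: "norm (sh2 k x) \<le> (real n)\<^sup>2 * norm x"
proof -
  have "norm (s i * sh k (st (s i) * x * s j) * st (s j)) \<le> norm x"
    if "i \<in> {1..n}" "j \<in> {1..n}" for i j
    using norm_isom_le[OF isom_s[OF that(1)]] norm_isom_le[OF isom_s[OF that(2)]] norm_sh_le
    by (meson order_trans)
  then have "norm (sh2 k x) \<le> (\<Sum>i=1..n. \<Sum>j=1..n. norm x)"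
    unfolding sh2_def by (intro sum_norm_le) auto
  then show ?thesis by (simp add: power2_eq_square)
qed

lemma tendsto_sh2: assumes "f \<longlonglongrightarrow> x" shows "(\<lambda>m. sh2 k (f m)) \<longlonglongrightarrow> sh2 k x"
proof -
  have "(\<lambda>m. (real n)\<^sup>2 * norm (f m - x)) \<longlonglongrightarrow> (real n)\<^sup>2 * 0"
    by (intro tendsto_mult tendsto_const tendsto_norm_zero LIM_zero assms)
  then have lim: "(\<lambda>m. (real n)\<^sup>2 * norm (f m - x)) \<longlonglongrightarrow> 0" by simp
  have "norm (sh2 k (f m) - sh2 k x) \<le> (real n)\<^sup>2 * norm (f m - x)" for m
    by (simp only: norm_sh2_le sh2_diff[symmetric])
  then have "(\<lambda>m. sh2 k (f m) - sh2 k x) \<longlonglongrightarrow> 0"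
    by (intro Lim_null_comparison[OF always_eventually lim] allI)
  then show ?thesis by (rule LIM_zero_cancel)
qed

section \<open>Convergence of slices and commutation with their limits\<close>

lemma slice_Suc_H_1: "slice \<alpha> \<beta> (Suc m) x = sh 1 (st (s 1)) * slice \<alpha> \<beta> m x * sh 1 (s 1)"
  by (simp only: slice_def power_Suc2 st_mult sh_mult mult.assoc)

text \<open>Once \<open>\<alpha>\<close> and \<open>m\<close> letters exhaust the level of
  \<open>x\<close>, the slice is a matrix on the first leg; further isometries commute with it and
  cancel.\<close>

lemma slice_H:
  assumes x: "x \<in> H (Suc (k + m)) (Suc (k + m))" and \<alpha>: "\<alpha> \<in> words n k" "\<beta> \<in> words n k"
  shows "slice \<alpha> \<beta> m x \<in> H 1 1" "slice \<alpha> \<beta> (m + r) x = slice \<alpha> \<beta> m x"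
proof -
  show H: "slice \<alpha> \<beta> m x \<in> H 1 1"
    unfolding H_def words_1
  proof safe
    fix i j assume ij: "i \<in> {1..n}" "j \<in> {1..n}"
    have "st (s i) * slice \<alpha> \<beta> m x * s j = (st (s i) * sh 1 (st (S \<alpha> * s 1 ^ m))) * x * (sh 1 (S \<beta> * s 1 ^ m) * s j)"
      by (simp add: slice_def mult.assoc)
    also have "\<dots> = st (S (i # \<alpha> @ replicate m 1)) * x * S (j # \<beta> @ replicate m 1)"
      unfolding st_s_intertwine[OF ij(1)] s_intertwine[OF ij(2), symmetric] by (simp add: mult.assoc)
    finally have e: "st (s i) * slice \<alpha> \<beta> m x * s j = st (S (i # \<alpha> @ replicate m 1)) * x * S (j # \<beta> @ replicate m 1)" .
    have ws: "i # \<alpha> @ replicate m 1 \<in> words n (Suc (k + m))" "j # \<beta> @ replicate m 1 \<in> words n (Suc (k + m))"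
      using \<alpha> ij one_n by (auto simp: words_def)
    show "\<exists>c. st (S [i]) * slice \<alpha> \<beta> m x * S [j] = sc c 1"
      unfolding smon_singleton e by (rule H_entry[OF x ws])
  qed
  show "slice \<alpha> \<beta> (m + r) x = slice \<alpha> \<beta> m x"
  proof (induction r)
    case (Suc r)
    have "slice \<alpha> \<beta> (m + Suc r) x = sh 1 (st (s 1)) * (slice \<alpha> \<beta> m x * sh 1 (s 1))"
      using slice_Suc_H_1[of \<alpha> \<beta> "m + r" x] Suc by (simp add: mult.assoc)
    also have "slice \<alpha> \<beta> m x * sh 1 (s 1) = sh 1 (s 1) * slice \<alpha> \<beta> m x" by (rule intertwine[OF H])
    also have "sh 1 (st (s 1)) * (sh 1 (s 1) * slice \<alpha> \<beta> m x) = sh 1 (st (s 1) * s 1) * slice \<alpha> \<beta> m x"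
      by (simp add: sh_mult mult.assoc)
    finally show ?case by (simp add: isom_12)
  qed simp
qed

lemma slice_converges:
  assumes a: "a \<in> core" and \<alpha>: "\<alpha> \<in> words n k" "\<beta> \<in> words n k"
  obtains T where "T \<in> H 1 1" "(\<lambda>m. slice \<alpha> \<beta> m a) \<longlonglongrightarrow> T"
proof -
  have approx: "\<exists>M. \<exists>T\<in>H 1 1. \<forall>m\<ge>M. norm (slice \<alpha> \<beta> m a - T) < e" if e: "e > 0" for e
  proof -
    obtain l x where x: "l \<ge> Suc k" "x \<in> H l l" "norm (a - x) < e" using core_approx[OF a e] by metis
    obtain m0 where m0: "l = Suc (k + m0)" using x(1) by (metis add_Suc le_Suc_ex)
    have "norm (slice \<alpha> \<beta> m a - slice \<alpha> \<beta> m0 x) < e" if m: "m \<ge> m0" for m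
    proof -
      have "slice \<alpha> \<beta> m x = slice \<alpha> \<beta> m0 x"
        using slice_H(2)[OF x(2)[unfolded m0] \<alpha>, of "m - m0"] m by simp
      then have "slice \<alpha> \<beta> m a - slice \<alpha> \<beta> m0 x = slice \<alpha> \<beta> m (a - x)" by (simp add: slice_diff)
      then show ?thesis using norm_slice_le[OF \<alpha>, of m "a - x"] x(3) by simp
    qed
    then show ?thesis using slice_H(1)[OF x(2)[unfolded m0] \<alpha>] by blast
  qed
  have "Cauchy (\<lambda>m. slice \<alpha> \<beta> m a)" unfolding Cauchy_def dist_norm
  proof (intro allI impI)
    fix e :: real assume "e > 0"
    then obtain M T where M: "\<And>m. m \<ge> M \<Longrightarrow> norm (slice \<alpha> \<beta> m a - T) < e / 2" using approx[of "e / 2"] by auto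
    have "norm (slice \<alpha> \<beta> m a - slice \<alpha> \<beta> m' a) < e" if "m \<ge> M" "m' \<ge> M" for m m'
      using norm_triangle_ineq4[of "slice \<alpha> \<beta> m a - T" "slice \<alpha> \<beta> m' a - T"] M[OF that(1)] M[OF that(2)] by simp
    then show "\<exists>M. \<forall>m\<ge>M. \<forall>m'\<ge>M. norm (slice \<alpha> \<beta> m a - slice \<alpha> \<beta> m' a) < e" by blast
  qed
  then obtain T where T: "(\<lambda>m. slice \<alpha> \<beta> m a) \<longlonglongrightarrow> T" using Cauchy_convergent convergent_def by blast
  have "T \<in> closure (H 1 1)" unfolding closure_approachable
  proof (intro allI impI)
    fix e :: real assume e: "e > 0"
    then obtain M T' where M: "T' \<in> H 1 1" "\<And>m. m \<ge> M \<Longrightarrow> norm (slice \<alpha> \<beta> m a - T') < e / 2" using approx[of "e / 2"] by auto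
    have "norm (T - T') \<le> e / 2"
      by (rule LIMSEQ_le_const2[OF tendsto_norm[OF tendsto_diff[OF T tendsto_const]]]) (use M(2) in \<open>auto intro: less_imp_le\<close>)
    then show "\<exists>y\<in>H 1 1. dist y T < e" using M(1) e by (intro bexI[of _ T']) (auto simp: dist_norm norm_minus_commute)
  qed
  then have "T \<in> H 1 1" using closed_H by simp
  then show ?thesis using T that by blast
qed

text \<open>\<open>sh2 k a\<close> is asymptotically of the form \<open>a\<close> with its tail pushed to infinity, so that
  an element \<open>b\<close> commuting with all \<open>sh2 k a\<close> commutes with the first tensor leg of \<open>a\<close>.\<close>
lemma slice_limit_commutes:
  assumes b: "b \<in> core" and comm: "\<And>k. b * sh2 k a = sh2 k a * b"
    and \<alpha>: "\<alpha> \<in> words n j" "\<beta> \<in> words n j" and T: "T \<in> H 1 1" "(\<lambda>m. slice \<alpha> \<beta> m a) \<longlonglongrightarrow> T"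
  shows "b * T = T * b"
proof -
  define C where "C = 2 * ((real n)\<^sup>2 * norm a + norm T)"
  have bound: "norm (b * T - T * b) \<le> C * e" if e: "e > 0" for e
  proof -
    obtain l b' where b': "l \<ge> 1" "b' \<in> H l l" "norm (b - b') < e" using core_approx[OF b e] by metis
    then obtain k where l: "l = Suc k" by (metis One_nat_def Suc_le_D)
    \<comment> \<open>\<open>b'\<close> involves only the first \<open>k + 1\<close> legs, while
      \<open>sh2 k\<close> moves the tail of \<open>a\<close> beyond them; the slicing isometries
      thus pass through \<open>b'\<close>.\<close>
    have intw: "b' * sh (Suc k) y = sh (Suc k) y * b'" for y by (rule intertwine) (use b' l in simp)
    have "norm (b' * sh2 k (slice \<alpha> \<beta> m a) - sh2 k (slice \<alpha> \<beta> m a) * b') \<le> 2 * e * ((real n)\<^sup>2 * norm a)" for m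
    proof -
      let ?v = "S \<alpha> * s 1 ^ m" and ?w = "S \<beta> * s 1 ^ m" and ?A = "sh2 k a"
      have v: "st ?v * ?v = 1" "st ?w * ?w = 1" by (rule isom_S_power[OF \<alpha>(1)] isom_S_power[OF \<alpha>(2)])+
      have s2: "sh2 k (slice \<alpha> \<beta> m a) = sh (Suc k) (st ?v) * ?A * sh (Suc k) ?w"
        by (simp only: slice_def sh2_compress)
      have "b' * sh2 k (slice \<alpha> \<beta> m a) - sh2 k (slice \<alpha> \<beta> m a) * b' =
          (b' * sh (Suc k) (st ?v)) * ?A * sh (Suc k) ?w - sh (Suc k) (st ?v) * ?A * (sh (Suc k) ?w * b')"
        unfolding s2 by (simp only: mult.assoc)
      also have "\<dots> = sh (Suc k) (st ?v) * (b' * ?A - ?A * b') * sh (Suc k) ?w"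
        unfolding intw[of "st ?v"] intw[of ?w, symmetric] by (simp only: left_diff_distrib right_diff_distrib mult.assoc)
      also have "norm \<dots> \<le> norm (b' * ?A - ?A * b')"
        unfolding sh_st
        by (rule order_trans[OF norm_isom_le(1)[OF isom_sh[OF v(2)]] norm_isom_le(2)[OF isom_sh[OF v(1)]]])
      also have "b' * ?A - ?A * b' = ?A * (b - b') - (b - b') * ?A"
        using comm[of k] by (simp add: left_diff_distrib right_diff_distrib)
      also have "norm \<dots> \<le> norm ?A * norm (b - b') + norm (b - b') * norm ?A"
        by (rule order_trans[OF norm_triangle_ineq4 add_mono[OF norm_mult_ineq norm_mult_ineq]])
      also have "\<dots> = 2 * norm (b - b') * norm ?A" by simp
      also have "\<dots> \<le> 2 * e * ((real n)\<^sup>2 * norm a)"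
        using b' e norm_sh2_le by (intro mult_mono) auto
      finally show ?thesis .
    qed
    moreover have "(\<lambda>m. norm (b' * sh2 k (slice \<alpha> \<beta> m a) - sh2 k (slice \<alpha> \<beta> m a) * b')) \<longlonglongrightarrow> norm (b' * sh2 k T - sh2 k T * b')"
      by (intro tendsto_intros tendsto_sh2 T)
    \<comment> \<open>Units inserted after the first leg leave the matrix \<open>T\<close>
      unchanged, so the limit in \<open>m\<close> no longer involves \<open>k\<close>.\<close>
    ultimately have "norm (b' * T - T * b') \<le> 2 * e * ((real n)\<^sup>2 * norm a)"
      unfolding sh2_H_1[OF T(1)] by (intro LIMSEQ_le_const2) auto
    moreover have "norm (((b - b') * T - T * (b - b'))) \<le> 2 * e * norm T"
    proof -
      have "norm ((b - b') * T - T * (b - b')) \<le> norm (b - b') * norm T + norm T * norm (b - b')"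
        by (rule order_trans[OF norm_triangle_ineq4 add_mono[OF norm_mult_ineq norm_mult_ineq]])
      also have "\<dots> = 2 * norm (b - b') * norm T" by simp
      also have "\<dots> \<le> 2 * e * norm T" using b' by (intro mult_right_mono) auto
      finally show ?thesis .
    qed
    moreover have "b * T - T * b = (b' * T - T * b') + ((b - b') * T - T * (b - b'))" by (simp add: algebra_simps)
    ultimately have "norm (b * T - T * b) \<le> 2 * e * ((real n)\<^sup>2 * norm a) + 2 * e * norm T"
      by (metis add_mono norm_triangle_le)
    then show ?thesis by (simp add: C_def algebra_simps)
  qed
  have "norm (b * T - T * b) \<le> 0"
  proof (rule field_le_epsilon)
    fix e :: real assume e: "e > 0"
    have C: "C \<ge> 0" by (simp add: C_def)
    have "norm (b * T - T * b) \<le> C * (e / (C + 1))" using e C by (intro bound) simp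
    also have "\<dots> \<le> e" using e C by (simp add: field_simps)
    finally show "norm (b * T - T * b) \<le> 0 + e" by simp
  qed
  then show ?thesis by simp
qed

text \<open>The limit slices of \<open>a\<close> commute with \<open>A\<close> and belong to it by
  maximality. They are matrices, so \<open>x\<close> commutes with them, and the slices of
  \<open>x * a - a * x\<close> tend to 0. The commutator vanishes because \<open>vnull\<close> is
  trivial on \<open>core\<close>.\<close>

lemma H_1_commutant:
  assumes A: "masa st sc core A"
    and comm: "\<And>a b k. a \<in> A \<Longrightarrow> b \<in> A \<Longrightarrow> b * sh2 k a = sh2 k a * b"
    and x: "x \<in> H 1 1" and xc: "\<And>d. d \<in> A \<Longrightarrow> d \<in> H 1 1 \<Longrightarrow> x * d = d * x"
  shows "x \<in> A"
proof (rule masa_commutantD[OF A core_sub H_core[OF x]])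
  fix a assume a: "a \<in> A"
  have A_core: "A \<subseteq> core" using A by (simp add: masa_def)
  have a_core: "a \<in> core" using a A_core by blast
  have y: "x * a - a * x \<in> core"
    by (intro subalg_diff subalgD(4) core_sub H_core[OF x] a_core)
  have "x * a - a * x \<in> vnull"
  proof (rule slice_zero_vnull[OF y])
    fix k \<alpha> \<beta> assume \<alpha>: "\<alpha> \<in> words n k" "\<beta> \<in> words n k"
    obtain T where T: "T \<in> H 1 1" "(\<lambda>m. slice \<alpha> \<beta> m a) \<longlonglongrightarrow> T" using slice_converges[OF a_core \<alpha>] by metis
    have "T \<in> A"
      by (rule masa_commutantD[OF A core_sub H_core[OF T(1)]])
         (rule slice_limit_commutes[OF _ comm[OF a] \<alpha> T]; use A_core in blast)
    then have "x * T = T * x" using xc T(1) by blast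
    moreover have "slice \<alpha> \<beta> m (x * a - a * x) = x * slice \<alpha> \<beta> m a - slice \<alpha> \<beta> m a * x" for m
    proof -
      have i: "sh 1 y * x = x * sh 1 y" for y by (rule intertwine[OF x, symmetric])
      have "slice \<alpha> \<beta> m (x * a) = (sh 1 (st (S \<alpha> * s 1 ^ m)) * x) * a * sh 1 (S \<beta> * s 1 ^ m)"
        by (simp only: slice_def mult.assoc)
      also have "\<dots> = x * slice \<alpha> \<beta> m a" unfolding i by (simp only: slice_def mult.assoc)
      finally have 1: "slice \<alpha> \<beta> m (x * a) = x * slice \<alpha> \<beta> m a" .
      have "slice \<alpha> \<beta> m (a * x) = sh 1 (st (S \<alpha> * s 1 ^ m)) * a * (x * sh 1 (S \<beta> * s 1 ^ m))"
        by (simp only: slice_def mult.assoc)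
      also have "\<dots> = slice \<alpha> \<beta> m a * x" unfolding i[symmetric] by (simp only: slice_def mult.assoc)
      finally show ?thesis using 1 by (simp only: slice_diff)
    qed
    moreover have "(\<lambda>m. x * slice \<alpha> \<beta> m a - slice \<alpha> \<beta> m a * x) \<longlonglongrightarrow> x * T - T * x"
      by (intro tendsto_intros T)
    ultimately show "(\<lambda>m. slice \<alpha> \<beta> m (x * a - a * x)) \<longlonglongrightarrow> 0" by simp
  qed
  then have "x * a - a * x = 0" by (rule vnull_zero) (rule y)
  then show "a * x = x * a" by simp
qed

end

section \<open>Joint eigenvectors\<close>

text \<open>If two of the vectors coincide, coefficients 1 and -1 give a relation; otherwise there
  are \<open>card T + 1\<close> distinct vectors in a space of dimension at most
  \<open>card T\<close>. The coefficients are real because \<open>span\<close> is.\<close>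

lemma linear_relation:
  fixes v :: "nat \<Rightarrow> 'b::real_vector"
  assumes T: "finite T" and v: "\<And>i. v i \<in> span T"
  obtains c :: "nat \<Rightarrow> real" and N where "\<exists>i\<le>N. c i \<noteq> 0" "(\<Sum>i\<le>N. c i *\<^sub>R v i) = 0"
proof (cases "inj_on v {..card T}")
  case True
  have "\<not> independent (v ` {..card T})"
    using independent_span_bound[OF T, of "v ` {..card T}"] v card_image[OF True] by auto
  then obtain u where u: "\<exists>x\<in>v ` {..card T}. u x \<noteq> 0" "(\<Sum>x\<in>v ` {..card T}. u x *\<^sub>R x) = 0"
    by (auto simp: dependent_finite)
  show ?thesis
  proof (rule that[of "card T" "\<lambda>i. u (v i)"])
    show "\<exists>i\<le>card T. u (v i) \<noteq> 0" using u(1) by auto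
    show "(\<Sum>i\<le>card T. u (v i) *\<^sub>R v i) = 0" using u(2) by (simp add: sum.reindex[OF True])
  qed
next
  case False
  then obtain i j where ij: "i \<le> card T" "j \<le> card T" "i \<noteq> j" "v i = v j" by (auto simp: inj_on_def)
  define c where "c = (\<lambda>k. (if k = i then 1 else 0) - (if k = j then 1 else 0) :: real)"
  have "c i \<noteq> 0" using ij by (simp add: c_def)
  moreover have "(\<Sum>k\<le>card T. c k *\<^sub>R v k) = 0"
    using ij by (simp add: c_def scaleR_left_diff_distrib sum_subtractf if_distrib[of "\<lambda>x. x *\<^sub>R _"] cong: if_cong)
  ultimately show ?thesis using that ij(1) by blast
qed

context cuntz_alg
begin

section \<open>Eigenvectors of a single matrix\<close>

definition poly_eval :: "complex poly \<Rightarrow> 'a \<Rightarrow> 'a" where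
  "poly_eval p d = (\<Sum>i\<le>degree p. sc (coeff p i) (d ^ i))"

lemma poly_eval_le: "degree p \<le> K \<Longrightarrow> poly_eval p d = (\<Sum>i\<le>K. sc (coeff p i) (d ^ i))"
  unfolding poly_eval_def by (rule sum.mono_neutral_left) (auto simp: coeff_eq_0)

lemma poly_eval_linear_factor: "poly_eval ([:- z, 1:] * q) d = (d - sc z 1) * poly_eval q d"
proof -
  let ?K = "degree q"
  have deg: "degree ([:- z, 1:] * q) \<le> Suc ?K"
    using degree_mult_le[of "[:- z, 1:]" q] by simp
  have "[:- z, 1:] * q = pCons 0 q - smult z q" by simp
  then have "poly_eval ([:- z, 1:] * q) d =
      (\<Sum>i\<le>Suc ?K. sc (coeff (pCons 0 q) i) (d ^ i)) - (\<Sum>i\<le>Suc ?K. sc (z * coeff q i) (d ^ i))"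
    unfolding poly_eval_le[OF deg] by (simp only: coeff_diff coeff_smult sc_diff_left sum_subtractf)
  also have "(\<Sum>i\<le>Suc ?K. sc (coeff (pCons 0 q) i) (d ^ i)) = d * poly_eval q d"
    unfolding sum.atMost_Suc_shift by (simp add: poly_eval_def sum_distrib_left)
  also have "(\<Sum>i\<le>Suc ?K. sc (z * coeff q i) (d ^ i)) = sc z (poly_eval q d)"
    unfolding poly_eval_le[OF le_SucI[OF order_refl], of q] by (simp only: sc_sum_right sc_sc)
  finally show ?thesis by (simp add: left_diff_distrib)
qed

text \<open>Linear factors of \<open>p\<close> are split off one at a time; the first quotient that
  does not annihilate \<open>\<xi>\<close> yields an eigenvector. Its form
  \<open>poly_eval q d * \<xi>\<close> shows that it arises from \<open>\<xi>\<close> within any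
  unital algebra containing \<open>d\<close>.\<close>

lemma poly_eval_eigenvector:
  assumes "poly_eval p d * \<xi> = 0" "p \<noteq> 0" "\<xi> \<noteq> 0"
  shows "\<exists>q z. poly_eval q d * \<xi> \<noteq> 0 \<and> d * (poly_eval q d * \<xi>) = sc z (poly_eval q d * \<xi>)"
  using assms(1,2)
proof (induction "degree p" arbitrary: p)
  case 0
  then obtain c where "p = [:c:]" "c \<noteq> 0" by (metis degree_eq_zeroE pCons_0_0)
  then show ?case using 0 assms(3) by (simp add: poly_eval_def)
next
  case (Suc k)
  then have "\<not> constant (poly p)" by (simp add: constant_degree)
  then obtain z where "poly p z = 0" using fundamental_theorem_of_algebra by blast
  then obtain q where q: "p = [:- z, 1:] * q" by (metis poly_eq_0_iff_dvd dvdE)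
  then have q0: "q \<noteq> 0" using Suc.prems(2) by auto
  have e: "d * (poly_eval q d * \<xi>) = sc z (poly_eval q d * \<xi>)"
    using Suc.prems(1) unfolding q poly_eval_linear_factor by (simp add: left_diff_distrib mult.assoc)
  show ?case
  proof (cases "poly_eval q d * \<xi> = 0")
    case True
    have "degree p = Suc (degree q)" unfolding q by (subst degree_mult_eq) (use q0 in auto)
    then have "k = degree q" using Suc.hyps(2) by simp
    then show ?thesis using Suc.hyps(1) True q0 by blast
  qed (use e in blast)
qed

section \<open>Columns, traces and orthonormal systems\<close>

lemma column_expand:
  assumes \<xi>: "\<xi> \<in> H 1 0"
  obtains a where "\<And>i. i \<in> {1..n} \<Longrightarrow> st (s i) * \<xi> = sc (a i) 1" "\<xi> = (\<Sum>i=1..n. sc (a i) (s i))"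
    "st \<xi> * \<xi> = sc (of_real (\<Sum>i=1..n. (cmod (a i))\<^sup>2)) 1"
proof -
  have "\<forall>i. \<exists>c. i \<in> {1..n} \<longrightarrow> st (s i) * \<xi> = sc c 1"
    using H_entry[OF \<xi>, of "[_]" "[]"] by (auto simp: words_1_singleton)
  then obtain a where a: "\<And>i. i \<in> {1..n} \<Longrightarrow> st (s i) * \<xi> = sc (a i) 1" by metis
  have "\<xi> = (\<Sum>i=1..n. s i * (st (s i) * \<xi>))"
    using expand_left[of \<xi> 1] unfolding sum_words_1 smon_singleton .
  also have "\<dots> = (\<Sum>i=1..n. sc (a i) (s i))" by (intro sum.cong refl) (simp add: a)
  finally have e: "\<xi> = (\<Sum>i=1..n. sc (a i) (s i))" .
  have "st \<xi> * \<xi> = (\<Sum>i=1..n. sc (cnj (a i)) (st (s i) * \<xi>))"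
    by (subst e) (simp add: st_sum sum_distrib_right)
  also have "\<dots> = (\<Sum>i=1..n. sc (of_real ((cmod (a i))\<^sup>2)) 1)"
    by (intro sum.cong refl) (simp add: a complex_norm_square mult.commute del: of_real_power)
  finally have "st \<xi> * \<xi> = sc (of_real (\<Sum>i=1..n. (cmod (a i))\<^sup>2)) 1"
    by (simp add: sc_sum_left)
  then show ?thesis using that a e by blast
qed

text \<open>The trace of a rank-one matrix: the entries \<open>st (s i) * \<xi>\<close> are scalars
  and may be moved to the other side.\<close>

lemma column_trace:
  assumes "\<xi> \<in> H 1 0" "\<eta> \<in> H 1 0"
  shows "(\<Sum>i=1..n. st (s i) * (\<xi> * st \<eta>) * s i) = st \<eta> * \<xi>"
proof -
  obtain a where a: "\<And>i. i \<in> {1..n} \<Longrightarrow> st (s i) * \<xi> = sc (a i) 1" "\<xi> = (\<Sum>i=1..n. sc (a i) (s i))"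
    using column_expand[OF assms(1)] by metis
  have "(\<Sum>i=1..n. st (s i) * (\<xi> * st \<eta>) * s i) = (\<Sum>i=1..n. (st (s i) * \<xi>) * (st \<eta> * s i))"
    by (simp add: mult.assoc)
  also have "\<dots> = (\<Sum>i=1..n. st \<eta> * sc (a i) (s i))" by (intro sum.cong refl) (simp add: a(1))
  also have "\<dots> = st \<eta> * \<xi>" by (simp only: a(2)[symmetric] sum_distrib_left[symmetric])
  finally show ?thesis .
qed

text \<open>Dimension counting by trace: the complement of \<open>k\<close> orthonormal columns has
  trace \<open>n - k\<close>. If this is nonzero, some \<open>s j\<close> survives under
  \<open>1 - p\<close>; for \<open>k = n\<close> it will force \<open>p = 1\<close>.\<close>

lemma orthonormal_defect:
  assumes H10: "\<forall>i\<in>{1..k}. \<xi> i \<in> H 1 0"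
    and orth: "\<forall>i\<in>{1..k}. \<forall>j\<in>{1..k}. st (\<xi> i) * \<xi> j = (if i = j then 1 else 0)"
  defines "p \<equiv> \<Sum>i=1..k. \<xi> i * st (\<xi> i)"
  shows "(\<Sum>j=1..n. st ((1 - p) * s j) * ((1 - p) * s j)) = of_nat n - of_nat k"
    "i \<in> {1..k} \<Longrightarrow> st (\<xi> i) * (1 - p) = 0" "p \<in> H 1 1"
proof -
  have \<xi>: "\<And>i. i \<in> {1..k} \<Longrightarrow> \<xi> i \<in> H 1 0" using H10 by blast
  have on: "\<And>i j. i \<in> {1..k} \<Longrightarrow> j \<in> {1..k} \<Longrightarrow> st (\<xi> i) * \<xi> j = (if i = j then 1 else 0)"
    using orth by blast
  show "p \<in> H 1 1" unfolding p_def by (intro H_sum H_mult[where m = 0] H_st \<xi>)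
  have \<xi>p: "st (\<xi> i) * p = st (\<xi> i)" if i: "i \<in> {1..k}" for i
  proof -
    have "st (\<xi> i) * p = (\<Sum>j=1..k. (st (\<xi> i) * \<xi> j) * st (\<xi> j))" by (simp add: p_def sum_distrib_left mult.assoc)
    also have "\<dots> = (\<Sum>j=1..k. if j = i then st (\<xi> i) else 0)" by (intro sum.cong refl) (use on[OF i] in auto)
    finally show ?thesis using i by simp
  qed
  then show "i \<in> {1..k} \<Longrightarrow> st (\<xi> i) * (1 - p) = 0" by (simp add: right_diff_distrib)
  have "p * p = (\<Sum>i=1..k. \<xi> i * (st (\<xi> i) * p))" by (subst (1) p_def) (simp add: sum_distrib_right mult.assoc)
  also have "\<dots> = p" unfolding p_def[symmetric] by (subst (2) p_def) (intro sum.cong refl, simp only: \<xi>p)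
  finally have pp: "p * p = p" .
  have "st p = p" by (simp add: p_def st_sum)
  then have qq: "st (1 - p) * (1 - p) = 1 - p" using pp by (simp add: st_diff algebra_simps)
  have "(\<Sum>j=1..n. st (s j) * p * s j) = (\<Sum>i=1..k. \<Sum>j=1..n. st (s j) * (\<xi> i * st (\<xi> i)) * s j)"
    unfolding p_def by (subst sum.swap) (simp add: sum_distrib_left sum_distrib_right)
  also have "\<dots> = (\<Sum>i=1..k. 1)" by (intro sum.cong refl) (simp add: column_trace \<xi> on)
  finally have trp: "(\<Sum>j=1..n. st (s j) * p * s j) = of_nat k" by simp
  have "(\<Sum>j=1..n. st (s j) * s j) = (\<Sum>j=1..n. 1)" by (intro sum.cong refl isom_s)
  then have tr1: "(\<Sum>j=1..n. st (s j) * s j) = of_nat n" by simp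
  have "(\<Sum>j=1..n. st ((1 - p) * s j) * ((1 - p) * s j)) = (\<Sum>j=1..n. st (s j) * (st (1 - p) * (1 - p)) * s j)"
    by (simp only: st_mult mult.assoc)
  also have "\<dots> = (\<Sum>j=1..n. st (s j) * s j) - (\<Sum>j=1..n. st (s j) * p * s j)"
    unfolding qq by (simp add: left_diff_distrib right_diff_distrib sum_subtractf mult.assoc)
  finally show "(\<Sum>j=1..n. st ((1 - p) * s j) * ((1 - p) * s j)) = of_nat n - of_nat k" by (simp only: trp tr1)
qed

lemma H_finite_span: obtains T where "finite T" "H k l \<subseteq> span T"
proof -
  \<comment> \<open>\<open>span\<close> is taken over the reals, so each matrix unit also occurs
    multiplied by \<open>\<i>\<close>.\<close>
  define T where "T = (\<lambda>(\<mu>, \<nu>). S \<mu> * st (S \<nu>)) ` (words n k \<times> words n l) \<union>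
    (\<lambda>(\<mu>, \<nu>). sc \<i> (S \<mu> * st (S \<nu>))) ` (words n k \<times> words n l)"
  have "x \<in> span T" if x: "x \<in> H k l" for x
  proof -
    obtain c where c: "x = (\<Sum>\<mu>\<in>words n k. \<Sum>\<nu>\<in>words n l. sc (c \<mu> \<nu>) (S \<mu> * st (S \<nu>)))"
      by (rule H_E[OF x]) blast
    have sp: "sc z (S \<mu> * st (S \<nu>)) \<in> span T" if "\<mu> \<in> words n k" "\<nu> \<in> words n l" for z \<mu> \<nu>
    proof -
      have "sc z (S \<mu> * st (S \<nu>)) = Re z *\<^sub>R (S \<mu> * st (S \<nu>)) + Im z *\<^sub>R sc \<i> (S \<mu> * st (S \<nu>))"
        by (subst complex_eq[of z]) (simp only: sc_add_left sc_of_real mult.commute[of \<i>] sc_sc[symmetric])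
      also have "\<dots> \<in> span T"
        by (intro span_add span_scale span_base) (use that in \<open>auto simp: T_def\<close>)
      finally show ?thesis .
    qed
    show ?thesis unfolding c by (intro span_sum sp)
  qed
  moreover have "finite T" by (auto simp: T_def)
  ultimately show ?thesis using that by blast
qed

text \<open>\<open>E\<close> is an abelian *-algebra of matrices and \<open>H 1 0\<close> the vector space it acts on.\<close>
context
  fixes E :: "'a set"
  assumes E_H: "E \<subseteq> H 1 1" and E_1: "1 \<in> E"
    and E_add: "\<And>x y. x \<in> E \<Longrightarrow> y \<in> E \<Longrightarrow> x + y \<in> E" and E_mult: "\<And>x y. x \<in> E \<Longrightarrow> y \<in> E \<Longrightarrow> x * y \<in> E"
    and E_sc: "\<And>x a. x \<in> E \<Longrightarrow> sc a x \<in> E" and E_st: "\<And>x. x \<in> E \<Longrightarrow> st x \<in> E"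
    and E_comm: "\<And>x y. x \<in> E \<Longrightarrow> y \<in> E \<Longrightarrow> x * y = y * x"
begin

lemma poly_eval_E: assumes d: "d \<in> E" shows "poly_eval p d \<in> E"
proof -
  have pw: "d ^ i \<in> E" for i by (induction i) (auto intro: E_1 E_mult d)
  have "0 \<in> E" using E_sc[OF E_1, of 0] by simp
  then have sm: "sum f I \<in> E" if "\<And>i. i \<in> I \<Longrightarrow> f i \<in> E" for f :: "nat \<Rightarrow> 'a" and I
    using that by (induction I rule: infinite_finite_induct) (auto intro: E_add)
  show ?thesis unfolding poly_eval_def by (intro sm E_sc pw)
qed

lemma eigenvector_one:
  assumes d: "d \<in> E" and \<xi>: "\<xi> \<in> H 1 0" "\<xi> \<noteq> 0"
  shows "\<exists>e\<in>E. \<exists>z. e * \<xi> \<noteq> 0 \<and> d * (e * \<xi>) = sc z (e * \<xi>)"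
proof -
  have "d ^ i * \<xi> \<in> H 1 0" for i
    using H_mult[OF H_power \<xi>(1)] d E_H by blast
  moreover obtain T where T: "finite T" "H 1 0 \<subseteq> span T" using H_finite_span[of 1 0] by blast
  ultimately have sp: "d ^ i * \<xi> \<in> span T" for i by blast
  obtain c N where c: "\<exists>i\<le>N. c i \<noteq> 0" "(\<Sum>i\<le>N. c i *\<^sub>R (d ^ i * \<xi>)) = 0"
    by (rule linear_relation[OF T(1) sp])
  define p :: "complex poly" where "p = (\<Sum>i\<le>N. monom (of_real (c i)) i)"
  have coeff: "coeff p i = (if i \<le> N then of_real (c i) else 0)" for i
    by (simp add: p_def coeff_sum)
  then have "degree p \<le> N" by (auto intro: degree_le)
  then have "poly_eval p d * \<xi> = (\<Sum>i\<le>N. c i *\<^sub>R (d ^ i * \<xi>))"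
    by (simp add: poly_eval_le coeff sc_of_real sum_distrib_right)
  moreover have "p \<noteq> 0" using c(1) coeff by (metis coeff_0 of_real_eq_0_iff)
  ultimately obtain q z where "poly_eval q d * \<xi> \<noteq> 0" "d * (poly_eval q d * \<xi>) = sc z (poly_eval q d * \<xi>)"
    using poly_eval_eigenvector[of p d \<xi>] c(2) \<xi>(2) by auto
  then show ?thesis using poly_eval_E[OF d, of q] by blast
qed

text \<open>Applying a further element of \<open>E\<close> keeps the eigenvalues already achieved
  because \<open>E\<close> is commutative.\<close>

lemma eigenvector_finite:
  assumes B: "finite B" "B \<subseteq> E" and \<xi>: "\<xi> \<in> H 1 0" "\<xi> \<noteq> 0"
  shows "\<exists>e\<in>E. e * \<xi> \<noteq> 0 \<and> (\<forall>d\<in>B. \<exists>z. d * (e * \<xi>) = sc z (e * \<xi>))"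
  using B
proof (induction B)
  case empty
  show ?case using E_1 \<xi>(2) by (intro bexI[of _ 1]) auto
next
  case (insert d B)
  then obtain e where e: "e \<in> E" "e * \<xi> \<noteq> 0" "\<And>d. d \<in> B \<Longrightarrow> \<exists>z. d * (e * \<xi>) = sc z (e * \<xi>)" by auto
  have d: "d \<in> E" using insert by simp
  have "e * \<xi> \<in> H 1 0" using H_mult e(1) \<xi>(1) E_H by blast
  from eigenvector_one[OF d this e(2)] obtain e' z where
    e': "e' \<in> E" "e' * (e * \<xi>) \<noteq> 0" "d * (e' * (e * \<xi>)) = sc z (e' * (e * \<xi>))" by blast
  have "\<exists>z. b * (e' * e * \<xi>) = sc z (e' * e * \<xi>)" if b: "b \<in> insert d B" for b
  proof (cases "b = d")
    case False
    then obtain w where w: "b * (e * \<xi>) = sc w (e * \<xi>)" using b e(3) by blast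
    have "b * e' = e' * b" using E_comm b insert.prems e'(1) by blast
    then have "b * (e' * e * \<xi>) = e' * (b * (e * \<xi>))" by (simp flip: mult.assoc)
    then show ?thesis unfolding w by (auto simp: mult.assoc)
  qed (use e'(3) in \<open>auto simp: mult.assoc\<close>)
  then show ?case using e' e(1) E_mult by (intro bexI[of _ "e' * e"]) (auto simp: mult.assoc)
qed

lemma joint_eigenvector:
  assumes \<xi>: "\<xi> \<in> H 1 0" "\<xi> \<noteq> 0"
  shows "\<exists>e\<in>E. e * \<xi> \<noteq> 0 \<and> (\<forall>d\<in>E. \<exists>z. d * (e * \<xi>) = sc z (e * \<xi>))"
proof -
  obtain B where B: "B \<subseteq> E" "independent B" "E \<subseteq> span B" by (rule maximal_independent_subset)
  obtain T where T: "finite T" "H 1 1 \<subseteq> span T" using H_finite_span[of 1 1] by blast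
  have "finite B" using independent_span_bound[OF T(1) B(2)] B(1) E_H T(2) by blast
  from eigenvector_finite[OF this B(1) \<xi>] obtain e where
    e: "e \<in> E" "e * \<xi> \<noteq> 0" "\<And>d. d \<in> B \<Longrightarrow> \<exists>z. d * (e * \<xi>) = sc z (e * \<xi>)" by blast
  have "\<exists>z. d * (e * \<xi>) = sc z (e * \<xi>)" if "d \<in> span B" for d
    using that
  proof (induction rule: span_induct_alt)
    case base
    show ?case by (intro exI[of _ 0]) simp
  next
    case (step c x y)
    then obtain z w where "x * (e * \<xi>) = sc z (e * \<xi>)" "y * (e * \<xi>) = sc w (e * \<xi>)" using e(3) by blast
    then have "(c *\<^sub>R x + y) * (e * \<xi>) = sc (of_real c * z + w) (e * \<xi>)"
      by (simp add: distrib_right sc_add_left sc_of_real flip: sc_sc)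
    then show ?case by blast
  qed
  then show ?thesis using e B(3) by blast
qed

lemma orthonormal_eigenvectors:
  "k \<le> n \<Longrightarrow> \<exists>\<xi>. (\<forall>i\<in>{1..k}. \<xi> i \<in> H 1 0 \<and> (\<forall>d\<in>E. \<exists>z. d * \<xi> i = sc z (\<xi> i))) \<and>
      (\<forall>i\<in>{1..k}. \<forall>j\<in>{1..k}. st (\<xi> i) * \<xi> j = (if i = j then 1 else 0))"
proof (induction k)
  case (Suc k)
  from Suc.IH[OF Suc_leD[OF Suc.prems]] obtain \<xi> where
    \<xi>': "\<forall>i\<in>{1..k}. \<xi> i \<in> H 1 0 \<and> (\<forall>d\<in>E. \<exists>z. d * \<xi> i = sc z (\<xi> i))"
      "\<forall>i\<in>{1..k}. \<forall>j\<in>{1..k}. st (\<xi> i) * \<xi> j = (if i = j then 1 else 0)" by blast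
  have \<xi>: "\<And>i. i \<in> {1..k} \<Longrightarrow> \<xi> i \<in> H 1 0"
    "\<And>i d. i \<in> {1..k} \<Longrightarrow> d \<in> E \<Longrightarrow> \<exists>z. d * \<xi> i = sc z (\<xi> i)"
    using \<xi>'(1) by blast+
  have \<xi>3: "\<And>i j. i \<in> {1..k} \<Longrightarrow> j \<in> {1..k} \<Longrightarrow> st (\<xi> i) * \<xi> j = (if i = j then 1 else 0)"
    using \<xi>'(2) by blast
  define p where "p = (\<Sum>i=1..k. \<xi> i * st (\<xi> i))"
  have "\<forall>i\<in>{1..k}. \<xi> i \<in> H 1 0" using \<xi>(1) by blast
  note defect = orthonormal_defect[OF this \<xi>'(2), folded p_def]
  have "\<exists>j\<in>{1..n}. (1 - p) * s j \<noteq> 0"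
  proof (rule ccontr)
    assume "\<not> ?thesis"
    then have "(\<Sum>j=1..n. st ((1 - p) * s j) * ((1 - p) * s j)) = 0" by (intro sum.neutral ballI) simp
    then have "of_nat n = (of_nat k :: 'a)" by (simp only: defect(1) right_minus_eq)
    then show False using Suc.prems by (simp only: of_nat_eq_iff)
  qed
  then obtain j where j: "j \<in> {1..n}" "(1 - p) * s j \<noteq> 0" by blast
  define \<eta> where "\<eta> = (1 - p) * s j"
  have \<eta>: "\<eta> \<in> H 1 0" unfolding \<eta>_def by (intro H_mult[where m = 1] H_diff H_1 defect(3) H_s j)
  have \<eta>0: "\<eta> \<noteq> 0" using j by (simp add: \<eta>_def)
  obtain e where e: "e \<in> E" "e * \<eta> \<noteq> 0" "\<And>d. d \<in> E \<Longrightarrow> \<exists>z. d * (e * \<eta>) = sc z (e * \<eta>)"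
    using joint_eigenvector[OF \<eta> \<eta>0] by blast
  have e\<eta>: "e * \<eta> \<in> H 1 0" using H_mult e(1) \<eta> E_H by blast
  \<comment> \<open>\<open>E\<close> preserves the orthogonal complement of the earlier vectors
    because it contains \<open>st e\<close>, of which each \<open>\<xi> i\<close> is also an
    eigenvector.\<close>
  have orth: "st (\<xi> i) * (e * \<eta>) = 0" if i: "i \<in> {1..k}" for i
  proof -
    obtain z where "st e * \<xi> i = sc z (\<xi> i)" using \<xi>(2)[OF i E_st[OF e(1)]] by blast
    from arg_cong[OF this, of st] have "st (\<xi> i) * e = sc (cnj z) (st (\<xi> i))" by simp
    then have "st (\<xi> i) * (e * \<eta>) = sc (cnj z) (st (\<xi> i) * ((1 - p) * s j))"
      by (simp add: \<eta>_def flip: mult.assoc)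
    also have "st (\<xi> i) * ((1 - p) * s j) = 0" using defect(2)[OF i] by (simp flip: mult.assoc)
    finally show ?thesis by simp
  qed
  obtain a where a: "st (e * \<eta>) * (e * \<eta>) = sc (of_real (\<Sum>i=1..n. (cmod (a i))\<^sup>2)) 1"
    using column_expand[OF e\<eta>] by metis
  define r where "r = (\<Sum>i=1..n. (cmod (a i))\<^sup>2)"
  have "r \<ge> 0" unfolding r_def by (intro sum_nonneg) auto
  moreover have "r \<noteq> 0"
  proof
    assume "r = 0"
    then have "st (e * \<eta>) * (e * \<eta>) = 0" using a by (simp add: r_def)
    then show False using e(2) by (simp only: st_mult_self_eq_0_iff)
  qed
  ultimately have r: "r > 0" by simp
  define \<zeta> where "\<zeta> = sc (of_real (1 / sqrt r)) (e * \<eta>)"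
  have \<zeta>_H: "\<zeta> \<in> H 1 0" unfolding \<zeta>_def by (intro H_sc e\<eta>)
  have "st \<zeta> * \<zeta> = sc (of_real (1 / sqrt r) * of_real (1 / sqrt r)) (st (e * \<eta>) * (e * \<eta>))"
    unfolding \<zeta>_def by (simp only: st_sc mult_sc_left mult_sc_right sc_sc complex_cnj_complex_of_real)
  also have "\<dots> = sc (of_real (1 / sqrt r * (1 / sqrt r) * r)) 1"
    unfolding a r_def[symmetric] by (simp only: sc_sc of_real_mult)
  also have "1 / sqrt r * (1 / sqrt r) * r = 1" using r by simp
  finally have \<zeta>1: "st \<zeta> * \<zeta> = 1" by simp
  have orth1: "st (\<xi> i) * \<zeta> = 0" if "i \<in> {1..k}" for i using orth[OF that] by (simp add: \<zeta>_def)
  have orth2: "st \<zeta> * \<xi> i = 0" if "i \<in> {1..k}" for i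
    using arg_cong[OF orth1[OF that], of st] by simp
  have eig: "\<exists>z. d * \<zeta> = sc z \<zeta>" if d: "d \<in> E" for d
  proof -
    obtain z where "d * (e * \<eta>) = sc z (e * \<eta>)" using e(3)[OF d] by blast
    then have "d * \<zeta> = sc z \<zeta>" by (simp add: \<zeta>_def mult.commute)
    then show ?thesis by blast
  qed
  define \<xi>' where "\<xi>' = (\<lambda>i. if i = Suc k then \<zeta> else \<xi> i)"
  have "\<xi>' i \<in> H 1 0 \<and> (\<forall>d\<in>E. \<exists>z. d * \<xi>' i = sc z (\<xi>' i))" if "i \<in> {1..Suc k}" for i
    using that \<zeta>_H eig \<xi>(1,2)[of i] by (auto simp: \<xi>'_def)
  moreover have "st (\<xi>' i) * \<xi>' j = (if i = j then 1 else 0)" if "i \<in> {1..Suc k}" "j \<in> {1..Suc k}" for i j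
  proof -
    consider "i = Suc k" "j = Suc k" | "i = Suc k" "j \<in> {1..k}" | "j = Suc k" "i \<in> {1..k}" | "i \<in> {1..k}" "j \<in> {1..k}"
      using \<open>i \<in> {1..Suc k}\<close> \<open>j \<in> {1..Suc k}\<close> by (cases "i = Suc k"; cases "j = Suc k") auto
    then show ?thesis
      by cases (auto simp: \<xi>'_def \<zeta>1 orth1 orth2 \<xi>3)
  qed
  ultimately show ?case by blast
qed auto

lemma eigenbasis:
  obtains \<xi> where "cuntz_family st n \<xi>" "\<And>i. i \<in> {1..n} \<Longrightarrow> \<xi> i \<in> H 1 0"
    "\<And>i d. i \<in> {1..n} \<Longrightarrow> d \<in> E \<Longrightarrow> \<exists>z. d * \<xi> i = sc z (\<xi> i)"
proof -
  from orthonormal_eigenvectors[OF order_refl] obtain \<xi> where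
    \<xi>': "\<forall>i\<in>{1..n}. \<xi> i \<in> H 1 0 \<and> (\<forall>d\<in>E. \<exists>z. d * \<xi> i = sc z (\<xi> i))"
      "\<forall>i\<in>{1..n}. \<forall>j\<in>{1..n}. st (\<xi> i) * \<xi> j = (if i = j then 1 else 0)" by blast
  have \<xi>: "\<And>i. i \<in> {1..n} \<Longrightarrow> \<xi> i \<in> H 1 0"
    "\<And>i d. i \<in> {1..n} \<Longrightarrow> d \<in> E \<Longrightarrow> \<exists>z. d * \<xi> i = sc z (\<xi> i)"
    using \<xi>'(1) by blast+
  have \<xi>3: "\<And>i j. i \<in> {1..n} \<Longrightarrow> j \<in> {1..n} \<Longrightarrow> st (\<xi> i) * \<xi> j = (if i = j then 1 else 0)"
    using \<xi>'(2) by blast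
  define p where "p = (\<Sum>i=1..n. \<xi> i * st (\<xi> i))"
  define q where "q = 1 - p"
  have "\<forall>i\<in>{1..n}. \<xi> i \<in> H 1 0" using \<xi>(1) by blast
  note defect = orthonormal_defect[OF this \<xi>'(2), folded p_def, folded q_def]
  have col: "q * s j \<in> H 1 0" if "j \<in> {1..n}" for j
    unfolding q_def by (intro H_mult[where m = 1] H_diff H_1 defect(3) H_s that)
  \<comment> \<open>The defect \<open>q\<close> has trace 0, and the summands of this trace are
    nonnegative numbers. Each one vanishes, and with it each column of \<open>q\<close>.\<close>
  have "\<forall>j. \<exists>r. j \<in> {1..n} \<longrightarrow> r \<ge> 0 \<and> st (q * s j) * (q * s j) = sc (complex_of_real r) 1"
  proof
    fix j
    show "\<exists>r. j \<in> {1..n} \<longrightarrow> r \<ge> 0 \<and> st (q * s j) * (q * s j) = sc (complex_of_real r) 1"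
    proof (cases "j \<in> {1..n}")
      case True
      obtain a where "st (q * s j) * (q * s j) = sc (of_real (\<Sum>i=1..n. (cmod (a i))\<^sup>2)) 1"
        using column_expand[OF col[OF True]] by metis
      then show ?thesis by (intro exI[of _ "\<Sum>i=1..n. (cmod (a i))\<^sup>2"]) (auto intro: sum_nonneg)
    qed auto
  qed
  from choice[OF this] obtain r where r: "\<And>j. j \<in> {1..n} \<Longrightarrow> r j \<ge> 0"
    "\<And>j. j \<in> {1..n} \<Longrightarrow> st (q * s j) * (q * s j) = sc (complex_of_real (r j)) 1" by blast
  have "(\<Sum>j=1..n. sc (complex_of_real (r j)) 1) = (\<Sum>j=1..n. st (q * s j) * (q * s j))"
    by (intro sum.cong refl) (simp only: r(2))
  also have "\<dots> = 0" by (simp only: defect(1) diff_self)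
  finally have "sc (\<Sum>j=1..n. complex_of_real (r j)) 1 = 0" by (simp add: sc_sum_left)
  then have "complex_of_real (\<Sum>j=1..n. r j) = 0" by simp
  then have sr: "(\<Sum>j=1..n. r j) = 0" by (simp only: of_real_eq_0_iff)
  have r0: "r j = 0" if "j \<in> {1..n}" for j
    using iffD1[OF sum_nonneg_eq_0_iff[OF finite_atLeastAtMost r(1)] sr] that by blast
  have "q * s j = 0" if j: "j \<in> {1..n}" for j
  proof -
    have "st (q * s j) * (q * s j) = 0" using r(2)[OF j] r0[OF j] by simp
    then show ?thesis by (simp only: st_mult_self_eq_0_iff)
  qed
  then have "(\<Sum>j=1..n. q * s j * st (s j)) = 0" by simp
  then have "q * (\<Sum>j=1..n. s j * st (s j)) = 0" by (simp add: sum_distrib_left mult.assoc)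
  then have "q = 0" by (simp only: sum_s) simp
  then have "cuntz_family st n \<xi>" using \<xi>3 unfolding cuntz_family_def by (auto simp: q_def p_def)
  then show ?thesis using that \<xi> by blast
qed

end

end

section \<open>Conclusion\<close>

context cuntz_pair
begin

section \<open>Images of words, of the diagonal and of the shifts\<close>

lemma hom_sum: "finite I \<Longrightarrow> (\<And>i. i \<in> I \<Longrightarrow> f i \<in> alg) \<Longrightarrow> hom (sum f I) = (\<Sum>i\<in>I. hom (f i))"
proof (induction I rule: finite_induct)
  case empty
  show ?case using hom_sc[OF one_alg, of 0] by simp
next
  case (insert j I)
  have "sum f I \<in> alg" by (rule subalg_sum[OF alg_sub]) (use insert in auto)
  then show ?case using insert hom_add[of "f j" "sum f I"] by simp
qed

lemma hom_S: "\<mu> \<in> words n k \<Longrightarrow> hom (S \<mu>) = B.S \<mu>"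
  using hom_H[OF H_S, of \<mu> k] by (simp add: V_S)

lemma hom_proj: "\<mu> \<in> words n k \<Longrightarrow> hom (proj \<mu>) = B.proj \<mu>"
  by (simp add: hom_mult hom_st hom_S S_words_alg subalgD(6)[OF alg_sub])

lemma hom_tendsto:
  assumes f: "\<And>i. f i \<in> alg" and lim: "f \<longlonglongrightarrow> x" shows "(\<lambda>i. hom (f i)) \<longlonglongrightarrow> hom x"
proof -
  have x: "x \<in> alg" by (rule closed_sequentially[OF subalgD(2)[OF alg_sub] f lim])
  have "norm (hom (f i) - hom x) \<le> norm (f i - x)" for i
  proof -
    have m: "sc (-1) x \<in> alg" by (rule subalgD(5)[OF alg_sub x])
    have "hom (f i + sc (-1) x) = hom (f i) - hom x"
      using hom_add[OF f[of i] m] hom_sc[OF x, of "-1"] by simp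
    moreover have "norm (hom (f i + sc (-1) x)) \<le> norm (f i + sc (-1) x)"
      by (rule norm_hom[OF subalgD(3)[OF alg_sub f m]])
    ultimately show ?thesis by simp
  qed
  then have "(\<lambda>i. hom (f i) - hom x) \<longlonglongrightarrow> 0"
    by (intro Lim_null_comparison[OF always_eventually tendsto_norm_zero[OF LIM_zero[OF lim]]] allI)
  then show ?thesis by (rule LIM_zero_cancel)
qed

lemma hom_diag: assumes "x \<in> D" shows "hom x \<in> B.D"
proof -
  define E where "E = {x \<in> alg. hom x \<in> B.D}"
  have "cstar_sub st sc E"
    unfolding cstar_sub_def
  proof (intro conjI ballI allI)
    show "0 \<in> E" using hom_sc[OF one_alg, of 0] subalgD(1)[OF alg_sub] subalgD(1)[OF B.D_sub]
      by (simp add: E_def)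
    show "closed E" unfolding closed_sequential_limits
    proof safe
      fix f x assume f: "\<forall>i. f i \<in> E" and lim: "f \<longlonglongrightarrow> x"
      have f_alg: "f i \<in> alg" "hom (f i) \<in> B.D" for i using f by (auto simp: E_def)
      have "x \<in> alg" by (rule closed_sequentially[OF subalgD(2)[OF alg_sub] f_alg(1) lim])
      moreover have "hom x \<in> B.D"
        by (rule closed_sequentially[OF subalgD(2)[OF B.D_sub] f_alg(2) hom_tendsto[OF f_alg(1) lim]])
      ultimately show "x \<in> E" by (simp add: E_def)
    qed
  qed (auto simp: E_def hom_add hom_mult hom_sc hom_st subalgD[OF alg_sub] subalgD[OF B.D_sub])
  moreover have "proj \<mu> \<in> E" if "set \<mu> \<subseteq> {1..n}" for \<mu>
  proof -
    have "\<mu> \<in> words n (length \<mu>)" using that by (simp add: words_def)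
    then show ?thesis using hom_proj B.proj_D proj_alg by (simp add: E_def)
  qed
  ultimately have "D \<subseteq> E" unfolding diag_def[of _ _ _ s] by (intro gen_least) auto
  then show ?thesis using assms by (auto simp: E_def)
qed

lemma hom_cshift: assumes x: "x \<in> alg" shows "hom (cshift st n s x) = cshift st n s' (hom x)"
proof -
  have "hom (s i * x * st (s i)) = s' i * hom x * st (s' i)" if i: "i \<in> {1..n}" for i
    using i x by (simp add: hom_mult hom_st hom_s s_alg subalgD[OF alg_sub])
  then show ?thesis unfolding cshift_def
    by (subst hom_sum) (auto intro!: subalgD(4,6)[OF alg_sub] s_alg x)
qed

lemma hom_cshift2: assumes x: "x \<in> alg" shows "hom (cshift2 st n s x) = cshift2 st n s' (hom x)"
proof -
  have m: "s i * s k * st (s i) * x * s j * st (s k) * st (s j) \<in> alg"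
    if "i \<in> {1..n}" "j \<in> {1..n}" "k \<in> {1..n}" for i j k
    using that x by (intro subalgD(4,6)[OF alg_sub] s_alg) auto
  have F: "hom (s i * s k * st (s i) * x * s j * st (s k) * st (s j)) =
      s' i * s' k * st (s' i) * hom x * s' j * st (s' k) * st (s' j)"
    if "i \<in> {1..n}" "j \<in> {1..n}" "k \<in> {1..n}" for i j k
    using that x by (simp add: hom_mult hom_st hom_s s_alg subalgD(4,6)[OF alg_sub])
  have 1: "hom (\<Sum>k=1..n. s i * s k * st (s i) * x * s j * st (s k) * st (s j)) =
      (\<Sum>k=1..n. s' i * s' k * st (s' i) * hom x * s' j * st (s' k) * st (s' j))"
    if "i \<in> {1..n}" "j \<in> {1..n}" for i j
    by (rule trans[OF hom_sum[OF finite_atLeastAtMost m[OF that]] sum.cong[OF refl F[OF that]]])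
  have m1: "(\<Sum>k=1..n. s i * s k * st (s i) * x * s j * st (s k) * st (s j)) \<in> alg"
    if "i \<in> {1..n}" "j \<in> {1..n}" for i j
    by (rule subalg_sum[OF alg_sub m[OF that]])
  have 2: "hom (\<Sum>j=1..n. \<Sum>k=1..n. s i * s k * st (s i) * x * s j * st (s k) * st (s j)) =
      (\<Sum>j=1..n. \<Sum>k=1..n. s' i * s' k * st (s' i) * hom x * s' j * st (s' k) * st (s' j))"
    if "i \<in> {1..n}" for i
    by (rule trans[OF hom_sum[OF finite_atLeastAtMost m1[OF that]] sum.cong[OF refl 1[OF that]]])
  show ?thesis unfolding cshift2_def
    by (rule trans[OF hom_sum[OF finite_atLeastAtMost subalg_sum[OF alg_sub m1]] sum.cong[OF refl 2]])
qed

end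

text \<open>With the order \<open>t s\<close> the map \<open>hom\<close> sends the new basis
  \<open>t\<close> to the given family \<open>s\<close>. Unqualified names refer to
  \<open>t\<close>, names with prefix \<open>B\<close> to \<open>s\<close>.\<close>

locale cuntz_rotation = cuntz_pair st sc n t s
  for st :: "'a::{real_normed_algebra_1,banach} \<Rightarrow> 'a" and sc :: "complex \<Rightarrow> 'a \<Rightarrow> 'a"
    and n :: nat and t s :: "nat \<Rightarrow> 'a" +
  assumes t_column: "\<And>i. i \<in> {1..n} \<Longrightarrow> t i \<in> B.H 1 0"
begin

section \<open>The unitary matrix between the two bases\<close>

definition coord :: "nat \<Rightarrow> nat \<Rightarrow> complex" where
  "coord i j = (SOME c. st (t i) * s j = sc c 1)"

lemma coord: assumes "i \<in> {1..n}" "j \<in> {1..n}" shows "st (t i) * s j = sc (coord i j) 1"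
proof -
  have "st (t i) * s j \<in> B.H 0 0"
    by (rule B.H_mult[OF B.H_st[OF t_column[OF assms(1)]] B.H_s[OF assms(2)]])
  then show ?thesis unfolding coord_def B.H_00 by (rule someI_ex)
qed

lemma coord_cnj: assumes "i \<in> {1..n}" "j \<in> {1..n}" shows "st (s j) * t i = sc (cnj (coord i j)) 1"
  using arg_cong[OF coord[OF assms], of st] by simp

lemma unitary_mat: "unitary_mat n coord"
  unfolding unitary_mat_def
proof (intro conjI ballI)
  fix i j assume ij: "i \<in> {1..n}" "j \<in> {1..n}"
  have "sc (\<Sum>k=1..n. cnj (coord k i) * coord k j) 1 = (\<Sum>k=1..n. (st (s i) * t k) * (st (t k) * s j))"
    unfolding sc_sum_left by (intro sum.cong refl) (use ij in \<open>simp add: coord coord_cnj\<close>)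
  also have "\<dots> = st (s i) * (\<Sum>k=1..n. t k * st (t k)) * s j"
    by (simp add: sum_distrib_left sum_distrib_right mult.assoc)
  also have "\<dots> = sc (if i = j then 1 else 0) 1" using B.st_s_s[OF ij] by (simp only: sum_s) auto
  finally show "(\<Sum>k=1..n. cnj (coord k i) * coord k j) = (if i = j then 1 else 0)" by (simp only: sc_one_inject)
  have "sc (\<Sum>k=1..n. coord i k * cnj (coord j k)) 1 = (\<Sum>k=1..n. (st (t i) * s k) * (st (s k) * t j))"
    unfolding sc_sum_left by (intro sum.cong refl) (use ij in \<open>simp add: coord coord_cnj mult.commute\<close>)
  also have "\<dots> = st (t i) * (\<Sum>k=1..n. s k * st (s k)) * t j"
    by (simp add: sum_distrib_left sum_distrib_right mult.assoc)
  also have "\<dots> = sc (if i = j then 1 else 0) 1" using st_s_s[OF ij] by (simp only: B.sum_s) auto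
  finally show "(\<Sum>k=1..n. coord i k * cnj (coord j k)) = (if i = j then 1 else 0)" by (simp only: sc_one_inject)
qed

text \<open>In this form it is visibly the unitary taking each \<open>t i\<close> to
  \<open>s i\<close>, and therefore the one by which \<open>hom\<close> multiplies columns.\<close>

lemma unit_of_mat_eq: "unit_of_mat st sc n s coord = (\<Sum>i=1..n. s i * st (t i))"
proof -
  have "(\<Sum>j=1..n. sc (coord i j) (s i * st (s j))) = s i * st (t i)" if i: "i \<in> {1..n}" for i
  proof -
    have "(\<Sum>j=1..n. sc (coord i j) (s i * st (s j))) = (\<Sum>j=1..n. s i * (st (t i) * s j) * st (s j))"
      by (intro sum.cong refl) (use i in \<open>simp add: coord\<close>)
    also have "\<dots> = s i * st (t i) * (\<Sum>j=1..n. s j * st (s j))" by (simp add: sum_distrib_left mult.assoc)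
    finally show ?thesis by (simp only: B.sum_s mult_1_right)
  qed
  then show ?thesis unfolding unit_of_mat_def by (intro sum.cong refl)
qed

lemma s_expand: assumes "j \<in> {1..n}" shows "s j = (\<Sum>i=1..n. sc (coord i j) (t i))"
proof -
  have "s j = (\<Sum>i=1..n. t i * (st (t i) * s j))"
    using expand_left[of "s j" 1] unfolding sum_words_1 smon_singleton .
  also have "\<dots> = (\<Sum>i=1..n. sc (coord i j) (t i))" by (intro sum.cong refl) (use assms in \<open>simp add: coord\<close>)
  finally show ?thesis .
qed

lemma alg_eq: "alg = B.alg"
proof
  show "alg \<subseteq> B.alg" unfolding cuntz_def[of _ _ _ t]
    by (rule gen_least[OF B.alg_sub]) (auto intro: B.H_alg t_column)
  have "s j \<in> alg" if "j \<in> {1..n}" for j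
    by (subst s_expand[OF that]) (intro subalg_sum alg_sub subalgD(5)[OF alg_sub] s_alg)
  then show "B.alg \<subseteq> alg" unfolding cuntz_def[of _ _ _ s] by (intro gen_least[OF alg_sub]) auto
qed

lemma star_auto_hom: "star_auto st sc B.alg hom"
proof -
  have "star_endo st sc alg hom"
    unfolding star_endo_def using hom_alg alg_eq by (auto simp: hom_add hom_mult hom_sc hom_st)
  then show ?thesis using bij_hom unfolding star_auto_def alg_eq by blast
qed

lemma hom_s_eq: assumes "j \<in> {1..n}" shows "hom (s j) = unit_of_mat st sc n s coord * s j"
proof -
  have m: "sc (coord i j) (t i) \<in> alg" if "i \<in> {1..n}" for i
    by (intro subalgD(5)[OF alg_sub] s_alg that)
  have "hom (s j) = (\<Sum>i=1..n. hom (sc (coord i j) (t i)))"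
    by (subst s_expand[OF assms]) (rule hom_sum[OF finite_atLeastAtMost m])
  also have "\<dots> = (\<Sum>i=1..n. s i * (st (t i) * s j))"
    by (intro sum.cong refl) (use assms in \<open>simp add: hom_sc s_alg hom_s coord\<close>)
  finally show ?thesis unfolding unit_of_mat_eq by (simp add: sum_distrib_right mult.assoc)
qed

lemma t_intertwine: assumes "i \<in> {1..n}"
  shows "t i * x = B.sh 1 x * t i" "st (t i) * B.sh 1 x = x * st (t i)"
  using B.intertwine[OF t_column[OF assms], of x] B.intertwine[OF B.H_st[OF t_column[OF assms]], of x] by simp_all

text \<open>Independence of the orthonormal basis: \<open>t i\<close> intertwines \<open>x\<close>
  with \<open>B.sh 1 x\<close>, and what remains is the sum of the range projections.\<close>

lemma sh_eq: "sh 1 x = B.sh 1 x"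
proof -
  have "sh 1 x = (\<Sum>i=1..n. t i * x * st (t i))" unfolding sh_1 cshift_def ..
  also have "\<dots> = (\<Sum>i=1..n. B.sh 1 x * (t i * st (t i)))"
    by (intro sum.cong refl) (simp add: t_intertwine(1) mult.assoc)
  also have "\<dots> = B.sh 1 x" by (simp only: sum_s mult_1_right flip: sum_distrib_left)
  finally show ?thesis .
qed

lemma cshift_eq: "cshift st n t x = cshift st n s x"
  using sh_eq by (simp only: sh_1 B.sh_1)

text \<open>Basis independence of one half of the second shift: the coefficients
  \<open>st (s k) * t i\<close> are scalars and move inside the shift, where the sum over
  \<open>i\<close> collapses to 1.\<close>

lemma sum_left_eq: "(\<Sum>i=1..n. t i * B.sh 1 (st (t i) * z)) = (\<Sum>k=1..n. s k * B.sh 1 (st (s k) * z))"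
proof -
  have "t i * B.sh 1 (st (t i) * z) = (\<Sum>k=1..n. s k * B.sh 1 (st (s k) * (t i * st (t i)) * z))" if i: "i \<in> {1..n}" for i
  proof -
    have "t i = (\<Sum>k=1..n. s k * (st (s k) * t i))"
      using B.expand_left[of "t i" 1] unfolding sum_words_1 smon_singleton .
    then have "t i * B.sh 1 (st (t i) * z) = (\<Sum>k=1..n. s k * (st (s k) * t i)) * B.sh 1 (st (t i) * z)" by simp
    also have "\<dots> = (\<Sum>k=1..n. s k * ((st (s k) * t i) * B.sh 1 (st (t i) * z)))"
      by (simp add: sum_distrib_right mult.assoc)
    also have "\<dots> = (\<Sum>k=1..n. s k * B.sh 1 ((st (s k) * t i) * (st (t i) * z)))"
      by (intro sum.cong refl) (use i in \<open>simp add: coord_cnj B.sh_sc\<close>)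
    finally show ?thesis by (simp add: mult.assoc)
  qed
  then have "(\<Sum>i=1..n. t i * B.sh 1 (st (t i) * z)) = (\<Sum>i=1..n. \<Sum>k=1..n. s k * B.sh 1 (st (s k) * (t i * st (t i)) * z))"
    by (intro sum.cong refl)
  also have "\<dots> = (\<Sum>k=1..n. \<Sum>i=1..n. s k * B.sh 1 (st (s k) * (t i * st (t i)) * z))" by (rule sum.swap)
  also have "\<dots> = (\<Sum>k=1..n. s k * B.sh 1 (st (s k) * (\<Sum>i=1..n. t i * st (t i)) * z))"
    by (simp add: B.sh_sum sum_distrib_left sum_distrib_right)
  finally show ?thesis by (simp only: sum_s mult_1_right)
qed

lemma sum_right_eq: "(\<Sum>i=1..n. B.sh 1 (z * t i) * st (t i)) = (\<Sum>k=1..n. B.sh 1 (z * s k) * st (s k))"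
  using arg_cong[OF sum_left_eq[of "st z"], of st] by (simp add: st_sum flip: B.sh_st)

lemma cshift2_eq': "cshift2 st n t x = cshift2 st n s x"
proof -
  have "cshift2 st n t x = (\<Sum>i=1..n. \<Sum>j=1..n. t i * B.sh 1 (st (t i) * (x * t j)) * st (t j))"
    by (simp add: cshift2_eq sh2_def sh_eq mult.assoc)
  also have "\<dots> = (\<Sum>j=1..n. (\<Sum>i=1..n. t i * B.sh 1 (st (t i) * (x * t j))) * st (t j))"
    by (subst sum.swap) (simp add: sum_distrib_right)
  also have "\<dots> = (\<Sum>j=1..n. (\<Sum>k=1..n. s k * B.sh 1 (st (s k) * (x * t j))) * st (t j))"
    by (simp only: sum_left_eq)
  also have "\<dots> = (\<Sum>k=1..n. s k * (\<Sum>j=1..n. B.sh 1 ((st (s k) * x) * t j) * st (t j)))"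
    unfolding sum_distrib_left sum_distrib_right by (subst sum.swap) (simp add: mult.assoc)
  also have "\<dots> = (\<Sum>k=1..n. s k * (\<Sum>j=1..n. B.sh 1 ((st (s k) * x) * s j) * st (s j)))"
    by (simp only: sum_right_eq)
  also have "\<dots> = cshift2 st n s x"
    by (simp add: B.cshift2_eq B.sh2_def sum_distrib_left mult.assoc)
  finally show ?thesis .
qed

text \<open>The projection of \<open>i # \<mu>\<close> is \<open>t i * st (t i)\<close> times the
  shifted projection of \<open>\<mu>\<close>, so one-letter projections and shift invariance produce
  all of them.\<close>

lemma proj_in:
  assumes A: "cstar_sub st sc A" "1 \<in> A" and p: "\<And>i. i \<in> {1..n} \<Longrightarrow> t i * st (t i) \<in> A"
    and sh: "\<And>x. x \<in> A \<Longrightarrow> cshift st n s x \<in> A"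
  shows "D \<subseteq> A"
proof -
  have "set \<mu> \<subseteq> {1..n} \<Longrightarrow> proj \<mu> \<in> A" for \<mu>
  proof (induction \<mu>)
    case (Cons i \<mu>)
    then have i: "i \<in> {1..n}" and IH: "proj \<mu> \<in> A" by auto
    have "proj (i # \<mu>) = t i * (proj \<mu> * st (t i))" by (simp add: mult.assoc)
    also have "\<dots> = t i * st (t i) * B.sh 1 (proj \<mu>)" by (simp only: t_intertwine(2)[OF i] mult.assoc)
    also have "\<dots> \<in> A" by (intro subalgD(4)[OF A(1)] p i) (simp add: B.sh_1 sh IH)
    finally show ?case .
  qed (simp add: A)
  then show ?thesis unfolding diag_def[of _ _ _ t] by (intro gen_least[OF A(1)]) auto
qed

text \<open>The image of \<open>A\<close> is an abelian algebra containing the maximal abelian \<open>B.D\<close>.\<close>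
lemma hom_image_diag:
  assumes A: "A \<subseteq> alg" "D \<subseteq> A" and comm: "\<And>x y. x \<in> A \<Longrightarrow> y \<in> A \<Longrightarrow> x * y = y * x"
  shows "hom ` A = B.D"
proof
  interpret rev: cuntz_pair st sc n s t by (rule swap)
  have rev_hom: "rev.hom d \<in> A" "hom (rev.hom d) = d" if "d \<in> B.D" for d
    using rev.hom_diag[OF that] A rev.swap_hom_hom B.D_alg that by blast+
  show "B.D \<subseteq> hom ` A" using rev_hom by (metis image_eqI subsetI)
  show "hom ` A \<subseteq> B.D"
  proof safe
    fix x assume x: "x \<in> A"
    show "hom x \<in> B.D"
    proof (rule B.diag_maximal)
      show "hom x \<in> B.alg" using x A(1) hom_alg by blast
      fix d assume d: "d \<in> B.D"
      have alg: "rev.hom d \<in> alg" "x \<in> alg" using rev_hom(1)[OF d] x A by auto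
      have "hom (rev.hom d * x) = hom (x * rev.hom d)" using comm[OF rev_hom(1)[OF d] x] by simp
      then show "d * hom x = hom x * d" by (simp only: hom_mult[OF alg] hom_mult[OF alg(2,1)] rev_hom(2)[OF d])
    qed
  qed
qed

end

theorem theorem4p5:
  fixes st :: "'a::{real_normed_algebra_1,banach} \<Rightarrow> 'a"
    and sc :: "complex \<Rightarrow> 'a \<Rightarrow> 'a"
    and n :: nat and s :: "nat \<Rightarrow> 'a" and A :: "'a set"
  assumes "cstar_alg st sc"
    and "n \<ge> 2"
    and "cuntz_family st n s"
    and "masa st sc (cuntz st sc n s) A"
    and "masa st sc (gauge_fixed st sc n s) (A \<inter> gauge_fixed st sc n s)"
    and "cshift st n s ` A \<subseteq> A"
    and "cshift2 st n s ` A \<subseteq> A"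
  shows "\<exists>u. unitary_mat n u \<and>
           (\<exists>\<alpha>. star_auto st sc (cuntz st sc n s) \<alpha> \<and>
                 (\<forall>i\<in>{1..n}. \<alpha> (s i) = unit_of_mat st sc n s u * s i) \<and>
                 \<alpha> ` A = diag st sc n s \<and>
                 (\<forall>x\<in>cuntz st sc n s. \<alpha> (cshift st n s x) = cshift st n s (\<alpha> x)) \<and>
                 (\<forall>x\<in>cuntz st sc n s. \<alpha> (cshift2 st n s x) = cshift2 st n s (\<alpha> x)))"
proof -
  interpret cuntz_alg st sc n s by unfold_locales (fact assms)+
  have A: "cstar_sub st sc A" "A \<subseteq> alg" "\<And>x y. x \<in> A \<Longrightarrow> y \<in> A \<Longrightarrow> x * y = y * x"
    using assms(4) unfolding masa_def by blast+
  define A0 where "A0 = A \<inter> core"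
  have A0: "masa st sc core A0" using assms(5) by (simp add: gauge_fixed_eq A0_def)
  have sh2_A: "sh2 k a \<in> A" if "a \<in> A" for k a
  proof (induction k)
    case (Suc k)
    have "cshift2 st n s (sh2 k a) \<in> A" using Suc assms(7) by blast
    then show ?case by (simp add: cshift2_eq sh2_sh2 plus_1_eq_Suc)
  qed (simp add: that)
  have H_1_A: "x \<in> A" if "x \<in> H 1 1" "\<And>d. d \<in> A \<Longrightarrow> d \<in> H 1 1 \<Longrightarrow> x * d = d * x" for x
  proof -
    have "x \<in> A0"
      by (rule H_1_commutant[OF A0 _ that(1)]) (use A(3) sh2_A that(2) in \<open>auto simp: A0_def\<close>)
    then show ?thesis by (simp add: A0_def)
  qed
  \<comment> \<open>\<open>cstar_sub\<close> does not include the unit; as 1 commutes with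
    everything, maximality supplies it.\<close>
  have one_A: "1 \<in> A" by (rule H_1_A[OF H_1]) simp
  define E where "E = A \<inter> H 1 1"
  have E: "E \<subseteq> H 1 1" "1 \<in> E" "\<And>x y. x \<in> E \<Longrightarrow> y \<in> E \<Longrightarrow> x + y \<in> E" "\<And>x y. x \<in> E \<Longrightarrow> y \<in> E \<Longrightarrow> x * y \<in> E"
    "\<And>x a. x \<in> E \<Longrightarrow> sc a x \<in> E" "\<And>x. x \<in> E \<Longrightarrow> st x \<in> E" "\<And>x y. x \<in> E \<Longrightarrow> y \<in> E \<Longrightarrow> x * y = y * x"
    using one_A A(3) by (auto simp: E_def H_1 subalgD[OF A(1)] H_add H_sc H_st intro: H_mult)
  obtain t where t: "cuntz_family st n t" "\<And>i. i \<in> {1..n} \<Longrightarrow> t i \<in> H 1 0"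
    "\<And>i d. i \<in> {1..n} \<Longrightarrow> d \<in> E \<Longrightarrow> \<exists>z. d * t i = sc z (t i)"
    by (rule eigenbasis[OF E]) blast+
  interpret T: cuntz_rotation st sc n t s
    by unfold_locales (use t assms(2) in auto)
  \<comment> \<open>\<open>t i\<close> is an eigenvector of both \<open>d\<close> and
    \<open>st d\<close>, with conjugate eigenvalues, so \<open>d\<close> multiplies the range
    projection by the same scalar from either side.\<close>
  have "t i * st (t i) \<in> A" if i: "i \<in> {1..n}" for i
  proof (rule H_1_A)
    show "t i * st (t i) \<in> H 1 1" by (rule H_mult[OF t(2)[OF i] H_st[OF t(2)[OF i]]])
    fix d assume "d \<in> A" "d \<in> H 1 1"
    then have d: "d \<in> E" by (simp add: E_def)
    obtain z where z: "d * t i = sc z (t i)" using t(3)[OF i d] by blast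
    obtain w where "st d * t i = sc w (t i)" using t(3)[OF i E(6)[OF d]] by blast
    from arg_cong[OF this, of st] have w: "st (t i) * d = sc (cnj w) (st (t i))" by simp
    have "sc z 1 = st (t i) * (d * t i)" using T.isom_s[OF i] by (simp add: z)
    also have "\<dots> = sc (cnj w) 1" using T.isom_s[OF i] by (simp add: w flip: mult.assoc)
    finally have zw: "z = cnj w" by simp
    have "t i * st (t i) * d = sc (cnj w) (t i * st (t i))" by (simp add: mult.assoc w)
    also have "\<dots> = d * (t i * st (t i))" by (simp add: z zw flip: mult.assoc)
    finally show "t i * st (t i) * d = d * (t i * st (t i))" .
  qed
  then have D_A: "T.D \<subseteq> A" using assms(6) by (intro T.proj_in A(1) one_A) auto
  have A_alg: "A \<subseteq> T.alg" using A(2) T.alg_eq by simp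
  show ?thesis
  proof (intro exI conjI ballI)
    show "unitary_mat n T.coord" by (rule T.unitary_mat)
    show "star_auto st sc alg T.hom" by (rule T.star_auto_hom)
    show "T.hom (s i) = unit_of_mat st sc n s T.coord * s i" if "i \<in> {1..n}" for i by (rule T.hom_s_eq[OF that])
    show "T.hom ` A = D" by (rule T.hom_image_diag[OF A_alg D_A A(3)])
    fix x assume "x \<in> alg"
    then have x: "x \<in> T.alg" by (simp add: T.alg_eq)
    show "T.hom (cshift st n s x) = cshift st n s (T.hom x)"
      using T.hom_cshift[OF x] by (simp add: T.cshift_eq)
    show "T.hom (cshift2 st n s x) = cshift2 st n s (T.hom x)"
      using T.hom_cshift2[OF x] by (simp add: T.cshift2_eq')
  qed
qed

end
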